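(* Let $A$ be a semiprime torsion-free associative SGPI-algebra over $F$ satisfying one of the conditions: $A$ is prime; $A$ is weakly Noetherian; $A$ is finitely cogenerated as an $M(A)$-module. Suppose that the set $\mathcal E(A)$ of essential ideals of $A$ is closed under countable intersections and that ${}_AC$ is integral over $F$. Let $D\in\mathrm{Der}(A)$ be such that at least one of the following holds: $D$ is a nil-derivation; or $D$ is algebraic over $F$ and $F$ is an algebraically closed field of characteristic $0$. Then $D\in{}_AC\,\mathrm{Der}(A)\cap\mathrm{Inder}(Q^s_m(A))$.
   Context: $F$ is an associative commutative ring with 1; derivations are $F$-linear and written on the right. $A$ is semiprime if $I^2\ne\{0\}$ for every nonzero ideal $I$, prime if $IJ\neq\{0\}$ for all nonzero ideals $I,J$. Torsion-free means that the additive group has no torsion. Weakly Noetherian: ascending chain condition on two-sided ideals. Finitely cogenerated as an $M(A)$-module: every family of ideals of $A$ with zero intersection has a finite subfamily with zero intersection. An ideal is essential if it meets every nonzero ideal nontrivially. $Q(A)$ is the maximal (Utumi) right ring of quotients; $Q^s_m(A)$ is the subring of those $q\in Q(A)$ with $qI+Iq\subseteq A$ for some essential ideal $I$; ${}_AC=Z(Q^s_m(A))=Z(Q(A))$. Every derivation of $A$ extends uniquely to $Q^s_m(A)$, and $\mathrm{Der}(A)$ is identified with a subset of $\mathrm{Der}(Q^s_m(A))$; ${}_AC\,\mathrm{Der}(A)$ is the set of finite sums $\sum c_iD_i$ with $c_i\in{}_AC$, $D_i\in\mathrm{Der}(A)$, $cD:x\mapsto c(xD)$; $\mathrm{Inder}(Q^s_m(A))=\{x\mapsto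 xq-qx\mid q\in Q^s_m(A)\}$. ${}_AC$ is integral over $F$ if each $c\in{}_AC$ is a root of a monic polynomial $t^n+f_{n-1}t^{n-1}+\dots+f_1t\in F[t]$, $n\geq 1$. $D$ is a nil-derivation if for each $x\in A$ there is $n\ge1$ with $xD^n=0$. $D$ is algebraic over $F$ if for each $x\in A$ there is a monic $f(t)=t^n+\dots+f_1t\in F[t]$, $n\ge 1$, with $x f(D)=0$. $A$ is an SGPI-algebra if there is $f$ in the free product $Q(A)\langle X\rangle_{{}_AC}$ (coproduct of unital ${}_AC$-algebras $Q(A)$ and the free associative algebra on $X=\{x_1,x_2,\dots\}$) such that $cf\ne0$ for all $0\ne c\in{}_AC$ and $\phi(f)=0$ for every ring homomorphism $\phi:Q(A)\langle X\rangle_{{}_AC}\to Q(A)$ with $\phi(X)\subseteq A$, $\phi|_{Q(A)}=\mathrm{Id}$. *)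

theory Defs
  imports "HOL-Library.FuncSet" "HOL-Computational_Algebra.Polynomial"
begin

section \<open>The maximal (Utumi) right ring of quotients\<close>

definition right_ideal :: "'a::ring set \<Rightarrow> bool" where
  "right_ideal J \<longleftrightarrow> 0 \<in> J \<and> (\<forall>x\<in>J. \<forall>y\<in>J. x - y \<in> J) \<and> (\<forall>x\<in>J. \<forall>r. x * r \<in> J)"

definition dense_right_ideal :: "'a::ring set \<Rightarrow> bool" where
  "dense_right_ideal J \<longleftrightarrow>
     right_ideal J \<and> (\<forall>x y. x \<noteq> 0 \<longrightarrow> (\<exists>r. x * r \<noteq> 0 \<and> y * r \<in> J))"

text \<open>
  The ring of quotients consists of the right module homomorphisms defined on dense right ideals,
  two of them being identified if they agree on a dense right ideal.  The whole ring is always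
  admitted as a domain.  This makes the construction total: if the left annihilator of the ring
  is zero (in particular if the ring is semiprime) then the whole ring is dense
  and the extra clause is redundant; otherwise there is no dense right ideal at all.
\<close>

definition quotient_domain :: "'a::ring set \<Rightarrow> bool" where
  "quotient_domain J \<longleftrightarrow> dense_right_ideal J \<or> J = UNIV"

lemma quotient_domain_iff_dense:
  fixes J :: "'a::ring set"
  assumes "\<And>x::'a. (\<And>r. x * r = 0) \<Longrightarrow> x = 0"
  shows "quotient_domain J \<longleftrightarrow> dense_right_ideal J"
  using assms unfolding quotient_domain_def dense_right_ideal_def right_ideal_def by auto

definition partial_right_hom :: "'a::ring set \<times> ('a \<Rightarrow> 'a) \<Rightarrow> bool" where
  "partial_right_hom = (\<lambda>(J, f). quotient_domain J \<and>
     (\<forall>x\<in>J. \<forall>y\<in>J. f (x + y) = f x + f y) \<and> (\<forall>x\<in>J. \<forall>r. f (x * r) = f x * r))"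

definition utumi_rel :: "'a::ring set \<times> ('a \<Rightarrow> 'a) \<Rightarrow> 'a set \<times> ('a \<Rightarrow> 'a) \<Rightarrow> bool" where
  "utumi_rel p q \<longleftrightarrow> partial_right_hom p \<and> partial_right_hom q \<and>
     (\<exists>K. quotient_domain K \<and> K \<subseteq> fst p \<inter> fst q \<and> (\<forall>x\<in>K. snd p x = snd q x))"

lemma quotient_domain_right_ideal: "quotient_domain J \<Longrightarrow> right_ideal J"
  by (auto simp: quotient_domain_def dense_right_ideal_def right_ideal_def)

lemma right_idealD:
  assumes "right_ideal J"
  shows "0 \<in> J" "x \<in> J \<Longrightarrow> y \<in> J \<Longrightarrow> x - y \<in> J" "x \<in> J \<Longrightarrow> x * r \<in> J"
    "x \<in> J \<Longrightarrow> - x \<in> J" "x \<in> J \<Longrightarrow> y \<in> J \<Longrightarrow> x + y \<in> J"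
proof -
  have 0: "0 \<in> J" and d: "\<And>x y. x \<in> J \<Longrightarrow> y \<in> J \<Longrightarrow> x - y \<in> J"
    using assms by (auto simp: right_ideal_def)
  have m: "- x \<in> J" if "x \<in> J" for x using d[OF 0 that] by simp
  show "0 \<in> J" by (rule 0)
  show "x - y \<in> J" if "x \<in> J" "y \<in> J" using d that .
  show "x * r \<in> J" if "x \<in> J" using assms that by (auto simp: right_ideal_def)
  show "- x \<in> J" if "x \<in> J" using m that .
  show "x + y \<in> J" if "x \<in> J" "y \<in> J" using d[OF that(1) m[OF that(2)]] by simp
qed

lemma partial_right_homD:
  assumes "partial_right_hom (J, f)"
  shows "quotient_domain J" "right_ideal J"
    "x \<in> J \<Longrightarrow> y \<in> J \<Longrightarrow> f (x + y) = f x + f y" "x \<in> J \<Longrightarrow> f (x * r) = f x * r"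
    "f 0 = 0" "x \<in> J \<Longrightarrow> f (- x) = - f x" "x \<in> J \<Longrightarrow> y \<in> J \<Longrightarrow> f (x - y) = f x - f y"
proof -
  show q: "quotient_domain J" and add: "x \<in> J \<Longrightarrow> y \<in> J \<Longrightarrow> f (x + y) = f x + f y"
    and "x \<in> J \<Longrightarrow> f (x * r) = f x * r" for x y
    using assms by (auto simp: partial_right_hom_def)
  show r: "right_ideal J" using q by (rule quotient_domain_right_ideal)
  show z: "f 0 = 0" using add[of 0 0] right_idealD(1)[OF r] by simp
  have m: "f (- x) = - f x" if "x \<in> J" for x
    using add[of x "- x"] right_idealD(4)[OF r] that z by (simp add: eq_neg_iff_add_eq_0 add.commute)
  show "x \<in> J \<Longrightarrow> f (- x) = - f x" by (rule m)
  show "x \<in> J \<Longrightarrow> y \<in> J \<Longrightarrow> f (x - y) = f x - f y"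
    using add[of x "- y"] m right_idealD(4)[OF r] by simp
qed

lemma quotient_domain_UNIV [simp]: "quotient_domain UNIV"
  by (simp add: quotient_domain_def)

lemma quotient_domain_preimage:
  assumes f: "partial_right_hom (J, f)" and K: "quotient_domain K"
  shows "quotient_domain {x \<in> J. f x \<in> K}"
proof (cases "dense_right_ideal J \<or> dense_right_ideal K")
  case False
  then show ?thesis using partial_right_homD(1)[OF f] K by (simp add: quotient_domain_def)
next
  case True
  have dense: "\<exists>r. x * r \<noteq> 0 \<and> y * r \<in> L" if "quotient_domain L" "x \<noteq> 0" for L :: "'a set" and x y
  proof (cases "dense_right_ideal L")
    case True then show ?thesis using that(2) by (simp add: dense_right_ideal_def)
  next
    case False
    then have "L = UNIV" using that(1) by (simp add: quotient_domain_def)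
    moreover have "\<exists>r. x * r \<noteq> 0"
      using \<open>dense_right_ideal J \<or> dense_right_ideal K\<close> that(2)
      by (auto simp: dense_right_ideal_def)
    ultimately show ?thesis by auto
  qed
  note J = partial_right_homD[OF f]
  note JI = right_idealD[OF J(2)]
  note KI = right_idealD[OF quotient_domain_right_ideal[OF K]]
  have "\<exists>r. x * r \<noteq> 0 \<and> y * r \<in> {x \<in> J. f x \<in> K}" if x: "x \<noteq> 0" for x y
  proof -
    obtain r where r: "x * r \<noteq> 0" "y * r \<in> J" using dense[OF J(1) x] by blast
    obtain s where s: "x * r * s \<noteq> 0" "f (y * r) * s \<in> K" using dense[OF K r(1)] by blast
    have "x * (r * s) \<noteq> 0" using s(1) by (simp add: mult.assoc)
    moreover have "y * (r * s) \<in> J" using JI(3)[OF r(2), of s] by (simp add: mult.assoc)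
    moreover have "f (y * (r * s)) \<in> K" using J(4)[OF r(2), of s] s(2) by (simp add: mult.assoc)
    ultimately show ?thesis by blast
  qed
  moreover have "right_ideal {x \<in> J. f x \<in> K}"
    unfolding right_ideal_def using J JI KI by auto
  ultimately show ?thesis by (simp add: quotient_domain_def dense_right_ideal_def)
qed

lemma quotient_domain_Int:
  assumes "quotient_domain J" "quotient_domain K"
  shows "quotient_domain (J \<inter> K)"
proof -
  have "partial_right_hom (J, \<lambda>x. x)" using assms(1) by (simp add: partial_right_hom_def)
  from quotient_domain_preimage[OF this assms(2)] show ?thesis by (simp add: Int_def)
qed

lemma utumi_relI:
  assumes "partial_right_hom (J, f)" "partial_right_hom (J', g)" "quotient_domain K"
    "K \<subseteq> J" "K \<subseteq> J'" "\<And>x. x \<in> K \<Longrightarrow> f x = g x"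
  shows "utumi_rel (J, f) (J', g)"
  using assms by (auto simp: utumi_rel_def)

lemma utumi_relE:
  assumes "utumi_rel (J, f) (J', g)"
  obtains K where "partial_right_hom (J, f)" "partial_right_hom (J', g)" "quotient_domain K"
    "K \<subseteq> J" "K \<subseteq> J'" "\<forall>x\<in>K. f x = g x"
  using assms by (auto simp: utumi_rel_def)

lemma partial_right_hom_id: "partial_right_hom (UNIV, \<lambda>x. x)"
  by (simp add: partial_right_hom_def)

lemma part_equivp_utumi_rel: "part_equivp (utumi_rel :: 'a::ring set \<times> ('a \<Rightarrow> 'a) \<Rightarrow> _)"
proof (rule part_equivpI)
  show "\<exists>x :: 'a set \<times> ('a \<Rightarrow> 'a). utumi_rel x x"
    using utumi_relI[OF partial_right_hom_id partial_right_hom_id, of UNIV] by auto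
  show "symp (utumi_rel :: 'a set \<times> ('a \<Rightarrow> 'a) \<Rightarrow> _)"
  proof (rule sympI)
    fix p q :: "'a set \<times> ('a \<Rightarrow> 'a)"
    assume "utumi_rel p q"
    then show "utumi_rel q p" unfolding utumi_rel_def by (metis Int_commute)
  qed
  show "transp (utumi_rel :: 'a set \<times> ('a \<Rightarrow> 'a) \<Rightarrow> _)"
  proof (rule transpI)
    fix p q r :: "'a set \<times> ('a \<Rightarrow> 'a)"
    assume "utumi_rel p q" "utumi_rel q r"
    then obtain K L where *: "partial_right_hom p" "partial_right_hom r"
      "quotient_domain K" "K \<subseteq> fst p \<inter> fst q" "\<forall>x\<in>K. snd p x = snd q x"
      "quotient_domain L" "L \<subseteq> fst q \<inter> fst r" "\<forall>x\<in>L. snd q x = snd r x"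
      unfolding utumi_rel_def by blast
    show "utumi_rel p r" unfolding utumi_rel_def
      using * quotient_domain_Int[OF *(3) *(6)] by (intro conjI exI[of _ "K \<inter> L"]) auto
  qed
qed

quotient_type (overloaded) 'a utumi = "'a::ring set \<times> ('a \<Rightarrow> 'a)" / partial: utumi_rel
  by (rule part_equivp_utumi_rel)

lemma partial_right_hom_add:
  "partial_right_hom (J, f) \<Longrightarrow> partial_right_hom (K, g) \<Longrightarrow>
     partial_right_hom (J \<inter> K, \<lambda>x. f x + g x)"
  by (auto simp: partial_right_hom_def quotient_domain_Int algebra_simps)

lemma partial_right_hom_uminus:
  "partial_right_hom (J, f) \<Longrightarrow> partial_right_hom (J, \<lambda>x. - f x)"
  by (auto simp: partial_right_hom_def)

lemma partial_right_hom_comp: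
  assumes f: "partial_right_hom (J, f)" and g: "partial_right_hom (K, g)"
  shows "partial_right_hom ({x \<in> K. g x \<in> J}, \<lambda>x. f (g x))"
  using quotient_domain_preimage[OF g partial_right_homD(1)[OF f]]
    partial_right_homD[OF f] partial_right_homD[OF g]
  by (auto simp: partial_right_hom_def)

lemma partial_right_hom_zero: "partial_right_hom (UNIV, \<lambda>x. 0)"
  by (simp add: partial_right_hom_def)

lemma utumi_rel_refl: "partial_right_hom (J, f) \<Longrightarrow> utumi_rel (J, f) (J, f)"
  by (rule utumi_relI[where K = J]) (auto dest: partial_right_homD)

instantiation utumi :: (ring) "{ring, monoid_mult}"
begin

lift_definition zero_utumi :: "'a utumi" is "(UNIV, \<lambda>x. 0)"
  by (rule utumi_rel_refl[OF partial_right_hom_zero])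

lift_definition one_utumi :: "'a utumi" is "(UNIV, \<lambda>x. x)"
  by (rule utumi_rel_refl[OF partial_right_hom_id])

lift_definition plus_utumi :: "'a utumi \<Rightarrow> 'a utumi \<Rightarrow> 'a utumi"
  is "\<lambda>(J, f) (K, g). (J \<inter> K, \<lambda>x. f x + g x)"
proof clarsimp
  fix J J' K K' :: "'a set" and f f' g g' :: "'a \<Rightarrow> 'a"
  assume "utumi_rel (J, f) (J', f')" "utumi_rel (K, g) (K', g')"
  then obtain M N where
    M: "partial_right_hom (J, f)" "partial_right_hom (J', f')" "quotient_domain M"
      "M \<subseteq> J" "M \<subseteq> J'" "\<forall>x\<in>M. f x = f' x" and
    N: "partial_right_hom (K, g)" "partial_right_hom (K', g')" "quotient_domain N"
      "N \<subseteq> K" "N \<subseteq> K'" "\<forall>x\<in>N. g x = g' x"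
    by (elim utumi_relE) blast
  show "utumi_rel (J \<inter> K, \<lambda>x. f x + g x) (J' \<inter> K', \<lambda>x. f' x + g' x)"
    by (rule utumi_relI[where K = "M \<inter> N"])
      (use M N in \<open>auto intro!: partial_right_hom_add quotient_domain_Int\<close>)
qed

lift_definition uminus_utumi :: "'a utumi \<Rightarrow> 'a utumi"
  is "\<lambda>(J, f). (J, \<lambda>x. - f x)"
proof clarsimp
  fix J J' :: "'a set" and f f' :: "'a \<Rightarrow> 'a"
  assume "utumi_rel (J, f) (J', f')"
  then obtain M where
    M: "partial_right_hom (J, f)" "partial_right_hom (J', f')" "quotient_domain M"
      "M \<subseteq> J" "M \<subseteq> J'" "\<forall>x\<in>M. f x = f' x"
    by (elim utumi_relE) blast
  show "utumi_rel (J, \<lambda>x. - f x) (J', \<lambda>x. - f' x)"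
    by (rule utumi_relI[where K = M]) (use M in \<open>auto intro!: partial_right_hom_uminus\<close>)
qed

definition minus_utumi :: "'a utumi \<Rightarrow> 'a utumi \<Rightarrow> 'a utumi" where
  "minus_utumi p q = p + - q"

lift_definition times_utumi :: "'a utumi \<Rightarrow> 'a utumi \<Rightarrow> 'a utumi"
  is "\<lambda>(J, f) (K, g). ({x \<in> K. g x \<in> J}, \<lambda>x. f (g x))"
proof clarsimp
  fix J J' K K' :: "'a set" and f f' g g' :: "'a \<Rightarrow> 'a"
  assume "utumi_rel (J, f) (J', f')" "utumi_rel (K, g) (K', g')"
  then obtain M N where
    M: "partial_right_hom (J, f)" "partial_right_hom (J', f')" "quotient_domain M"
      "M \<subseteq> J" "M \<subseteq> J'" "\<forall>x\<in>M. f x = f' x" and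
    N: "partial_right_hom (K, g)" "partial_right_hom (K', g')" "quotient_domain N"
      "N \<subseteq> K" "N \<subseteq> K'" "\<forall>x\<in>N. g x = g' x"
    by (elim utumi_relE) blast
  have "quotient_domain ({x \<in> K. g x \<in> M} \<inter> N)"
    using N M by (intro quotient_domain_Int quotient_domain_preimage)
  then show "utumi_rel ({x \<in> K. g x \<in> J}, \<lambda>x. f (g x)) ({x \<in> K'. g' x \<in> J'}, \<lambda>x. f' (g' x))"
    by (rule utumi_relI[rotated 2])
      (use M N in \<open>auto intro!: partial_right_hom_comp\<close>)
qed

lemma utumi_rel_self: "utumi_rel (J, f) (J, f) \<longleftrightarrow> partial_right_hom (J, f)"
  using utumi_rel_refl by (auto simp: utumi_rel_def)

lemma utumi_rel_eqI:
  assumes "partial_right_hom (J, f)" "partial_right_hom (K, g)"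
    "\<And>x. x \<in> J \<Longrightarrow> x \<in> K \<Longrightarrow> f x = g x"
  shows "utumi_rel (J, f) (K, g)"
  using assms by (intro utumi_relI[where K = "J \<inter> K"] quotient_domain_Int)
    (auto dest: partial_right_homD)

instance
proof
  note add = partial_right_hom_add and minus = partial_right_hom_uminus
    and comp = partial_right_hom_comp
  fix a b c :: "'a utumi"
  show "a + b + c = a + (b + c)"
  proof (transfer, clarsimp simp only: utumi_rel_self split)
    fix J K L :: "'a set" and f g h :: "'a \<Rightarrow> 'a"
    assume f: "partial_right_hom (J, f)" and g: "partial_right_hom (K, g)"
      and h: "partial_right_hom (L, h)"
    show "utumi_rel (J \<inter> K \<inter> L, \<lambda>x. f x + g x + h x) (J \<inter> (K \<inter> L), \<lambda>x. f x + (g x + h x))"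
      by (rule utumi_rel_eqI[OF add[OF add[OF f g] h] add[OF f add[OF g h]]]) (simp add: add.assoc)
  qed
  show "a + b = b + a"
  proof (transfer, clarsimp simp only: utumi_rel_self split)
    fix J K :: "'a set" and f g :: "'a \<Rightarrow> 'a"
    assume f: "partial_right_hom (J, f)" and g: "partial_right_hom (K, g)"
    show "utumi_rel (J \<inter> K, \<lambda>x. f x + g x) (K \<inter> J, \<lambda>x. g x + f x)"
      by (rule utumi_rel_eqI[OF add[OF f g] add[OF g f]]) (simp add: add.commute)
  qed
  show "0 + a = a"
  proof (transfer, clarsimp simp only: utumi_rel_self split)
    fix J :: "'a set" and f :: "'a \<Rightarrow> 'a"
    assume f: "partial_right_hom (J, f)"
    show "utumi_rel (UNIV \<inter> J, \<lambda>x. 0 + f x) (J, f)"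
      by (rule utumi_rel_eqI[OF add[OF partial_right_hom_zero f] f]) simp
  qed
  show "- a + a = 0"
  proof (transfer, clarsimp simp only: utumi_rel_self split)
    fix J :: "'a set" and f :: "'a \<Rightarrow> 'a"
    assume f: "partial_right_hom (J, f)"
    show "utumi_rel (J \<inter> J, \<lambda>x. - f x + f x) (UNIV, \<lambda>x. 0)"
      by (rule utumi_rel_eqI[OF add[OF minus[OF f] f] partial_right_hom_zero]) simp
  qed
  show "a - b = a + - b" by (simp add: minus_utumi_def)
  show "a * b * c = a * (b * c)"
  proof (transfer, clarsimp simp only: utumi_rel_self split)
    fix J K L :: "'a set" and f g h :: "'a \<Rightarrow> 'a"
    assume f: "partial_right_hom (J, f)" and g: "partial_right_hom (K, g)"
      and h: "partial_right_hom (L, h)"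
    show "utumi_rel ({x \<in> L. h x \<in> {x \<in> K. g x \<in> J}}, \<lambda>x. f (g (h x)))
        ({x \<in> {x \<in> L. h x \<in> K}. g (h x) \<in> J}, \<lambda>x. f (g (h x)))"
      by (rule utumi_rel_eqI[OF comp[OF comp[OF f g] h] comp[OF f comp[OF g h]]]) (rule refl)
  qed
  show "(a + b) * c = a * c + b * c"
  proof (transfer, clarsimp simp only: utumi_rel_self split)
    fix J K L :: "'a set" and f g h :: "'a \<Rightarrow> 'a"
    assume f: "partial_right_hom (J, f)" and g: "partial_right_hom (K, g)"
      and h: "partial_right_hom (L, h)"
    show "utumi_rel ({x \<in> L. h x \<in> J \<inter> K}, \<lambda>x. f (h x) + g (h x))
        ({x \<in> L. h x \<in> J} \<inter> {x \<in> L. h x \<in> K}, \<lambda>x. f (h x) + g (h x))"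
      by (rule utumi_rel_eqI[OF comp[OF add[OF f g] h] add[OF comp[OF f h] comp[OF g h]]]) (rule refl)
  qed
  show "a * (b + c) = a * b + a * c"
  proof (transfer, clarsimp simp only: utumi_rel_self split)
    fix J K L :: "'a set" and f g h :: "'a \<Rightarrow> 'a"
    assume f: "partial_right_hom (J, f)" and g: "partial_right_hom (K, g)"
      and h: "partial_right_hom (L, h)"
    show "utumi_rel ({x \<in> K \<inter> L. g x + h x \<in> J}, \<lambda>x. f (g x + h x))
        ({x \<in> K. g x \<in> J} \<inter> {x \<in> L. h x \<in> J}, \<lambda>x. f (g x) + f (h x))"
      by (rule utumi_rel_eqI[OF comp[OF f add[OF g h]] add[OF comp[OF f g] comp[OF f h]]])
        (use partial_right_homD(3)[OF f] in simp)
  qed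
  show "1 * a = a"
  proof (transfer, clarsimp simp only: utumi_rel_self split)
    fix J :: "'a set" and f :: "'a \<Rightarrow> 'a"
    assume f: "partial_right_hom (J, f)"
    show "utumi_rel ({x \<in> J. f x \<in> UNIV}, \<lambda>x. f x) (J, f)"
      by (rule utumi_rel_eqI[OF comp[OF partial_right_hom_id f] f]) (rule refl)
  qed
  show "a * 1 = a"
  proof (transfer, clarsimp simp only: utumi_rel_self split)
    fix J :: "'a set" and f :: "'a \<Rightarrow> 'a"
    assume f: "partial_right_hom (J, f)"
    show "utumi_rel ({x \<in> UNIV. x \<in> J}, \<lambda>x. f x) (J, f)"
      by (rule utumi_rel_eqI[OF comp[OF f partial_right_hom_id] f]) (rule refl)
  qed
qed

end

definition utumi_embed :: "'a::ring \<Rightarrow> 'a utumi" where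
  "utumi_embed a = abs_utumi (UNIV, \<lambda>x. a * x)"

lemma partial_right_hom_left_mult: "partial_right_hom (UNIV, \<lambda>x. a * x)"
  by (simp add: partial_right_hom_def algebra_simps)

lemma abs_utumi_times:
  assumes "partial_right_hom (UNIV, f)" "partial_right_hom (UNIV, g)"
  shows "abs_utumi (UNIV, f) * abs_utumi (UNIV, g) = abs_utumi (UNIV, \<lambda>x. f (g x))"
  using assms by (subst times_utumi.abs_eq) (auto simp: utumi_rel_self)

lemma abs_utumi_plus:
  assumes "partial_right_hom (UNIV, f)" "partial_right_hom (UNIV, g)"
  shows "abs_utumi (UNIV, f) + abs_utumi (UNIV, g) = abs_utumi (UNIV, \<lambda>x. f x + g x)"
  using assms by (subst plus_utumi.abs_eq) (auto simp: utumi_rel_self)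

lemma utumi_embed_hom:
  "utumi_embed (a + b) = utumi_embed a + utumi_embed b"
  "utumi_embed (a * b) = utumi_embed a * utumi_embed b"
proof -
  have "(*) (a + b) = (\<lambda>x. a * x + b * x)" "(*) (a * b) = (\<lambda>x. a * (b * x))"
    by (simp_all add: fun_eq_iff algebra_simps)
  then show "utumi_embed (a + b) = utumi_embed a + utumi_embed b"
    "utumi_embed (a * b) = utumi_embed a * utumi_embed b"
    unfolding utumi_embed_def
    by (simp_all add: abs_utumi_times abs_utumi_plus partial_right_hom_left_mult)
qed

lemma abs_utumi_eq_iff:
  assumes "partial_right_hom (J, f)" "partial_right_hom (K, g)"
  shows "abs_utumi (J, f) = abs_utumi (K, g) \<longleftrightarrow> utumi_rel (J, f) (K, g)"
  using Quotient_rel[OF Quotient_utumi, of "(J, f)" "(K, g)"] assms by (simp add: utumi_rel_self)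

lemma utumi_embed_inj:
  assumes ann: "\<And>x::'a::ring. (\<And>r. x * r = 0) \<Longrightarrow> x = 0"
  shows "inj (utumi_embed :: 'a \<Rightarrow> 'a utumi)"
proof (rule injI)
  fix a b :: 'a
  assume "utumi_embed a = utumi_embed b"
  then have "utumi_rel (UNIV, \<lambda>x. a * x) (UNIV, \<lambda>x. b * x)"
    unfolding utumi_embed_def by (simp add: abs_utumi_eq_iff partial_right_hom_left_mult)
  then obtain K where K: "quotient_domain K" "\<And>x. x \<in> K \<Longrightarrow> a * x = b * x"
    by (elim utumi_relE) blast
  have "dense_right_ideal K" using K(1) quotient_domain_iff_dense[OF ann] by blast
  moreover have "(a - b) * x = 0" if "x \<in> K" for x using K(2)[OF that] by (simp add: algebra_simps)
  ultimately have *: "x = 0 \<or> (\<exists>r. x * r \<noteq> 0 \<and> y * r \<in> K)" "y * r \<in> K \<Longrightarrow> (a - b) * (y * r) = 0"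
    for x y r by (auto simp: dense_right_ideal_def)
  have "(a - b) * y = 0" for y
    using *(1)[of "(a - b) * y" y] *(2)[of y] by (auto simp: mult.assoc)
  then show "a = b" using ann[of "a - b"] by simp
qed

definition ring_centre :: "'q::semigroup_mult set" where
  "ring_centre = {c. \<forall>q. c * q = q * c}"

text \<open>For semiprime rings this is also the centre of the symmetric ring of quotients.\<close>

definition extended_centroid :: "'a::ring utumi set" where
  "extended_centroid = ring_centre"


section \<open>The free product of a ring with a free algebra over its centre\<close>

text \<open>
  The coproduct, over the centre \<open>C\<close> of a unital ring \<open>Q\<close>, of the \<open>C\<close>-algebras \<open>Q\<close> and
  \<open>C\<langle>x\<^sub>0, x\<^sub>1, \<dots>\<rangle>\<close> is presented by generators and relations: it is the unital ring generated by
  \<open>Q\<close> and the indeterminates, subject to the addition and multiplication table of \<open>Q\<close> and to the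
  commutation of \<open>C\<close> with the indeterminates.  Its universal property is proved below.
\<close>

datatype 'q gp_term =
    Coef 'q
  | Indet nat
  | Plus "'q gp_term" "'q gp_term"
  | Neg "'q gp_term"
  | Times "'q gp_term" "'q gp_term"

inductive gp_eq :: "'q::{ring,monoid_mult} gp_term \<Rightarrow> 'q gp_term \<Rightarrow> bool" where
  gp_refl: "gp_eq s s"
| gp_sym: "gp_eq s t \<Longrightarrow> gp_eq t s"
| gp_trans: "gp_eq s t \<Longrightarrow> gp_eq t u \<Longrightarrow> gp_eq s u"
| gp_Plus_cong: "gp_eq s s' \<Longrightarrow> gp_eq t t' \<Longrightarrow> gp_eq (Plus s t) (Plus s' t')"
| gp_Neg_cong: "gp_eq s s' \<Longrightarrow> gp_eq (Neg s) (Neg s')"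
| gp_Times_cong: "gp_eq s s' \<Longrightarrow> gp_eq t t' \<Longrightarrow> gp_eq (Times s t) (Times s' t')"
| gp_Plus_assoc: "gp_eq (Plus (Plus s t) u) (Plus s (Plus t u))"
| gp_Plus_commute: "gp_eq (Plus s t) (Plus t s)"
| gp_Plus_zero: "gp_eq (Plus (Coef 0) s) s"
| gp_Plus_Neg: "gp_eq (Plus (Neg s) s) (Coef 0)"
| gp_Times_assoc: "gp_eq (Times (Times s t) u) (Times s (Times t u))"
| gp_Times_one_left: "gp_eq (Times (Coef 1) s) s"
| gp_Times_one_right: "gp_eq (Times s (Coef 1)) s"
| gp_distrib_left: "gp_eq (Times s (Plus t u)) (Plus (Times s t) (Times s u))"
| gp_distrib_right: "gp_eq (Times (Plus s t) u) (Plus (Times s u) (Times t u))"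
| gp_Coef_Plus: "gp_eq (Coef (p + q)) (Plus (Coef p) (Coef q))"
| gp_Coef_Times: "gp_eq (Coef (p * q)) (Times (Coef p) (Coef q))"
| gp_centre: "c \<in> ring_centre \<Longrightarrow> gp_eq (Times (Coef c) (Indet i)) (Times (Indet i) (Coef c))"

quotient_type (overloaded) 'q gen_poly = "'q::{ring,monoid_mult} gp_term" / gp_eq
  by (rule equivpI) (auto intro!: reflpI sympI transpI gp_refl intro: gp_sym gp_trans)

instantiation gen_poly :: ("{ring,monoid_mult}") "{ring,monoid_mult}"
begin

lift_definition zero_gen_poly :: "'a gen_poly" is "Coef 0" .
lift_definition one_gen_poly :: "'a gen_poly" is "Coef 1" .
lift_definition plus_gen_poly :: "'a gen_poly \<Rightarrow> 'a gen_poly \<Rightarrow> 'a gen_poly" is Plus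
  by (rule gp_Plus_cong)
lift_definition uminus_gen_poly :: "'a gen_poly \<Rightarrow> 'a gen_poly" is Neg
  by (rule gp_Neg_cong)
lift_definition times_gen_poly :: "'a gen_poly \<Rightarrow> 'a gen_poly \<Rightarrow> 'a gen_poly" is Times
  by (rule gp_Times_cong)
definition minus_gen_poly :: "'a gen_poly \<Rightarrow> 'a gen_poly \<Rightarrow> 'a gen_poly" where
  "minus_gen_poly s t = s + - t"

instance
proof
  fix s t u :: "'a gen_poly"
  show "s + t + u = s + (t + u)" by transfer (rule gp_Plus_assoc)
  show "s + t = t + s" by transfer (rule gp_Plus_commute)
  show "0 + s = s" by transfer (rule gp_Plus_zero)
  show "- s + s = 0" by transfer (rule gp_Plus_Neg)
  show "s - t = s + - t" by (rule minus_gen_poly_def)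
  show "s * t * u = s * (t * u)" by transfer (rule gp_Times_assoc)
  show "1 * s = s" by transfer (rule gp_Times_one_left)
  show "s * 1 = s" by transfer (rule gp_Times_one_right)
  show "s * (t + u) = s * t + s * u" by transfer (rule gp_distrib_left)
  show "(s + t) * u = s * u + t * u" by transfer (rule gp_distrib_right)
qed

end

lift_definition gp_coef :: "'q::{ring,monoid_mult} \<Rightarrow> 'q gen_poly" is Coef .

lift_definition gp_indet :: "nat \<Rightarrow> 'q::{ring,monoid_mult} gen_poly" is Indet .

definition is_ring_hom :: "('r::ring \<Rightarrow> 's::ring) \<Rightarrow> bool" where
  "is_ring_hom h \<longleftrightarrow> (\<forall>x y. h (x + y) = h x + h y) \<and> (\<forall>x y. h (x * y) = h x * h y)"

lemma is_ring_homD: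
  assumes "is_ring_hom h"
  shows "h (x + y) = h x + h y" "h (x * y) = h x * h y" "h 0 = 0" "h (- x) = - h x"
proof -
  show add: "h (x + y) = h x + h y" and "h (x * y) = h x * h y" for x y
    using assms by (auto simp: is_ring_hom_def)
  show z: "h 0 = 0" using add[of 0 0] by simp
  show "h (- x) = - h x" using add[of x "- x"] z by (simp add: eq_neg_iff_add_eq_0 add.commute)
qed

lemma gen_poly_surj: "\<exists>t. x = abs_gen_poly t"
  by (induction x rule: gen_poly.abs_induct) blast

lemma gp_coef_hom: "is_ring_hom gp_coef" "gp_coef 1 = 1"
proof -
  have "gp_coef (p + q) = gp_coef p + gp_coef q" for p q :: 'a
    by transfer (rule gp_Coef_Plus)
  moreover have "gp_coef (p * q) = gp_coef p * gp_coef q" for p q :: 'a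
    by transfer (rule gp_Coef_Times)
  ultimately show "is_ring_hom (gp_coef :: 'a \<Rightarrow> _)" by (simp add: is_ring_hom_def)
  show "gp_coef 1 = 1" by (simp only: gp_coef.abs_eq one_gen_poly.abs_eq)
qed

lemma gp_coef_central:
  assumes c: "c \<in> ring_centre"
  shows "gp_coef c \<in> ring_centre"
proof -
  have "gp_coef c * abs_gen_poly t = abs_gen_poly t * gp_coef c" for t
  proof (induction t)
    case (Coef q)
    have "c * q = q * c" using c by (simp add: ring_centre_def)
    then show ?case
      unfolding gp_coef.abs_eq[symmetric] is_ring_homD(2)[OF gp_coef_hom(1), symmetric] by (rule arg_cong)
  next
    case (Indet i)
    show ?case
      unfolding gp_coef.abs_eq times_gen_poly.abs_eq gen_poly.abs_eq_iff using c by (rule gp_centre)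
  next
    case (Plus s t)
    then show ?case
      by (simp only: plus_gen_poly.abs_eq[symmetric] distrib_left distrib_right)
  next
    case (Neg t)
    then show ?case
      by (simp only: uminus_gen_poly.abs_eq[symmetric] mult_minus_left mult_minus_right)
  next
    case (Times s t)
    have "gp_coef c * (abs_gen_poly s * abs_gen_poly t) = abs_gen_poly s * gp_coef c * abs_gen_poly t"
      by (simp only: mult.assoc[symmetric] Times)
    also have "\<dots> = abs_gen_poly s * abs_gen_poly t * gp_coef c"
      by (simp only: mult.assoc Times)
    finally show ?case by (simp only: times_gen_poly.abs_eq[symmetric])
  qed
  then have "gp_coef c * x = x * gp_coef c" for x
    using gen_poly_surj[of x] by auto
  then show ?thesis by (simp add: ring_centre_def)
qed

primrec gp_eval :: "('q \<Rightarrow> 'r::{ring,monoid_mult}) \<Rightarrow> (nat \<Rightarrow> 'r) \<Rightarrow> 'q gp_term \<Rightarrow> 'r" where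
  "gp_eval h v (Coef q) = h q"
| "gp_eval h v (Indet i) = v i"
| "gp_eval h v (Plus s t) = gp_eval h v s + gp_eval h v t"
| "gp_eval h v (Neg s) = - gp_eval h v s"
| "gp_eval h v (Times s t) = gp_eval h v s * gp_eval h v t"

theorem gen_poly_universal:
  fixes h :: "'q::{ring,monoid_mult} \<Rightarrow> 'r::{ring,monoid_mult}" and v :: "nat \<Rightarrow> 'r"
  assumes h: "is_ring_hom h" "h 1 = 1" and central: "h ` ring_centre \<subseteq> ring_centre"
  shows "\<exists>!\<phi>. is_ring_hom \<phi> \<and> (\<forall>q. \<phi> (gp_coef q) = h q) \<and> (\<forall>i. \<phi> (gp_indet i) = v i)"
proof (rule ex1I)
  have wd: "gp_eval h v s = gp_eval h v t" if "gp_eq s t" for s t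
    using that
  proof induction
    case (gp_centre c i)
    then show ?case using central by (auto simp: ring_centre_def)
  qed (simp_all add: is_ring_homD[OF h(1)] h(2) add.assoc add.commute mult.assoc distrib_left distrib_right)
  define \<phi> where "\<phi> = (\<lambda>x. gp_eval h v (rep_gen_poly x))"
  have \<phi>: "\<phi> (abs_gen_poly t) = gp_eval h v t" for t
    unfolding \<phi>_def
    by (rule wd) (simp only: gen_poly.abs_eq_iff[symmetric] Quotient3_abs_rep[OF Quotient3_gen_poly])
  have "\<phi> (x + y) = \<phi> x + \<phi> y" "\<phi> (x * y) = \<phi> x * \<phi> y" for x y
    using gen_poly_surj[of x] gen_poly_surj[of y] by (auto simp: plus_gen_poly.abs_eq times_gen_poly.abs_eq \<phi>)
  then show "is_ring_hom \<phi> \<and> (\<forall>q. \<phi> (gp_coef q) = h q) \<and> (\<forall>i. \<phi> (gp_indet i) = v i)"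
    by (simp add: is_ring_hom_def gp_coef.abs_eq gp_indet.abs_eq \<phi>)
  fix \<psi>
  assume \<psi>: "is_ring_hom \<psi> \<and> (\<forall>q. \<psi> (gp_coef q) = h q) \<and> (\<forall>i. \<psi> (gp_indet i) = v i)"
  have "\<psi> (abs_gen_poly t) = gp_eval h v t" for t
  proof (induction t)
    case (Plus s t)
    then show ?case using \<psi> by (simp add: plus_gen_poly.abs_eq[symmetric] is_ring_homD)
  next
    case (Neg s)
    then show ?case using \<psi> by (simp add: uminus_gen_poly.abs_eq[symmetric] is_ring_homD)
  next
    case (Times s t)
    then show ?case using \<psi> by (simp add: times_gen_poly.abs_eq[symmetric] is_ring_homD)
  qed (use \<psi> in \<open>simp_all add: gp_coef.abs_eq[symmetric] gp_indet.abs_eq[symmetric]\<close>)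
  then have "\<psi> (abs_gen_poly t) = \<phi> (abs_gen_poly t)" for t by (simp add: \<phi>)
  then have "\<psi> x = \<phi> x" for x using gen_poly_surj[of x] by auto
  then show "\<psi> = \<phi>" by (rule ext)
qed

text \<open>
  For \<open>c\<close> in \<open>C\<close> the scalar multiple \<open>cf\<close> is the
  product of the image of \<open>c\<close> with \<open>f\<close>.
\<close>

definition SGPI_ring :: "'a::ring itself \<Rightarrow> bool" where
  "SGPI_ring _ \<longleftrightarrow>
     (\<exists>f :: 'a utumi gen_poly.
        (\<forall>c\<in>extended_centroid. c \<noteq> 0 \<longrightarrow> gp_coef c * f \<noteq> 0) \<and>
        (\<forall>\<phi> :: 'a utumi gen_poly \<Rightarrow> 'a utumi.
           is_ring_hom \<phi> \<and> \<phi> ` range gp_indet \<subseteq> range utumi_embed \<and> (\<forall>q. \<phi> (gp_coef q) = q)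
             \<longrightarrow> \<phi> f = 0))"


section \<open>Algebras, ideals and chain conditions\<close>

locale assoc_algebra = module scale
  for scale :: "'f::comm_ring_1 \<Rightarrow> 'a::ring \<Rightarrow> 'a" +
  assumes scale_mult_left: "scale \<alpha> (x * y) = scale \<alpha> x * y"
    and scale_mult_right: "scale \<alpha> (x * y) = x * scale \<alpha> y"

context
  fixes scale :: "'f::comm_ring_1 \<Rightarrow> 'a::ring \<Rightarrow> 'a"
begin

definition algebra_ideal :: "'a set \<Rightarrow> bool" where
  "algebra_ideal I \<longleftrightarrow> module.subspace scale I \<and> (\<forall>x\<in>I. \<forall>a. a * x \<in> I \<and> x * a \<in> I)"

definition ideal_product :: "'a set \<Rightarrow> 'a set \<Rightarrow> 'a set" where
  "ideal_product I J = module.span scale {x * y | x y. x \<in> I \<and> y \<in> J}"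

definition semiprime_algebra :: bool where
  "semiprime_algebra \<longleftrightarrow>
     (\<forall>I. algebra_ideal I \<and> I \<noteq> {0} \<longrightarrow> ideal_product I I \<noteq> {0})"

definition prime_algebra :: bool where
  "prime_algebra \<longleftrightarrow>
     (\<forall>I J. algebra_ideal I \<and> I \<noteq> {0} \<and> algebra_ideal J \<and> J \<noteq> {0} \<longrightarrow> ideal_product I J \<noteq> {0})"

definition weakly_Noetherian :: bool where
  "weakly_Noetherian \<longleftrightarrow>
     (\<forall>I :: nat \<Rightarrow> 'a set. (\<forall>n. algebra_ideal (I n) \<and> I n \<subseteq> I (Suc n))
        \<longrightarrow> (\<exists>N. \<forall>n\<ge>N. I n = I N))"

definition finitely_cogenerated :: bool where
  "finitely_cogenerated \<longleftrightarrow>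
     (\<forall>\<I>. (\<forall>I\<in>\<I>. algebra_ideal I) \<and> \<Inter>\<I> = {0}
        \<longrightarrow> (\<exists>\<J>\<subseteq>\<I>. finite \<J> \<and> \<Inter>\<J> = {0}))"

definition essential_ideal :: "'a set \<Rightarrow> bool" where
  "essential_ideal I \<longleftrightarrow>
     algebra_ideal I \<and> (\<forall>J. algebra_ideal J \<and> J \<noteq> {0} \<longrightarrow> I \<inter> J \<noteq> {0})"

definition essential_ideals_countably_closed :: bool where
  "essential_ideals_countably_closed \<longleftrightarrow>
     (\<forall>I :: nat \<Rightarrow> 'a set. (\<forall>n. essential_ideal (I n)) \<longrightarrow> essential_ideal (\<Inter>n. I n))"


section \<open>The symmetric ring of quotients and derivations\<close>

definition Qsm :: "'a utumi set" where
  "Qsm = {q. \<exists>I. essential_ideal I \<and>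
             {q * utumi_embed x + utumi_embed y * q | x y. x \<in> I \<and> y \<in> I} \<subseteq> range utumi_embed}"

text \<open>
  The action of a scalar is a right module endomorphism of the whole ring, hence an element
  of the ring of quotients.  It is central (see below) and gives the \<open>F\<close>-algebra structure.
\<close>

definition utumi_scalar :: "'f \<Rightarrow> 'a utumi" where
  "utumi_scalar \<alpha> = abs_utumi (UNIV, scale \<alpha>)"

definition utumi_scale :: "'f \<Rightarrow> 'a utumi \<Rightarrow> 'a utumi" where
  "utumi_scale \<alpha> q = utumi_scalar \<alpha> * q"

definition monic_without_constant :: "'f poly \<Rightarrow> bool" where
  "monic_without_constant p \<longleftrightarrow> degree p \<ge> 1 \<and> lead_coeff p = 1 \<and> coeff p 0 = 0"

definition extended_centroid_integral :: bool where
  "extended_centroid_integral \<longleftrightarrow>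
     (\<forall>c\<in>extended_centroid. \<exists>p. monic_without_constant p \<and>
        (\<Sum>i\<le>degree p. utumi_scale (coeff p i) (c ^ i)) = 0)"

definition Der :: "('a \<Rightarrow> 'a) set" where
  "Der = {D. module_hom scale scale D \<and> (\<forall>x y. D (x * y) = D x * y + x * D y)}"

definition nil_derivation :: "('a \<Rightarrow> 'a) \<Rightarrow> bool" where
  "nil_derivation D \<longleftrightarrow> (\<forall>x. \<exists>n\<ge>1. (D ^^ n) x = 0)"

definition algebraic_derivation :: "('a \<Rightarrow> 'a) \<Rightarrow> bool" where
  "algebraic_derivation D \<longleftrightarrow>
     (\<forall>x. \<exists>p. monic_without_constant p \<and> (\<Sum>i\<le>degree p. scale (coeff p i) ((D ^^ i) x)) = 0)"

text \<open>Maps on \<^term>\<open>Qsm\<close> are normalised to be \<^const>\<open>undefined\<close> outside \<^term>\<open>Qsm\<close>.\<close>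

definition Der_Qsm :: "('a utumi \<Rightarrow> 'a utumi) set" where
  "Der_Qsm = {\<delta> \<in> Qsm \<rightarrow>\<^sub>E Qsm.
     (\<forall>p\<in>Qsm. \<forall>q\<in>Qsm. \<delta> (p + q) = \<delta> p + \<delta> q) \<and>
     (\<forall>\<alpha>. \<forall>q\<in>Qsm. \<delta> (utumi_scale \<alpha> q) = utumi_scale \<alpha> (\<delta> q)) \<and>
     (\<forall>p\<in>Qsm. \<forall>q\<in>Qsm. \<delta> (p * q) = \<delta> p * q + p * \<delta> q)}"

text \<open>The identification of \<open>Der(A)\<close> with a subset of the derivations of \<^term>\<open>Qsm\<close>.\<close>

definition Der_extension :: "('a \<Rightarrow> 'a) \<Rightarrow> 'a utumi \<Rightarrow> 'a utumi" where
  "Der_extension D = (THE \<delta>. \<delta> \<in> Der_Qsm \<and> (\<forall>x. \<delta> (utumi_embed x) = utumi_embed (D x)))"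

definition C_Der :: "('a utumi \<Rightarrow> 'a utumi) set" where
  "C_Der = {\<lambda>q\<in>Qsm. \<Sum>i<n. c i * Der_extension (D i) q | n c D.
     \<forall>i<n::nat. c i \<in> extended_centroid \<and> D i \<in> Der}"

definition Inder_Qsm :: "('a utumi \<Rightarrow> 'a utumi) set" where
  "Inder_Qsm = {\<lambda>x\<in>Qsm. x * q - q * x | q. q \<in> Qsm}"

end

lemma (in assoc_algebra) semiprime_left_annihilator:
  fixes x :: 'a
  assumes semiprime: "semiprime_algebra scale" and x: "\<And>r. x * r = 0"
  shows "x = 0"
proof -
  let ?L = "{x. \<forall>r::'a. x * r = 0}"
  have "subspace ?L"
    by (auto simp: subspace_def distrib_right scale_mult_left[symmetric])
  then have "algebra_ideal scale ?L"
    by (simp add: algebra_ideal_def mult.assoc)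
  moreover have "{x * y | x y. x \<in> ?L \<and> y \<in> ?L} \<subseteq> {0}" by auto
  then have "ideal_product scale ?L ?L \<subseteq> span {0}"
    unfolding ideal_product_def by (rule span_mono)
  then have "ideal_product scale ?L ?L = {0}"
    using span_zero by (auto simp: ideal_product_def span_singleton)
  ultimately have "?L = {0}" using semiprime by (auto simp: semiprime_algebra_def)
  then show ?thesis using x by blast
qed

lemma (in assoc_algebra) utumi_scalar_hom:
  "utumi_scalar scale (\<alpha> + \<beta>) = utumi_scalar scale \<alpha> + utumi_scalar scale \<beta>"
  "utumi_scalar scale (\<alpha> * \<beta>) = utumi_scalar scale \<alpha> * utumi_scalar scale \<beta>"
  "utumi_scalar scale 1 = 1"
proof -
  have *: "partial_right_hom (UNIV, scale \<alpha>)" for \<alpha>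
    by (simp add: partial_right_hom_def scale_right_distrib scale_mult_left)
  have **: "scale (\<alpha> + \<beta>) = (\<lambda>x. scale \<alpha> x + scale \<beta> x)"
    "scale (\<alpha> * \<beta>) = (\<lambda>x. scale \<alpha> (scale \<beta> x))" for \<alpha> \<beta>
    by (simp_all add: fun_eq_iff scale_left_distrib)
  show "utumi_scalar scale (\<alpha> + \<beta>) = utumi_scalar scale \<alpha> + utumi_scalar scale \<beta>"
    "utumi_scalar scale (\<alpha> * \<beta>) = utumi_scalar scale \<alpha> * utumi_scalar scale \<beta>"
    unfolding utumi_scalar_def by (simp_all add: abs_utumi_times abs_utumi_plus * ** del: scale_scale)
  have "scale 1 = (\<lambda>x. x)" by (simp add: fun_eq_iff)
  then show "utumi_scalar scale 1 = 1" by (simp add: utumi_scalar_def one_utumi.abs_eq)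
qed

lemma (in assoc_algebra) utumi_scale_embed:
  "utumi_scale scale \<alpha> (utumi_embed x) = utumi_embed (scale \<alpha> x)"
proof -
  have "partial_right_hom (UNIV, scale \<alpha>)"
    by (simp add: partial_right_hom_def scale_right_distrib scale_mult_left)
  then show ?thesis unfolding utumi_scale_def utumi_scalar_def utumi_embed_def
    by (simp add: abs_utumi_times partial_right_hom_left_mult scale_mult_left)
qed

lemma (in assoc_algebra) utumi_scalar_central:
  assumes ann: "\<And>x::'a. (\<And>r. x * r = 0) \<Longrightarrow> x = 0"
  shows "utumi_scalar scale \<alpha> \<in> extended_centroid"
proof -
  have hom: "partial_right_hom (UNIV, scale \<alpha>)"
    by (simp add: partial_right_hom_def scale_right_distrib scale_mult_left)
  have "abs_utumi (UNIV, scale \<alpha>) * q = q * abs_utumi (UNIV, scale \<alpha>)" for q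
  proof -
    obtain J f where f: "partial_right_hom (J, f)" and q: "q = abs_utumi (J, f)"
      using Quotient_abs_rep[OF Quotient_utumi, of q] Quotient_rep_reflp[OF Quotient_utumi, of q]
      by (cases "rep_utumi q") (auto simp: utumi_rel_self)
    have "scale \<alpha> (f x) = f (scale \<alpha> x)" if x: "x \<in> J" "scale \<alpha> x \<in> J" for x
    proof -
      have "(scale \<alpha> (f x) - f (scale \<alpha> x)) * r = 0" for r
      proof -
        have "f (scale \<alpha> x) * r = f (x * scale \<alpha> r)"
          using partial_right_homD(4)[OF f x(2)] by (metis scale_mult_left scale_mult_right)
        also have "\<dots> = scale \<alpha> (f x) * r"
          using partial_right_homD(4)[OF f x(1)] by (metis scale_mult_left scale_mult_right)
        finally show ?thesis by (simp add: left_diff_distrib)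
      qed
      from ann[OF this] show ?thesis by simp
    qed
    moreover have 1: "partial_right_hom (J, \<lambda>x. scale \<alpha> (f x))"
      using partial_right_hom_comp[OF hom f] by simp
    moreover have 2: "partial_right_hom ({x. scale \<alpha> x \<in> J}, \<lambda>x. f (scale \<alpha> x))"
      using partial_right_hom_comp[OF f hom] by simp
    ultimately have "utumi_rel (J, \<lambda>x. scale \<alpha> (f x)) ({x. scale \<alpha> x \<in> J}, \<lambda>x. f (scale \<alpha> x))"
      by (intro utumi_rel_eqI) auto
    then have eq: "abs_utumi (J, \<lambda>x. scale \<alpha> (f x)) = abs_utumi ({x. scale \<alpha> x \<in> J}, \<lambda>x. f (scale \<alpha> x))"
      by (subst abs_utumi_eq_iff[OF 1 2])
    have rel: "utumi_rel (J, f) (J, f)" "utumi_rel (UNIV, scale \<alpha>) (UNIV, scale \<alpha>)"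
      using f hom by (simp_all only: utumi_rel_self)
    show ?thesis
      unfolding q times_utumi.abs_eq[OF rel(2) rel(1)] times_utumi.abs_eq[OF rel(1) rel(2)]
      by (simp only: split UNIV_I simp_thms Collect_mem_eq eq)
  qed
  then show ?thesis by (simp add: extended_centroid_def ring_centre_def utumi_scalar_def)
qed

definition torsion_free :: "'a::ab_group_add itself \<Rightarrow> bool" where
  "torsion_free _ \<longleftrightarrow> (\<forall>(n::nat) (x::'a). n > 0 \<and> (\<Sum>i<n. x) = 0 \<longrightarrow> x = 0)"

definition algebraically_closed_field_char_0 :: "'f::comm_ring_1 itself \<Rightarrow> bool" where
  "algebraically_closed_field_char_0 _ \<longleftrightarrow>
     (\<forall>a::'f. a \<noteq> 0 \<longrightarrow> (\<exists>b. a * b = 1)) \<and>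
     (\<forall>p::'f poly. degree p > 0 \<longrightarrow> (\<exists>a. poly p a = 0)) \<and>
     CHAR('f) = 0"

end

theory Submission
  imports Defs
begin

text \<open>
  The derivation extends to \<open>Q = Q(A)\<close>, and by integrality over \<open>F\<close> and torsion-freeness it kills the
  centre \<open>C\<close>. Each of the three finiteness conditions excludes infinite strictly descending chains
  of idempotents of \<open>C\<close>, so it suffices to treat a primitive idempotent \<open>e\<close>, for which \<open>eC\<close> is a field
  and \<open>p A q \<noteq> 0\<close> for nonzero \<open>p, q\<close> in \<open>eQ\<close>.

  If no map \<open>x \<mapsto> a x b\<close> with nonzero \<open>a, b\<close> in \<open>eQ\<close> had finite rank over \<open>eC\<close>, one could choose
  elements of \<open>A\<close> at which all multilinear generalized monomials are linearly independent, which
  contradicts the polarised generalized identity. So some \<open>x \<mapsto> a x b\<close> has finite rank. Since \<open>\<delta>\<close> is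
  \<open>C\<close>-linear, \<open>\<delta>(a x b)\<close> is then determined by finitely many values of \<open>\<delta>\<close>, which yields an identity
  \<open>a \<delta>(x) b = \<Sum> p x q\<close>; Martindale's lemma shrinks its right-hand side to \<open>a x q - p x b\<close>, and from this
  an element inducing \<open>e \<delta>\<close> can be read off.
\<close>

section \<open>Rings of right quotients\<close>

text \<open>The argument runs in an abstract pair of a ring \<open>A\<close> inside a ring
  \<open>Q\<close>, reduced to what it needs of the Utumi ring: elements of \<open>Q\<close> are
  detected, and moved into \<open>A\<close>, by right multiplication with elements of
  \<open>A\<close>, and right linear maps on dense right ideals are left multiplications. Central
  idempotents, inverses in \<open>eC\<close>, the scalar in Martindale's lemma, the extension of the
  derivation and the inducing element all come from \<open>extend\<close>, applied to a suitable
  map. The recurring obstacle is that these maps take values in \<open>Q\<close> while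
  \<open>extend\<close> wants values in \<open>A\<close>; domains are cut down accordingly and must
  be shown to stay large. Killing the centre matters because the coordinates of \<open>a x b\<close>
  in a basis depend on \<open>x\<close>: were they not constants of \<delta>, differentiating them
  would leave uncontrolled terms. Extension is one-sided, whereas the inducing element
  \<open>y\<close> must multiply an essential ideal into \<open>A\<close> from both sides; for this
  its construction also supplies a nonzero \<open>z\<close> with \<open>y z\<close> and
  \<open>z y\<close> in \<open>A\<close>.\<close>

locale right_quotient_ring =
  fixes A :: "'q::{ring,monoid_mult} set"
  assumes zero_closed [simp]: "0 \<in> A"
    and diff_closed: "x \<in> A \<Longrightarrow> y \<in> A \<Longrightarrow> x - y \<in> A"
    and mult_closed: "x \<in> A \<Longrightarrow> y \<in> A \<Longrightarrow> x * y \<in> A"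
    and dense: "q \<noteq> 0 \<Longrightarrow> \<exists>r\<in>A. q * r \<noteq> 0 \<and> p * r \<in> A"
    and extend: "J \<subseteq> A \<Longrightarrow> 0 \<in> J \<Longrightarrow> (\<And>x y. x \<in> J \<Longrightarrow> y \<in> J \<Longrightarrow> x - y \<in> J) \<Longrightarrow>
      (\<And>x r. x \<in> J \<Longrightarrow> r \<in> A \<Longrightarrow> x * r \<in> J) \<Longrightarrow>
      (\<And>p q. p \<in> A \<Longrightarrow> q \<in> A \<Longrightarrow> q \<noteq> 0 \<Longrightarrow> \<exists>r\<in>A. q * r \<noteq> 0 \<and> p * r \<in> J) \<Longrightarrow>
      (\<And>x. x \<in> J \<Longrightarrow> \<phi> x \<in> A) \<Longrightarrow> (\<And>x y. x \<in> J \<Longrightarrow> y \<in> J \<Longrightarrow> \<phi> (x + y) = \<phi> x + \<phi> y) \<Longrightarrow>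
      (\<And>x r. x \<in> J \<Longrightarrow> r \<in> A \<Longrightarrow> \<phi> (x * r) = \<phi> x * r) \<Longrightarrow> \<exists>q. \<forall>x\<in>J. q * x = \<phi> x"
    and semiprime: "a \<in> A \<Longrightarrow> (\<And>r. r \<in> A \<Longrightarrow> a * r * a = 0) \<Longrightarrow> a = 0"
begin

lemma uminus_closed: "x \<in> A \<Longrightarrow> - x \<in> A"
  using diff_closed[OF zero_closed, of x] by simp

lemma add_closed: "x \<in> A \<Longrightarrow> y \<in> A \<Longrightarrow> x + y \<in> A"
  using diff_closed[of x "- y"] uminus_closed by simp

lemma sum_closed: "(\<And>i. i \<in> S \<Longrightarrow> f i \<in> A) \<Longrightarrow> sum f S \<in> A"
  by (induction S rule: infinite_finite_induct) (auto intro: add_closed)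

text \<open>The free parameter \<open>p\<close> allows the test to assume \<open>p * r\<close> in
  \<open>A\<close>, so that maps known only on \<open>A\<close> can be applied to it.\<close>

lemma eq_zeroI:
  assumes "\<And>r. r \<in> A \<Longrightarrow> p * r \<in> A \<Longrightarrow> q * r = 0"
  shows "q = 0"
  using dense[of q p] assms by blast

lemma eq_zeroI2:
  assumes "\<And>r. r \<in> A \<Longrightarrow> p * r \<in> A \<Longrightarrow> p' * r \<in> A \<Longrightarrow> q * r = 0"
  shows "q = 0"
proof (rule ccontr)
  assume "q \<noteq> 0"
  then obtain r where r: "r \<in> A" "q * r \<noteq> 0" "p * r \<in> A" using dense by blast
  then obtain s where s: "s \<in> A" "q * r * s \<noteq> 0" "p' * r * s \<in> A" using dense[of "q * r" "p' * r"] by blast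
  have "q * (r * s) = 0"
    using assms[of "r * s"] r s mult_closed by (simp add: mult.assoc[symmetric])
  then show False using s(2) by (simp add: mult.assoc)
qed

lemma centralI:
  assumes "\<And>r. r \<in> A \<Longrightarrow> c * r = r * c"
  shows "c \<in> ring_centre"
proof -
  have "c * q - q * c = 0" for q
  proof (rule eq_zeroI[of q])
    fix r assume r: "r \<in> A" "q * r \<in> A"
    have "c * q * r = q * (r * c)" using assms[OF r(2)] by (simp add: mult.assoc)
    then show "(c * q - q * c) * r = 0" using assms[OF r(1)]
      by (simp add: left_diff_distrib mult.assoc)
  qed
  then show ?thesis by (simp add: ring_centre_def)
qed

section \<open>Faithful ideals, extension of maps and annihilator idempotents\<close>

definition ideal :: "'q set \<Rightarrow> bool" where
  "ideal I \<longleftrightarrow> I \<subseteq> A \<and> 0 \<in> I \<and> (\<forall>x\<in>I. \<forall>y\<in>I. x - y \<in> I) \<and> (\<forall>x\<in>I. \<forall>r\<in>A. x * r \<in> I \<and> r * x \<in> I)"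

lemma idealD:
  assumes "ideal I"
  shows "I \<subseteq> A" "0 \<in> I" "x \<in> I \<Longrightarrow> y \<in> I \<Longrightarrow> x - y \<in> I" "x \<in> I \<Longrightarrow> r \<in> A \<Longrightarrow> x * r \<in> I"
    "x \<in> I \<Longrightarrow> r \<in> A \<Longrightarrow> r * x \<in> I"
  using assms by (auto simp: ideal_def)

definition faithful :: "'q set \<Rightarrow> bool" where
  "faithful I \<longleftrightarrow> (\<forall>a\<in>A. (\<forall>x\<in>I. a * x = 0) \<longrightarrow> a = 0)"

lemma faithfulD:
  assumes I: "ideal I" "faithful I" and t: "\<And>x. x \<in> I \<Longrightarrow> t * x = 0"
  shows "t = 0"
proof (rule eq_zeroI[of t])
  fix r assume r: "r \<in> A" "t * r \<in> A"
  have "\<forall>x\<in>I. t * r * x = 0" using t idealD(5)[OF I(1) _ r(1)] by (simp add: mult.assoc)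
  then show "t * r = 0" using I(2) r(2) by (simp add: faithful_def)
qed

text \<open>Faithfulness makes a two-sided ideal dense: some \<open>x\<close> in \<open>I\<close>
  has \<open>q * x\<close> nonzero, and \<open>p * x\<close> stays in \<open>I\<close>.\<close>

lemma extend_ideal:
  assumes I: "ideal I" "faithful I"
    and \<phi>: "\<And>x. x \<in> I \<Longrightarrow> \<phi> x \<in> A" "\<And>x y. x \<in> I \<Longrightarrow> y \<in> I \<Longrightarrow> \<phi> (x + y) = \<phi> x + \<phi> y"
      "\<And>x r. x \<in> I \<Longrightarrow> r \<in> A \<Longrightarrow> \<phi> (x * r) = \<phi> x * r"
  shows "\<exists>q. \<forall>x\<in>I. q * x = \<phi> x"
proof (rule extend)
  fix p q assume pq: "p \<in> A" "q \<in> A" "q \<noteq> 0"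
  then obtain x where x: "x \<in> I" "q * x \<noteq> 0" using I(2) by (auto simp: faithful_def)
  show "\<exists>r\<in>A. q * r \<noteq> 0 \<and> p * r \<in> I"
    using x idealD(1)[OF I(1)] idealD(5)[OF I(1) x(1) pq(1)] by (intro bexI[of _ x]) auto
qed (use idealD[OF I(1)] \<phi> in auto)

text \<open>Left linearity of \<open>\<phi>\<close> makes \<open>c * r\<close> and
  \<open>r * c\<close> agree on \<open>I\<close>, and \<open>I\<close> is faithful.\<close>

lemma extend_central:
  assumes I: "ideal I" "faithful I"
    and \<phi>: "\<And>x. x \<in> I \<Longrightarrow> \<phi> x \<in> A" "\<And>x y. x \<in> I \<Longrightarrow> y \<in> I \<Longrightarrow> \<phi> (x + y) = \<phi> x + \<phi> y"
      "\<And>x r. x \<in> I \<Longrightarrow> r \<in> A \<Longrightarrow> \<phi> (x * r) = \<phi> x * r"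
      "\<And>x r. x \<in> I \<Longrightarrow> r \<in> A \<Longrightarrow> \<phi> (r * x) = r * \<phi> x"
  shows "\<exists>c\<in>ring_centre. \<forall>x\<in>I. c * x = \<phi> x"
proof -
  obtain c where c: "\<And>x. x \<in> I \<Longrightarrow> c * x = \<phi> x"
    using extend_ideal[OF I \<phi>(1-3)] by blast
  have "c \<in> ring_centre"
  proof (rule centralI)
    fix r assume r: "r \<in> A"
    have "c * r - r * c = 0"
    proof (rule faithfulD[OF I])
      fix x assume x: "x \<in> I"
      show "(c * r - r * c) * x = 0"
        using c[OF x] c[OF idealD(5)[OF I(1) x r]] \<phi>(4)[OF x r]
        by (simp add: left_diff_distrib mult.assoc)
    qed
    then show "c * r = r * c" by simp
  qed
  then show ?thesis using c by blast
qed

text \<open>In a semiprime ring an ideal \<open>L\<close> and its left annihilator \<open>R\<close>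
  meet in zero and have a faithful sum, so the projection of the sum onto \<open>R\<close> is a
  bimodule map on a faithful ideal, that is, multiplication by a central idempotent. Here
  \<open>L\<close> is the right annihilator of \<open>p A\<close>; multiples \<open>p * r\<close>
  lying in \<open>A\<close> are in \<open>R\<close>, and multiples \<open>q * r\<close> lying in
  \<open>A\<close> are in \<open>L\<close>.\<close>

lemma annihilator_idempotent:
  assumes zero: "\<And>r. r \<in> A \<Longrightarrow> p * r * q = 0"
  obtains f where "f \<in> ring_centre" "f * f = f" "f * p = p" "f * q = 0"
proof -
  define L where "L = {x\<in>A. \<forall>r\<in>A. p * r * x = 0}"
  define R where "R = {y\<in>A. \<forall>x\<in>L. y * x = 0}"
  have L: "ideal L"
    unfolding ideal_def
  proof (intro conjI ballI)
    fix x r assume "x \<in> L" "r \<in> A"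
    then show "x * r \<in> L" "r * x \<in> L" unfolding L_def
      by (auto intro: mult_closed simp flip: mult.assoc) (metis mult.assoc mult_closed)
  qed (auto simp: L_def right_diff_distrib intro: diff_closed)
  have R: "ideal R"
    unfolding ideal_def
  proof (intro conjI ballI)
    fix x r assume "x \<in> R" "r \<in> A"
    then show "x * r \<in> R" "r * x \<in> R" unfolding R_def
      by (auto simp: mult.assoc intro: mult_closed idealD[OF L])
  qed (auto simp: R_def left_diff_distrib intro: diff_closed)
  have LR: "x = 0" if "x \<in> L" "x \<in> R" for x
  proof (rule semiprime)
    show "x \<in> A" using that(1) by (simp add: L_def)
    fix r assume "r \<in> A"
    then show "x * r * x = 0" using that idealD(5)[OF L that(1), of r] by (simp add: R_def mult.assoc)
  qed
  \<comment> \<open>\<open>I\<close> is \<open>R + L\<close> and \<open>\<phi>\<close> the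
    projection onto \<open>R\<close>, single-valued by \<open>LR\<close>.\<close>
  define I where "I = {x\<in>A. \<exists>y\<in>R. x - y \<in> L}"
  define \<phi> where "\<phi> x = (THE y. y \<in> R \<and> x - y \<in> L)" for x
  have \<phi>_eq: "\<phi> x = y" if "y \<in> R" "x - y \<in> L" for x y
    unfolding \<phi>_def
  proof (rule the_equality)
    fix z assume z: "z \<in> R \<and> x - z \<in> L"
    have "y - z \<in> R" "(x - z) - (x - y) \<in> L"
      using idealD(3)[OF R that(1), of z] idealD(3)[OF L _ that(2), of "x - z"] z by auto
    then have "y - z = 0" by (intro LR) auto
    then show "z = y" by simp
  qed (use that in simp)
  have \<phi>: "\<phi> x \<in> R" "x - \<phi> x \<in> L" if "x \<in> I" for x
    using that \<phi>_eq unfolding I_def by auto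
  have I_iff: "x \<in> I" if "y \<in> R" "x - y \<in> L" "x \<in> A" for x y using that by (auto simp: I_def)
  have diff: "\<phi> x - \<phi> y \<in> R" "(x - y) - (\<phi> x - \<phi> y) \<in> L" if "x \<in> I" "y \<in> I" for x y
    using idealD(3)[OF R \<phi>(1)[OF that(1)] \<phi>(1)[OF that(2)]]
      idealD(3)[OF L \<phi>(2)[OF that(1)] \<phi>(2)[OF that(2)]] by (simp_all add: algebra_simps)
  have left: "r * \<phi> x \<in> R" "r * x - r * \<phi> x \<in> L" and right: "\<phi> x * r \<in> R" "x * r - \<phi> x * r \<in> L"
    if "x \<in> I" "r \<in> A" for x r
    using idealD(4,5)[OF R \<phi>(1)[OF that(1)] that(2)] idealD(4,5)[OF L \<phi>(2)[OF that(1)] that(2)]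
    by (simp_all add: algebra_simps)
  have IA: "x \<in> A" if "x \<in> I" for x using that by (simp add: I_def)
  have "ideal I" unfolding ideal_def
  proof (intro conjI ballI)
    show "I \<subseteq> A" using IA by blast
    show "0 \<in> I" using I_iff[of 0 0] idealD[OF L] idealD[OF R] by auto
    show "x - y \<in> I" if "x \<in> I" "y \<in> I" for x y
      by (rule I_iff[OF diff[OF that]]) (use that IA in \<open>auto intro: diff_closed\<close>)
    show "x * r \<in> I" "r * x \<in> I" if "x \<in> I" "r \<in> A" for x r
      by (rule I_iff[OF right[OF that]] I_iff[OF left[OF that]], use that IA in \<open>auto intro: mult_closed\<close>)+
  qed
  have LI: "x \<in> I" "\<phi> x = 0" if "x \<in> L" for x
    using I_iff[of 0 x] \<phi>_eq[of 0 x] that idealD(2)[OF R] idealD(1)[OF L] by auto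
  have RI: "x \<in> I" "\<phi> x = x" if "x \<in> R" for x
    using I_iff[of x x] \<phi>_eq[of x x] that idealD(2)[OF L] idealD(1)[OF R] by auto
  \<comment> \<open>An element annihilating \<open>L\<close> is in \<open>R\<close>; if it
    annihilates \<open>R\<close> as well, then \<open>a * r * a = 0\<close>.\<close>
  have "faithful I" unfolding faithful_def
  proof (intro ballI impI)
    fix a assume a: "a \<in> A" "\<forall>x\<in>I. a * x = 0"
    then have aR: "a \<in> R" using LI(1) by (auto simp: R_def)
    show "a = 0"
    proof (rule semiprime)
      fix r assume "r \<in> A"
      then have "r * a \<in> R" using idealD(5)[OF R aR] by simp
      then show "a * r * a = 0" using a(2) RI(1) by (simp add: mult.assoc)
    qed fact
  qed
  have \<phi>A: "\<phi> x \<in> A" if "x \<in> I" for x using \<phi>(1)[OF that] by (simp add: R_def)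
  have \<phi>_add: "\<phi> (x + y) = \<phi> x + \<phi> y" if "x \<in> I" "y \<in> I" for x y
  proof -
    have "- y \<in> I" using idealD(3)[OF \<open>ideal I\<close> idealD(2)[OF \<open>ideal I\<close>] that(2)] by simp
    then have "\<phi> (x - (- y)) = \<phi> x - \<phi> (- y)" using that \<phi>_eq diff by blast
    moreover have "\<phi> (0 - y) = \<phi> 0 - \<phi> y"
      using that idealD(2)[OF \<open>ideal I\<close>] \<phi>_eq diff by blast
    ultimately show ?thesis using LI(2)[OF idealD(2)[OF L]] by simp
  qed
  have \<phi>_mult: "\<phi> (x * r) = \<phi> x * r" "\<phi> (r * x) = r * \<phi> x" if "x \<in> I" "r \<in> A" for x r
    by (rule \<phi>_eq, use left[OF that] right[OF that] in auto)+
  from extend_central[OF \<open>ideal I\<close> \<open>faithful I\<close> \<phi>A \<phi>_add \<phi>_mult]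
  obtain f where f: "f \<in> ring_centre" "\<And>x. x \<in> I \<Longrightarrow> f * x = \<phi> x" by blast
  have "f * f - f = 0"
    by (rule faithfulD[OF \<open>ideal I\<close> \<open>faithful I\<close>])
      (use f(2) \<phi>(1) RI in \<open>simp add: left_diff_distrib mult.assoc\<close>)
  moreover have "f * p - p = 0"
  proof (rule eq_zeroI[of p])
    fix r assume r: "r \<in> A" "p * r \<in> A"
    then have "p * r \<in> R" by (simp add: R_def L_def)
    then show "(f * p - p) * r = 0" using f(2) RI by (simp add: left_diff_distrib mult.assoc)
  qed
  moreover have "f * q = 0"
  proof (rule eq_zeroI[of q])
    fix r assume r: "r \<in> A" "q * r \<in> A"
    then have "q * r \<in> L" using zero by (auto simp: L_def simp flip: mult.assoc)
    then show "f * q * r = 0" using f(2) LI by (simp add: mult.assoc)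
  qed
  ultimately show thesis using that f(1) by auto
qed

end

section \<open>Corners at primitive central idempotents\<close>

lemma ring_centre_closed:
  fixes x y :: "'q::ring"
  assumes "x \<in> ring_centre" "y \<in> ring_centre"
  shows "x + y \<in> ring_centre" "x - y \<in> ring_centre" "- x \<in> ring_centre" "x * y \<in> ring_centre"
proof -
  have "x * y * q = q * (x * y)" for q
  proof -
    have "x * (y * q) = x * (q * y)" using assms(2) by (simp add: ring_centre_def)
    also have "\<dots> = x * q * y" by (simp add: mult.assoc)
    also have "\<dots> = q * x * y" using assms(1) by (simp add: ring_centre_def)
    finally show ?thesis by (simp add: mult.assoc)
  qed
  then show "x * y \<in> ring_centre" by (simp add: ring_centre_def)
qed (use assms in \<open>auto simp: ring_centre_def distrib_left right_diff_distrib distrib_right left_diff_distrib\<close>)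

lemma ring_centre_zero [simp]: "(0 :: 'q::ring) \<in> ring_centre"
  by (simp add: ring_centre_def)

locale corner = right_quotient_ring A for A :: "'q::{ring,monoid_mult} set" +
  fixes e :: 'q
  assumes e_central: "e \<in> ring_centre" and e_idem: "e * e = e" and e_nonzero: "e \<noteq> 0"
    and primitive: "f \<in> ring_centre \<Longrightarrow> f * f = f \<Longrightarrow> e * f = 0 \<or> e * f = e"
begin

lemma e_commute: "q * e = e * q"
  using e_central by (simp add: ring_centre_def)

text \<open>This is the ring \<open>eQ\<close> with unit \<open>e\<close>, kept as a subset of
  \<open>Q\<close> because \<open>e\<close> is a variable.\<close>

definition V :: "'q set" where "V = {q. e * q = q}"

text \<open>This is \<open>eC\<close>, the coefficient field of the linear algebra below (see
  \<open>K_inverse\<close>).\<close>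

definition K :: "'q set" where "K = {c \<in> ring_centre. e * c = c}"

lemma V_D: "q \<in> V \<Longrightarrow> e * q = q" "q \<in> V \<Longrightarrow> q * e = q"
  by (simp_all add: V_def e_commute)

lemma V_closed:
  "0 \<in> V" "x \<in> V \<Longrightarrow> y \<in> V \<Longrightarrow> x + y \<in> V" "x \<in> V \<Longrightarrow> y \<in> V \<Longrightarrow> x - y \<in> V"
  "x \<in> V \<Longrightarrow> - x \<in> V" "x \<in> V \<Longrightarrow> x * r \<in> V" "x \<in> V \<Longrightarrow> r * x \<in> V" "e * r \<in> V"
proof -
  show "r * x \<in> V" if "x \<in> V"
    using that unfolding V_def by (metis (mono_tags) e_commute mem_Collect_eq mult.assoc)
  show "x * r \<in> V" if "x \<in> V" using that by (simp add: V_def flip: mult.assoc)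
qed (auto simp: V_def distrib_left right_diff_distrib e_idem simp flip: mult.assoc)

lemma V_sum: "(\<And>i. i \<in> S \<Longrightarrow> f i \<in> V) \<Longrightarrow> sum f S \<in> V"
  by (induction S rule: infinite_finite_induct) (auto intro: V_closed)

lemma K_commute: "c \<in> K \<Longrightarrow> q * c = c * q"
  by (simp add: K_def ring_centre_def)

lemma K_left_commute: "c \<in> K \<Longrightarrow> q * (c * p) = c * (q * p)"
  by (metis K_commute mult.assoc)

lemma K_V: "c \<in> K \<Longrightarrow> c \<in> V"
  by (simp add: K_def V_def)

lemma K_closed:
  "0 \<in> K" "e \<in> K" "x \<in> K \<Longrightarrow> y \<in> K \<Longrightarrow> x + y \<in> K" "x \<in> K \<Longrightarrow> y \<in> K \<Longrightarrow> x - y \<in> K"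
  "x \<in> K \<Longrightarrow> - x \<in> K" "x \<in> K \<Longrightarrow> y \<in> K \<Longrightarrow> x * y \<in> K"
  using e_central
  by (auto simp: K_def ring_centre_closed distrib_left right_diff_distrib e_idem simp flip: mult.assoc)

lemma K_I: "c \<in> ring_centre \<Longrightarrow> e * c \<in> K"
  using e_central ring_centre_closed(4) by (auto simp: K_def e_idem simp flip: mult.assoc)

text \<open>If \<open>p A q = 0\<close>, a central idempotent fixes \<open>p\<close> and kills
  \<open>q\<close>. By primitivity it acts on \<open>eQ\<close> as zero or as the identity.\<close>

lemma prime:
  assumes "p \<in> V" "q \<in> V" "\<And>r. r \<in> A \<Longrightarrow> p * r * q = 0"
  shows "p = 0 \<or> q = 0"
proof -
  obtain f where f: "f \<in> ring_centre" "f * f = f" "f * p = p" "f * q = 0"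
    using annihilator_idempotent[of p q] assms(3) by blast
  have "e * f = f * e" by (rule e_commute[symmetric])
  from primitive[OF f(1,2)] show ?thesis
  proof
    assume "e * f = 0"
    then have "p = 0" using f(3) V_D(1)[OF assms(1)] \<open>e * f = f * e\<close> by (metis mult.assoc mult_zero_left)
    then show ?thesis ..
  next
    assume "e * f = e"
    then have "q = 0" using f(4) V_D(1)[OF assms(2)] by (metis mult.assoc mult_zero_right)
    then show ?thesis ..
  qed
qed

lemma primeE:
  assumes "p \<in> V" "q \<in> V" "p \<noteq> 0" "q \<noteq> 0"
  obtains r where "r \<in> A" "p * r * q \<noteq> 0"
  using prime[OF assms(1,2)] assms(3,4) by blast

text \<open>The two Peirce parts are treated separately. The assumption on elements killed by
  \<open>e\<close> and semiprimeness force an annihilating \<open>a\<close> into \<open>eQ\<close>;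
  there a single nonzero \<open>u\<close> suffices by primeness.\<close>

lemma faithful_ideal:
  assumes I: "ideal I" and N: "\<And>x. x \<in> A \<Longrightarrow> e * x = 0 \<Longrightarrow> x \<in> I"
    and u: "u \<in> I" "u \<in> V" "u \<noteq> 0"
  shows "faithful I"
  unfolding faithful_def
proof (intro ballI impI)
  fix a assume a: "a \<in> A" "\<forall>x\<in>I. a * x = 0"
  have "a - e * a = 0"
  proof (rule eq_zeroI[of "a - e * a"])
    fix r assume r: "r \<in> A" "(a - e * a) * r \<in> A"
    let ?y = "(a - e * a) * r"
    have ey: "e * ?y = 0" by (simp add: left_diff_distrib right_diff_distrib e_idem flip: mult.assoc)
    show "?y = 0"
    proof (rule semiprime[OF r(2)])
      fix s assume s: "s \<in> A"
      have "e * (r * s * ?y) = 0" using ey by (metis e_commute mult.assoc mult_zero_right)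
      then have "r * s * ?y \<in> I" using r s by (intro N) (auto intro: mult_closed)
      then have "a * (r * s * ?y) = 0" using a(2) by blast
      moreover have "?y * s * ?y = a * (r * s * ?y) - e * (a * (r * s * ?y))"
        by (simp add: left_diff_distrib mult.assoc)
      ultimately show "?y * s * ?y = 0" by simp
    qed
  qed
  then have "a \<in> V" by (simp add: V_def)
  moreover have "a * r * u = 0" if "r \<in> A" for r
    using a(2) idealD(5)[OF I u(1) that] by (simp add: mult.assoc)
  ultimately show "a = 0" using prime[OF _ u(2)] u(3) by blast
qed

text \<open>\<open>U\<close> and the values of \<open>\<phi>\<close> need not lie in
  \<open>A\<close>, so \<open>\<phi>\<close> is pulled back along \<open>x \<mapsto> e x\<close> to
  the ideal of those \<open>x\<close> for which everything does. On it the map is multiplication by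
  a central \<open>c\<close>, and density carries the formula with \<open>e * c\<close> back to
  \<open>U\<close>. Every later appearance of a scalar in \<open>K\<close> rests on this.\<close>

lemma bimodule_hom_scalar:
  assumes U: "U \<subseteq> V" "0 \<in> U" "\<And>x y. x \<in> U \<Longrightarrow> y \<in> U \<Longrightarrow> x - y \<in> U"
      "\<And>x r. x \<in> U \<Longrightarrow> r \<in> A \<Longrightarrow> x * r \<in> U" "\<And>x r. x \<in> U \<Longrightarrow> r \<in> A \<Longrightarrow> r * x \<in> U"
    and u: "u \<in> U" "u \<noteq> 0"
    and \<phi>: "\<And>x. x \<in> U \<Longrightarrow> \<phi> x \<in> V" "\<And>x y. x \<in> U \<Longrightarrow> y \<in> U \<Longrightarrow> \<phi> (x - y) = \<phi> x - \<phi> y"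
      "\<And>x r. x \<in> U \<Longrightarrow> r \<in> A \<Longrightarrow> \<phi> (x * r) = \<phi> x * r"
      "\<And>x r. x \<in> U \<Longrightarrow> r \<in> A \<Longrightarrow> \<phi> (r * x) = r * \<phi> x"
  shows "\<exists>c\<in>K. \<forall>x\<in>U. \<phi> x = c * x"
proof -
  have \<phi>0: "\<phi> 0 = 0" using \<phi>(2)[OF U(2) U(2)] by simp
  define I where "I = {x\<in>A. e * x \<in> U \<and> \<phi> (e * x) \<in> A}"
  have I: "ideal I" unfolding ideal_def
  proof (intro conjI ballI)
    show "I \<subseteq> A" "0 \<in> I" using U(2) \<phi>0 by (auto simp: I_def)
    show "x - y \<in> I" if "x \<in> I" "y \<in> I" for x y
      using that U(3) \<phi>(2) by (simp add: I_def right_diff_distrib diff_closed)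
    fix x r assume xr: "x \<in> I" "r \<in> A"
    show "x * r \<in> I" using xr U(4) \<phi>(3) by (simp add: I_def mult_closed flip: mult.assoc)
    have "e * (r * x) = r * (e * x)" by (metis e_commute mult.assoc)
    then show "r * x \<in> I" using xr U(5) \<phi>(4) by (simp add: I_def mult_closed)
  qed
  \<comment> \<open>Density is used twice, first to bring \<open>x\<close> into \<open>A\<close> and
    then to bring its image under \<open>\<phi>\<close> into \<open>A\<close>, each time without
    killing \<open>t\<close>.\<close>
  have *: "\<exists>s\<in>A. t * s \<noteq> 0 \<and> x * s \<in> I \<and> x * s \<in> U" if x: "x \<in> U" and t: "t \<noteq> 0" for x t
  proof -
    obtain r where r: "r \<in> A" "t * r \<noteq> 0" "x * r \<in> A" using dense[OF t] by blast
    obtain s where s: "s \<in> A" "t * r * s \<noteq> 0" "\<phi> (x * r) * s \<in> A" using dense[OF r(2)] by blast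
    have xr: "x * r \<in> U" using U(4) x r by blast
    have rs: "r * s \<in> A" using r s by (simp add: mult_closed)
    have "x * (r * s) \<in> U" using U(4)[OF x rs] .
    moreover from this have "e * (x * (r * s)) = x * (r * s)" using U(1) V_D(1) by blast
    moreover have "\<phi> (x * (r * s)) \<in> A" using \<phi>(3)[OF xr s(1)] s(3) by (simp add: mult.assoc)
    moreover have "x * (r * s) \<in> A" using mult_closed[OF r(3) s(1)] by (simp add: mult.assoc)
    ultimately show ?thesis using rs s(2) by (intro bexI[of _ "r * s"]) (auto simp: I_def mult.assoc)
  qed
  obtain s where s: "s \<in> A" "u * s \<noteq> 0" "u * s \<in> I" "u * s \<in> U" using *[OF u(1) u(2)] by blast
  have "faithful I"
    by (rule faithful_ideal[OF I _ s(3) _ s(2)]) (use U(1,2) \<phi>0 s(4) in \<open>auto simp: I_def\<close>)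
  moreover have "\<exists>c\<in>ring_centre. \<forall>x\<in>I. c * x = \<phi> (e * x)"
  proof (rule extend_central[OF I \<open>faithful I\<close>])
    show "\<phi> (e * x) \<in> A" if "x \<in> I" for x using that by (simp add: I_def)
    show "\<phi> (e * (x + y)) = \<phi> (e * x) + \<phi> (e * y)" if "x \<in> I" "y \<in> I" for x y
    proof -
      have "e * x \<in> U" "e * y \<in> U" using that by (auto simp: I_def)
      moreover from this have "- (e * y) \<in> U" using U(3)[OF U(2), of "e * y"] by simp
      moreover have "\<phi> (- (e * y)) = - \<phi> (e * y)"
        using \<phi>(2)[OF U(2), of "e * y"] \<phi>0 \<open>e * y \<in> U\<close> by simp
      ultimately show ?thesis using \<phi>(2)[of "e * x" "- (e * y)"] by (simp add: distrib_left)
    qed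
    fix x r assume "x \<in> I" "r \<in> A"
    then show "\<phi> (e * (x * r)) = \<phi> (e * x) * r" using \<phi>(3) by (simp add: I_def flip: mult.assoc)
    have "e * (r * x) = r * (e * x)" by (metis e_commute mult.assoc)
    then show "\<phi> (e * (r * x)) = r * \<phi> (e * x)" using \<phi>(4) \<open>x \<in> I\<close> \<open>r \<in> A\<close> by (simp add: I_def)
  qed
  ultimately obtain c where c: "c \<in> ring_centre" "\<And>x. x \<in> I \<Longrightarrow> c * x = \<phi> (e * x)" by blast
  have "\<phi> x = e * c * x" if x: "x \<in> U" for x
  proof -
    have "\<phi> x - e * c * x = 0"
    proof (rule ccontr)
      assume "\<phi> x - e * c * x \<noteq> 0"
      from *[OF x this] obtain s where s: "s \<in> A" "(\<phi> x - e * c * x) * s \<noteq> 0" "x * s \<in> I" "x * s \<in> U"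
        by blast
      have "e * (x * s) = x * s" "e * \<phi> (x * s) = \<phi> (x * s)"
        using U(1) V_D(1) s(4) \<phi>(1) by blast+
      then have "e * c * x * s = \<phi> x * s"
        using c(2)[OF s(3)] \<phi>(3)[OF x s(1)] by (simp add: mult.assoc)
      then show False using s(2) by (simp add: left_diff_distrib)
    qed
    then show ?thesis by simp
  qed
  then show ?thesis using K_I[OF c(1)] by blast
qed

text \<open>By primeness \<open>c * x = 0\<close> forces \<open>e * x = 0\<close>. Hence
  \<open>c * x \<mapsto> e * x\<close> is a bimodule map on \<open>c A\<close>, and the scalar it
  amounts to is the inverse.\<close>

lemma K_inverse:
  assumes c: "c \<in> K" "c \<noteq> 0"
  obtains d where "d \<in> K" "d * c = e"
proof -
  have cV: "c \<in> V" using K_V c(1) .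
  have inj: "e * x = 0" if "c * x = 0" for x
  proof -
    have "c * r * (e * x) = 0" for r
    proof -
      have "c * r * (e * x) = e * (r * (c * x))" using K_left_commute[OF c(1)] e_commute
        by (metis mult.assoc)
      then show ?thesis using that by simp
    qed
    then show ?thesis using prime[OF cV, of "e * x"] c(2) V_closed(7) by blast
  qed
  define U where "U = (\<lambda>x. c * x) ` A"
  \<comment> \<open>The chosen \<open>x\<close> is unique only up to elements killed by
    \<open>c\<close>; by \<open>inj\<close> the factor \<open>e\<close> removes the
    ambiguity.\<close>
  define \<phi> where "\<phi> u = e * (SOME x. x \<in> A \<and> u = c * x)" for u
  have \<phi>: "\<phi> (c * x) = e * x" if "x \<in> A" for x
  proof -
    let ?y = "SOME y. y \<in> A \<and> c * x = c * y"
    have "?y \<in> A \<and> c * x = c * ?y" by (rule someI_ex) (use that in blast)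
    then have "c * (x - ?y) = 0" by (simp add: right_diff_distrib)
    from inj[OF this] show ?thesis by (simp add: \<phi>_def right_diff_distrib)
  qed
  obtain x where x: "x \<in> A" "c * x \<noteq> 0" using dense[OF c(2), of c] by blast
  have "\<exists>d\<in>K. \<forall>x\<in>U. \<phi> x = d * x"
  proof (rule bimodule_hom_scalar)
    show "U \<subseteq> V" using V_closed(5)[OF cV] by (auto simp: U_def)
    show "0 \<in> U" unfolding U_def by (rule image_eqI[of _ _ 0]) auto
    show "c * x \<in> U" "c * x \<noteq> 0" using x by (auto simp: U_def)
    fix u v r assume u: "u \<in> U"
    then obtain x where x: "x \<in> A" "u = c * x" by (auto simp: U_def)
    show "\<phi> u \<in> V" using x \<phi> V_closed(7) by simp
    { assume "v \<in> U"
      then obtain y where y: "y \<in> A" "v = c * y" by (auto simp: U_def)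
      have *: "u - v = c * (x - y)" using x y by (simp add: right_diff_distrib)
      show "u - v \<in> U" unfolding * U_def using x y diff_closed by blast
      show "\<phi> (u - v) = \<phi> u - \<phi> v"
        using \<phi>[OF diff_closed[OF x(1) y(1)]] \<phi> x y * by (simp only: right_diff_distrib) }
    { assume r: "r \<in> A"
      have *: "u * r = c * (x * r)" "r * u = c * (r * x)"
        using x K_left_commute[OF c(1)] by (simp_all add: mult.assoc)
      show "u * r \<in> U" "r * u \<in> U" unfolding * U_def using x r mult_closed by blast+
      show "\<phi> (u * r) = \<phi> u * r" unfolding * using x r \<phi> mult_closed by (simp add: mult.assoc)
      have "e * (r * x) = r * (e * x)" by (metis e_commute mult.assoc)
      then show "\<phi> (r * u) = r * \<phi> u" unfolding * using x r \<phi> mult_closed by simp }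
  qed
  then obtain d where d: "d \<in> K" "\<And>x. x \<in> A \<Longrightarrow> e * x = d * (c * x)" using \<phi> by (auto simp: U_def)
  have "d * c - e = 0"
    by (rule eq_zeroI[of 0]) (use d(2) in \<open>simp add: left_diff_distrib mult.assoc\<close>)
  then show thesis using that d(1) by simp
qed

end

section \<open>Linear algebra over the centre of a corner\<close>

context corner
begin

text \<open>Sums over infinite sets are zero, so this is the linear span only for finite
  \<open>W\<close>.\<close>

definition K_span :: "'q set \<Rightarrow> 'q set" where
  "K_span W = {\<Sum>w\<in>W. c w * w | c. \<forall>w. c w \<in> K}"

lemma K_spanI: "(\<And>w. c w \<in> K) \<Longrightarrow> (\<Sum>w\<in>W. c w * w) \<in> K_span W"
  by (auto simp: K_span_def)

lemma K_spanE:
  assumes "x \<in> K_span W"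
  obtains c where "\<And>w. c w \<in> K" "x = (\<Sum>w\<in>W. c w * w)"
  using assms by (auto simp: K_span_def)

lemma K_span_zero [simp]: "0 \<in> K_span W"
  using K_spanI[of "\<lambda>_. 0" W] K_closed(1) by simp

lemma K_span_add: "x \<in> K_span W \<Longrightarrow> y \<in> K_span W \<Longrightarrow> x + y \<in> K_span W"
proof (elim K_spanE)
  fix c d assume "\<And>w. c w \<in> K" "\<And>w. d w \<in> K" "x = (\<Sum>w\<in>W. c w * w)" "y = (\<Sum>w\<in>W. d w * w)"
  then show ?thesis using K_spanI[of "\<lambda>w. c w + d w" W] K_closed(3)
    by (simp add: distrib_right sum.distrib)
qed

lemma K_span_scale: "x \<in> K_span W \<Longrightarrow> k \<in> K \<Longrightarrow> k * x \<in> K_span W"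
proof (elim K_spanE)
  fix c assume "\<And>w. c w \<in> K" "x = (\<Sum>w\<in>W. c w * w)" "k \<in> K"
  then show ?thesis using K_spanI[of "\<lambda>w. k * c w" W] K_closed(6)
    by (simp add: sum_distrib_left mult.assoc)
qed

lemma K_span_uminus: "x \<in> K_span W \<Longrightarrow> - x \<in> K_span W"
proof (elim K_spanE)
  fix c assume "\<And>w. c w \<in> K" "x = (\<Sum>w\<in>W. c w * w)"
  then show ?thesis using K_spanI[of "\<lambda>w. - c w" W] K_closed(5)
    by (simp add: sum_negf)
qed

lemma K_span_diff: "x \<in> K_span W \<Longrightarrow> y \<in> K_span W \<Longrightarrow> x - y \<in> K_span W"
  using K_span_add[of x W "- y"] K_span_uminus[of y W] by simp

lemma K_span_sum: "(\<And>i. i \<in> S \<Longrightarrow> f i \<in> K_span W) \<Longrightarrow> sum f S \<in> K_span W"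
  by (induction S rule: infinite_finite_induct) (auto intro: K_span_add)

lemma K_span_mono:
  assumes "finite W'" "W \<subseteq> W'"
  shows "K_span W \<subseteq> K_span W'"
proof
  fix x assume "x \<in> K_span W"
  then obtain c where c: "\<And>w. c w \<in> K" "x = (\<Sum>w\<in>W. c w * w)" by (elim K_spanE) blast
  have "x = (\<Sum>w\<in>W'. (if w \<in> W then c w else 0) * w)"
    using assms unfolding c(2) by (intro sum.mono_neutral_cong_left) auto
  also have "\<dots> \<in> K_span W'" by (rule K_spanI) (use c(1) K_closed(1) in auto)
  finally show "x \<in> K_span W'" .
qed

lemma K_span_insert:
  assumes "finite W" "w \<notin> W" "x \<in> K_span (insert w W)"
  obtains k where "k \<in> K" "x - k * w \<in> K_span W"
proof -
  obtain c where c: "\<And>w. c w \<in> K" "x = (\<Sum>w\<in>insert w W. c w * w)" using assms(3) by (elim K_spanE) blast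
  have "x - c w * w = (\<Sum>w\<in>W. c w * w)" using assms(1,2) c(2) by simp
  then show thesis using that[of "c w"] c(1) K_spanI[of c W] by simp
qed

lemma K_span_base:
  assumes "finite W" "w \<in> W" "w \<in> V"
  shows "w \<in> K_span W"
proof -
  have "e * w \<in> K_span {w}" using K_spanI[of "\<lambda>_. e" "{w}"] K_closed(2) by simp
  then show ?thesis using K_span_mono[of W "{w}"] assms V_D(1)[of w] by auto
qed

lemma K_span_mult:
  assumes "x \<in> K_span W" "finite W" "W \<subseteq> V"
  shows "r * x * s \<in> K_span ((\<lambda>w. r * w * s) ` W)"
proof -
  obtain c where c: "\<And>w. c w \<in> K" "x = (\<Sum>w\<in>W. c w * w)" using assms(1) by (elim K_spanE) blast
  have "r * x * s = (\<Sum>w\<in>W. c w * (r * w * s))"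
    by (simp add: c(2) sum_distrib_left sum_distrib_right mult.assoc K_left_commute[OF c(1)])
  also have "\<dots> \<in> K_span ((\<lambda>w. r * w * s) ` W)"
    using assms c(1) by (intro K_span_sum K_span_scale K_span_base) (auto intro: V_closed)
  finally show ?thesis .
qed

text \<open>A list of pairs \<open>(r, s)\<close> stands for the operator \<open>y \<mapsto> \<Sum> r y s\<close>.\<close>

definition elem :: "('q \<times> 'q) list \<Rightarrow> 'q \<Rightarrow> 'q" where
  "elem rs y = (\<Sum>(r, s)\<leftarrow>rs. r * y * s)"

lemma elem_simps [simp]:
  "elem [] y = 0" "elem ((r, s) # rs) y = r * y * s + elem rs y"
  "elem (rs @ rs') y = elem rs y + elem rs' y"
  by (simp_all add: elem_def)

lemma elem_add: "elem rs (x + y) = elem rs x + elem rs y"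
  by (induction rs) (auto simp: algebra_simps)

lemma elem_diff: "elem rs (x - y) = elem rs x - elem rs y"
  by (induction rs) (auto simp: algebra_simps)

lemma elem_zero [simp]: "elem rs 0 = 0"
  by (induction rs) auto

lemma elem_scale: "k \<in> K \<Longrightarrow> elem rs (k * y) = k * elem rs y"
  by (induction rs) (auto simp: distrib_left mult.assoc K_left_commute[of k])

lemma elem_sum: "elem rs (\<Sum>i\<in>S. f i) = (\<Sum>i\<in>S. elem rs (f i))"
  by (induction S rule: infinite_finite_induct) (auto simp: elem_add)

lemma elem_right: "elem (map (\<lambda>(r, s). (r, s * b)) rs) y = elem rs y * b"
  by (induction rs) (auto simp: distrib_left distrib_right mult.assoc)

lemma elem_left: "elem (map (\<lambda>(r, s). (a * r, s)) rs) y = a * elem rs y"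
  by (induction rs) (auto simp: distrib_left distrib_right mult.assoc)

lemma elem_uminus: "elem (map (\<lambda>(r, s). (- r, s)) rs) y = - elem rs y"
  by (induction rs) auto

lemma elem_V: "y \<in> V \<Longrightarrow> elem rs y \<in> V"
  by (induction rs) (auto simp: V_closed)

lemma elem_span_zero:
  assumes "\<And>w. w \<in> W \<Longrightarrow> elem rs w = 0" "x \<in> K_span W"
  shows "elem rs x = 0"
proof -
  obtain c where c: "\<And>w. c w \<in> K" "x = (\<Sum>w\<in>W. c w * w)" using assms(2) by (elim K_spanE) blast
  then show ?thesis using assms(1) by (simp add: elem_sum elem_scale)
qed

text \<open>Martindale's lemma: elementary operators with coefficients in \<open>A\<close> separate
  a vector from a finite-dimensional space. In the induction let \<open>E\<close> be the operators
  killing \<open>W\<close>. If each of them that kills \<open>w\<close> also killed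
  \<open>a\<close>, then sending the image of \<open>w\<close> to the image of \<open>a\<close>
  would be a well-defined bimodule map, hence a scalar \<open>c\<close>. Then all of
  \<open>E\<close> kills \<open>a - c * w\<close>, which the induction hypothesis puts into the span
  of \<open>W\<close>.\<close>

lemma martindale:
  assumes "finite W" "W \<subseteq> V" "a \<in> V" "a \<notin> K_span W"
  shows "\<exists>rs. set rs \<subseteq> A \<times> A \<and> elem rs a \<noteq> 0 \<and> (\<forall>w\<in>W. elem rs w = 0)"
  using assms
proof (induction W arbitrary: a rule: finite_induct)
  \<comment> \<open>\<open>A\<close> need not contain a unit, so nonzero factors have to be found on
    both sides of \<open>a\<close>.\<close>
  case empty
  then have a: "a \<noteq> 0" by auto
  then obtain s where s: "s \<in> A" "a * s \<noteq> 0" using dense by blast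
  have "a * s \<in> V" using empty V_closed(5) by simp
  from primeE[OF this this s(2) s(2)] obtain r where r: "r \<in> A" "a * s * r * (a * s) \<noteq> 0" by blast
  then have "r * (a * s) \<noteq> 0" by (auto simp: mult.assoc)
  then show ?case using r(1) s(1) by (intro exI[of _ "[(r, s)]"]) (simp add: mult.assoc)
next
  case (insert w W)
  define E where "E = {rs. set rs \<subseteq> A \<times> A \<and> (\<forall>w\<in>W. elem rs w = 0)}"
  have WV: "W \<subseteq> V" "w \<in> V" using insert.prems(1) by auto
  have aW: "a \<notin> K_span W" using insert.prems(3) K_span_mono[of "insert w W" W] insert.hyps(1) by auto
  show ?case
  proof (cases "w \<in> K_span W")
    case True
    obtain rs where rs: "set rs \<subseteq> A \<times> A" "elem rs a \<noteq> 0" "\<forall>w\<in>W. elem rs w = 0"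
      using insert.IH[OF WV(1) insert.prems(2) aW] by blast
    then have "elem rs w = 0" using elem_span_zero[of W rs w] True by blast
    then show ?thesis using rs by blast
  next
    case False
    show ?thesis
    proof (rule ccontr)
      assume "\<not> ?thesis"
      then have kill: "elem rs a = 0" if "rs \<in> E" "elem rs w = 0" for rs
        using that by (auto simp: E_def)
      have E_diff: "rs @ map (\<lambda>(r, s). (- r, s)) rs' \<in> E" if "rs \<in> E" "rs' \<in> E" for rs rs'
        using that by (auto simp: E_def elem_uminus intro!: uminus_closed)
      have E_right: "map (\<lambda>(r, s). (r, s * b)) rs \<in> E" if "rs \<in> E" "b \<in> A" for rs b
        using that by (auto simp: E_def elem_right intro!: mult_closed)
      have E_left: "map (\<lambda>(r, s). (b * r, s)) rs \<in> E" if "rs \<in> E" "b \<in> A" for rs b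
        using that by (auto simp: E_def elem_left intro!: mult_closed)
      define U where "U = (\<lambda>rs. elem rs w) ` E"
      define \<phi> where "\<phi> u = elem (SOME rs. rs \<in> E \<and> elem rs w = u) a" for u
      have \<phi>: "\<phi> (elem rs w) = elem rs a" if "rs \<in> E" for rs
      proof -
        let ?rs = "SOME rs'. rs' \<in> E \<and> elem rs' w = elem rs w"
        have "?rs \<in> E \<and> elem ?rs w = elem rs w" by (rule someI_ex) (use that in blast)
        then have "elem (?rs @ map (\<lambda>(r, s). (- r, s)) rs) a = 0"
          using that by (intro kill E_diff) (auto simp: elem_uminus)
        then show ?thesis by (simp add: \<phi>_def elem_uminus)
      qed
      obtain rs0 where rs0: "rs0 \<in> E" "elem rs0 w \<noteq> 0"
        using insert.IH[OF WV False] by (auto simp: E_def)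
      have "\<exists>c\<in>K. \<forall>x\<in>U. \<phi> x = c * x"
      proof (rule bimodule_hom_scalar)
        show "U \<subseteq> V" using elem_V WV(2) by (auto simp: U_def)
        show "0 \<in> U" unfolding U_def by (rule image_eqI[of _ _ "[]"]) (auto simp: E_def)
        show "elem rs0 w \<in> U" "elem rs0 w \<noteq> 0" using rs0 by (auto simp: U_def)
        fix u v r assume "u \<in> U"
        then obtain rs where rs: "rs \<in> E" "u = elem rs w" by (auto simp: U_def)
        show "\<phi> u \<in> V" using rs \<phi> elem_V insert.prems(2) by simp
        { assume "v \<in> U"
          then obtain rs' where rs': "rs' \<in> E" "v = elem rs' w" by (auto simp: U_def)
          have *: "u - v = elem (rs @ map (\<lambda>(r, s). (- r, s)) rs') w"
            using rs rs' by (simp add: elem_uminus)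
          show "u - v \<in> U" unfolding * U_def using E_diff[OF rs(1) rs'(1)] by blast
          show "\<phi> (u - v) = \<phi> u - \<phi> v"
            unfolding * using \<phi>[OF E_diff[OF rs(1) rs'(1)]] \<phi>[OF rs(1)] \<phi>[OF rs'(1)] rs(2) rs'(2)
            by (simp add: elem_uminus) }
        { assume r: "r \<in> A"
          have *: "u * r = elem (map (\<lambda>(x, s). (x, s * r)) rs) w" by (simp add: elem_right rs(2))
          show "u * r \<in> U" unfolding * U_def using E_right[OF rs(1) r] by blast
          show "\<phi> (u * r) = \<phi> u * r"
            unfolding * using \<phi>[OF E_right[OF rs(1) r]] \<phi>[OF rs(1)] rs(2) by (simp add: elem_right) }
        { assume r: "r \<in> A"
          have *: "r * u = elem (map (\<lambda>(x, s). (r * x, s)) rs) w" by (simp add: elem_left rs(2))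
          show "r * u \<in> U" unfolding * U_def using E_left[OF rs(1) r] by blast
          show "\<phi> (r * u) = r * \<phi> u"
            unfolding * using \<phi>[OF E_left[OF rs(1) r]] \<phi>[OF rs(1)] rs(2) by (simp add: elem_left) }
      qed
      then obtain c where c: "c \<in> K" "\<And>rs. rs \<in> E \<Longrightarrow> elem rs a = c * elem rs w"
        using \<phi> by (auto simp: U_def)
      have "elem rs (a - c * w) = 0" if "rs \<in> E" for rs
        using c that by (simp add: elem_diff elem_scale)
      then have "a - c * w \<in> K_span W"
        using insert.IH[OF WV(1), of "a - c * w"] V_closed(3,6) insert.prems(2) WV(2)
        by (auto simp: E_def)
      then have "a - c * w \<in> K_span (insert w W)"
        using K_span_mono[of "insert w W" W] insert.hyps(1) by auto
      moreover have "c * w \<in> K_span (insert w W)"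
        using insert.hyps(1) WV(2) c(1) by (intro K_span_scale K_span_base) auto
      ultimately have "a - c * w + c * w \<in> K_span (insert w W)" by (rule K_span_add)
      then show False using insert.prems(3) by simp
    qed
  qed
qed

section \<open>Maps of finite rank and Amitsur's lemma\<close>

definition finite_rank :: "('q \<Rightarrow> 'q) \<Rightarrow> bool" where
  "finite_rank T \<longleftrightarrow> (\<exists>W. finite W \<and> W \<subseteq> V \<and> T ` A \<subseteq> K_span W)"

text \<open>Amitsur's lemma. If it fails on adding \<open>k\<close>, then wherever the maps in
  \<open>S\<close> are independent modulo \<open>W\<close>, the value of \<open>T k\<close> is a
  combination of theirs modulo \<open>W\<close>. Additivity forces the coefficients to be the same
  at all sufficiently independent points, and the corresponding combination of the maps then has
  finite rank.\<close>

lemma amitsur: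
  assumes "finite S"
    and "\<And>i x. i \<in> S \<Longrightarrow> x \<in> A \<Longrightarrow> T i x \<in> V"
    and "\<And>i x y. i \<in> S \<Longrightarrow> x \<in> A \<Longrightarrow> y \<in> A \<Longrightarrow> T i (x + y) = T i x + T i y"
    and "\<And>c. (\<And>i. c i \<in> K) \<Longrightarrow> finite_rank (\<lambda>x. \<Sum>i\<in>S. c i * T i x) \<Longrightarrow> \<forall>i\<in>S. c i = 0"
    and "finite W" "W \<subseteq> V"
  shows "\<exists>x\<in>A. \<forall>c. (\<forall>i. c i \<in> K) \<longrightarrow> (\<Sum>i\<in>S. c i * T i x) \<in> K_span W \<longrightarrow> (\<forall>i\<in>S. c i = 0)"
  using assms
proof (induction S arbitrary: W rule: finite_induct)
  case empty
  show ?case by (rule bexI[OF _ zero_closed]) simp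
next
  case (insert k S)
  define indep where "indep W x \<longleftrightarrow>
    (\<forall>c. (\<forall>i. c i \<in> K) \<longrightarrow> (\<Sum>i\<in>S. c i * T i x) \<in> K_span W \<longrightarrow> (\<forall>i\<in>S. c i = 0))" for W x
  have indepD: "\<forall>i\<in>S. c i = 0"
    if "indep W x" "\<And>i. c i \<in> K" "(\<Sum>i\<in>S. c i * T i x) \<in> K_span W" for W x c
    using that by (auto simp: indep_def)
  have TV: "T i x \<in> V" if "i \<in> S" "x \<in> A" for i x using insert.prems(1) that by simp
  have T_add: "T i (x + y) = T i x + T i y" if "i \<in> S" "x \<in> A" "y \<in> A" for i x y
    using insert.prems(2) that by simp
  have norank: "\<forall>i\<in>S. c i = 0" if "\<And>i. c i \<in> K" "finite_rank (\<lambda>x. \<Sum>i\<in>S. c i * T i x)" for c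
  proof -
    have "(\<Sum>i\<in>S. c i * T i x) = (\<Sum>i\<in>insert k S. (c(k := 0)) i * T i x)" for x
      using insert.hyps by (simp, intro sum.cong) auto
    then have "\<forall>i\<in>insert k S. (c(k := 0)) i = 0"
      using that K_closed(1) by (intro insert.prems(3)) auto
    then show ?thesis using insert.hyps(2) by (metis fun_upd_other insertCI)
  qed
  have ex: "\<exists>x\<in>A. indep W x" if "finite W" "W \<subseteq> V" for W
    unfolding indep_def by (rule insert.IH) (use TV T_add norank that in auto)
  show ?case
  proof (rule ccontr)
    assume contra: "\<not> ?case"
    have dep: "\<exists>\<tau>. (\<forall>i. \<tau> i \<in> K) \<and> T k x - (\<Sum>i\<in>S. \<tau> i * T i x) \<in> K_span W"
      if x: "x \<in> A" "indep W x" for x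
    proof -
      from contra x(1) obtain c where c: "\<And>i. c i \<in> K" "(\<Sum>i\<in>insert k S. c i * T i x) \<in> K_span W"
        "\<not> (\<forall>i\<in>insert k S. c i = 0)" by blast
      have split: "(\<Sum>i\<in>insert k S. c i * T i x) = c k * T k x + (\<Sum>i\<in>S. c i * T i x)"
        using insert.hyps by simp
      have "c k \<noteq> 0"
      proof
        assume "c k = 0"
        then have "\<forall>i\<in>S. c i = 0" using x(2) c(1,2) split by (auto simp: indep_def)
        then show False using c(3) \<open>c k = 0\<close> by auto
      qed
      then obtain d where d: "d \<in> K" "d * c k = e" using K_inverse c(1) by blast
      have "d * (c k * T k x + (\<Sum>i\<in>S. c i * T i x)) \<in> K_span W"
        using c(2) d(1) split by (simp add: K_span_scale)
      also have "d * (c k * T k x + (\<Sum>i\<in>S. c i * T i x)) = T k x - (\<Sum>i\<in>S. - (d * c i) * T i x)"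
        using d(2) V_D(1)[OF insert.prems(1)[of k x]] x(1)
        by (simp add: distrib_left sum_distrib_left sum_negf flip: mult.assoc)
      finally show ?thesis using d(1) c(1) K_closed(5,6) by (intro exI[of _ "\<lambda>i. - (d * c i)"]) auto
    qed
    obtain y where y: "y \<in> A" "indep W y" using ex insert.prems(4,5) by blast
    obtain \<tau> where \<tau>: "\<And>i. \<tau> i \<in> K" "T k y - (\<Sum>i\<in>S. \<tau> i * T i y) \<in> K_span W" using dep[OF y] by blast
    define R where "R x = T k x - (\<Sum>i\<in>S. \<tau> i * T i x)" for x
    have R_add: "R (x + x') = R x + R x'" if "x \<in> A" "x' \<in> A" for x x'
      using T_add[OF _ that] insert.prems(2)[of k x x'] that
      by (simp add: R_def distrib_left sum.distrib)
    \<comment> \<open>With the values at \<open>y\<close> added to \<open>W\<close>, independence at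
      \<open>x\<close> modulo \<open>W'\<close> gives independence at \<open>x + y\<close> modulo
      \<open>W\<close>.\<close>
    define W' where "W' = W \<union> (\<lambda>i. T i y) ` S"
    have W': "finite W'" "W' \<subseteq> V" using insert.prems(4,5) insert.hyps(1) TV y(1) by (auto simp: W'_def)
    have combo: "(\<Sum>i\<in>S. c i * T i y) \<in> K_span W'" if "\<And>i. c i \<in> K" for c
      using W' that TV y(1) by (intro K_span_sum K_span_scale K_span_base) (auto simp: W'_def)
    have WW': "K_span W \<subseteq> K_span W'" using K_span_mono[OF W'(1)] by (auto simp: W'_def)
    txt \<open>Comparing the relations at \<open>x\<close> and at \<open>x + y\<close> forces the relation at \<open>x\<close> to have the
      coefficients it has at \<open>y\<close>.\<close>
    have good: "R x \<in> K_span W" if x: "x \<in> A" "indep W' x" for x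
    proof -
      have "indep W x" using x(2) WW' by (auto simp: indep_def)
      from dep[OF x(1) this] obtain \<alpha> where
        \<alpha>: "\<And>i. \<alpha> i \<in> K" "T k x - (\<Sum>i\<in>S. \<alpha> i * T i x) \<in> K_span W" by blast
      have xy: "x + y \<in> A" using x(1) y(1) add_closed by blast
      have "indep W (x + y)" unfolding indep_def
      proof (intro allI impI)
        fix c assume c: "\<forall>i. c i \<in> K" "(\<Sum>i\<in>S. c i * T i (x + y)) \<in> K_span W"
        have "(\<Sum>i\<in>S. c i * T i (x + y)) - (\<Sum>i\<in>S. c i * T i y) = (\<Sum>i\<in>S. c i * T i x)"
          using T_add[OF _ x(1) y(1)] by (simp add: distrib_left sum.distrib)
        moreover have "(\<Sum>i\<in>S. c i * T i (x + y)) - (\<Sum>i\<in>S. c i * T i y) \<in> K_span W'"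
          using c WW' combo by (intro K_span_diff) auto
        ultimately show "\<forall>i\<in>S. c i = 0" using x(2) c(1) by (simp add: indep_def)
      qed
      from dep[OF xy this] obtain \<gamma> where
        \<gamma>: "\<And>i. \<gamma> i \<in> K" "T k (x + y) - (\<Sum>i\<in>S. \<gamma> i * T i (x + y)) \<in> K_span W" by blast
      define P where "P = (T k x - (\<Sum>i\<in>S. \<alpha> i * T i x)) + (T k y - (\<Sum>i\<in>S. \<tau> i * T i y))
        - (T k (x + y) - (\<Sum>i\<in>S. \<gamma> i * T i (x + y)))"
      have P: "P = (\<Sum>i\<in>S. (\<gamma> i - \<alpha> i) * T i x) + (\<Sum>i\<in>S. (\<gamma> i - \<tau> i) * T i y)"
        using T_add[OF _ x(1) y(1)] insert.prems(2)[of k x y] x(1) y(1)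
        by (simp add: P_def distrib_left sum.distrib left_diff_distrib sum_subtractf)
      have PW: "P \<in> K_span W" unfolding P_def by (rule K_span_diff[OF K_span_add[OF \<alpha>(2) \<tau>(2)] \<gamma>(2)])
      have "P - (\<Sum>i\<in>S. (\<gamma> i - \<tau> i) * T i y) \<in> K_span W'"
        using PW WW' combo[of "\<lambda>i. \<gamma> i - \<tau> i"] \<gamma>(1) \<tau>(1) K_closed(4) by (intro K_span_diff) auto
      then have eq1: "\<forall>i\<in>S. \<gamma> i - \<alpha> i = 0"
        by (intro indepD[OF x(2)]) (auto simp: P \<gamma>(1) \<alpha>(1) K_closed(4))
      then have "P = (\<Sum>i\<in>S. (\<gamma> i - \<tau> i) * T i y)" unfolding P by simp
      then have "\<forall>i\<in>S. \<gamma> i - \<tau> i = 0"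
        using PW by (intro indepD[OF y(2)]) (auto simp: \<gamma>(1) \<tau>(1) K_closed(4))
      then have "\<forall>i\<in>S. \<alpha> i = \<tau> i" using eq1 by auto
      then show ?thesis using \<alpha>(2) by (simp add: R_def)
    qed
    \<comment> \<open>An arbitrary \<open>x\<close> is the difference of \<open>x + z\<close> and
      \<open>z\<close>. Choosing \<open>z\<close> independent also of the values at \<open>x\<close>
      makes both points good.\<close>
    have "R x \<in> K_span W" if x: "x \<in> A" for x
    proof -
      define W'' where "W'' = W' \<union> (\<lambda>i. T i x) ` S"
      have W'': "finite W''" "W'' \<subseteq> V" using W' insert.hyps(1) TV x by (auto simp: W''_def)
      obtain z where z: "z \<in> A" "indep W'' z" using ex[OF W''] by blast
      have WW'': "K_span W' \<subseteq> K_span W''" using K_span_mono[OF W''(1)] by (auto simp: W''_def)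
      have "indep W' z" using z(2) WW'' by (auto simp: indep_def)
      moreover have "indep W' (x + z)" unfolding indep_def
      proof (intro allI impI)
        fix c assume c: "\<forall>i. c i \<in> K" "(\<Sum>i\<in>S. c i * T i (x + z)) \<in> K_span W'"
        have "(\<Sum>i\<in>S. c i * T i (x + z)) - (\<Sum>i\<in>S. c i * T i x) = (\<Sum>i\<in>S. c i * T i z)"
          using T_add[OF _ x z(1)] by (simp add: distrib_left sum.distrib)
        moreover have "(\<Sum>i\<in>S. c i * T i x) \<in> K_span W''"
          using W'' c(1) TV x by (intro K_span_sum K_span_scale K_span_base) (auto simp: W''_def)
        then have "(\<Sum>i\<in>S. c i * T i (x + z)) - (\<Sum>i\<in>S. c i * T i x) \<in> K_span W''"
          using c(2) WW'' by (intro K_span_diff) auto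
        ultimately show "\<forall>i\<in>S. c i = 0" using z(2) c(1) by (simp add: indep_def)
      qed
      ultimately have "R z \<in> K_span W" "R (x + z) \<in> K_span W" using good z(1) x add_closed by blast+
      then have "R (x + z) - R z \<in> K_span W" by (intro K_span_diff)
      then show ?thesis using R_add[OF x z(1)] by simp
    qed
    then have "finite_rank R" unfolding finite_rank_def using insert.prems(4,5) by blast
    \<comment> \<open>The coefficient of \<open>T k\<close> is the unit \<open>e\<close> of
      \<open>K\<close>, so this finite rank combination is nontrivial.\<close>
    define c where "c i = (if i = k then e else - \<tau> i)" for i
    have "(\<Sum>i\<in>insert k S. c i * T i x) = R x" if "x \<in> A" for x
    proof -
      have "(\<Sum>i\<in>S. c i * T i x) = (\<Sum>i\<in>S. - (\<tau> i * T i x))"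
        using insert.hyps(2) by (intro sum.cong) (auto simp: c_def)
      then show ?thesis using insert.hyps V_D(1)[OF insert.prems(1)[of k x]] that
        by (simp add: R_def c_def sum_negf)
    qed
    then have "finite_rank (\<lambda>x. \<Sum>i\<in>insert k S. c i * T i x)"
      using \<open>finite_rank R\<close> by (simp add: finite_rank_def image_def)
    then have "\<forall>i\<in>insert k S. c i = 0"
      using \<tau>(1) K_closed(2,5) by (intro insert.prems(3)) (auto simp: c_def)
    then show False using e_nonzero by (simp add: c_def)
  qed
qed

end

section \<open>Generalized polynomials as sums of words\<close>

text \<open>The generalized monomial \<open>a1 x1 a2 x2 ... an xn j\<close>: each letter pairs a
  coefficient with the variable following it, and \<open>j\<close> is the last coefficient.\<close>

primrec word_val :: "('i \<Rightarrow> 'r::{ring,monoid_mult}) \<Rightarrow> (nat \<Rightarrow> 'r) \<Rightarrow> ('i \<times> nat) list \<Rightarrow> 'i \<Rightarrow> 'r" where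
  "word_val h v [] j = h j"
| "word_val h v (x # w) j = h (fst x) * v (snd x) * word_val h v w j"

lemma word_val_append:
  "word_val h v (u @ (i, m) # w) j = word_val h v u i * v m * word_val h v w j"
  by (induction u) (auto simp: mult.assoc)

lemma word_val_cong:
  "(\<And>p. p \<in> snd ` set w \<Longrightarrow> v p = v' p) \<Longrightarrow> word_val h v w j = word_val h v' w j"
  by (induction w) auto

lemma word_val_hom:
  assumes "is_ring_hom \<phi>"
  shows "\<phi> (word_val h v w j) = word_val (\<phi> \<circ> h) (\<phi> \<circ> v) w j"
  by (induction w) (auto simp: is_ring_homD[OF assms])

text \<open>Words are closed under products, the two coefficients meeting at the junction being
  multiplied; sums of words therefore form a subring containing the generators.\<close>

lemma gen_poly_word_sum:
  fixes g :: "'q::{ring,monoid_mult} gen_poly"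
  shows "\<exists>ws. g = (\<Sum>(w, j)\<leftarrow>ws. word_val gp_coef gp_indet w j)"
proof -
  let ?M = "\<lambda>w j. word_val gp_coef gp_indet w j :: 'q gen_poly"
  note hom = is_ring_homD[OF gp_coef_hom(1)]
  define R where "R = {\<Sum>(w, j)\<leftarrow>ws. ?M w j | ws. True}"
  have R_add: "x + y \<in> R" if xy: "x \<in> R" "y \<in> R" for x y
  proof -
    obtain ws where 1: "x = (\<Sum>(w, j)\<leftarrow>ws. ?M w j)" using xy unfolding R_def by blast
    obtain ws' where 2: "y = (\<Sum>(w, j)\<leftarrow>ws'. ?M w j)" using xy unfolding R_def by blast
    have "x + y = (\<Sum>(w, j)\<leftarrow>ws @ ws'. ?M w j)" by (simp add: 1 2)
    then show ?thesis unfolding R_def by blast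
  qed
  have R0: "0 \<in> R" unfolding R_def by (rule CollectI, rule exI[of _ "[]"]) simp
  have R_mon: "?M w j \<in> R" for w j
    unfolding R_def by (rule CollectI, rule exI[of _ "[(w, j)]"]) simp
  have R_sum: "sum_list xs \<in> R" if "set xs \<subseteq> R" for xs
    using that by (induction xs) (auto simp: R0 R_add)
  have coef_mult: "\<exists>w' j'. gp_coef q * ?M w j = ?M w' j'" for q w j
  proof (cases w)
    case Nil
    then have "gp_coef q * ?M w j = ?M [] (q * j)" by (simp add: hom)
    then show ?thesis by blast
  next
    case (Cons x w')
    then have "gp_coef q * ?M w j = ?M ((q * fst x, snd x) # w') j" by (simp add: hom mult.assoc)
    then show ?thesis by blast
  qed
  have mon_mult: "\<exists>w'' j''. ?M w j * ?M w' j' = ?M w'' j''" for w j w' j'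
  proof (induction w)
    case Nil
    then show ?case using coef_mult by simp
  next
    case (Cons x w)
    then obtain w'' j'' where "?M w j * ?M w' j' = ?M w'' j''" by blast
    then have "?M (x # w) j * ?M w' j' = ?M (x # w'') j''" by (simp add: mult.assoc)
    then show ?case by blast
  qed
  have R_mult: "x * y \<in> R" if xy: "x \<in> R" "y \<in> R" for x y
  proof -
    have mon: "?M w j * y \<in> R" for w j
    proof -
      obtain ws where "y = (\<Sum>(w, j)\<leftarrow>ws. ?M w j)" using xy(2) by (auto simp: R_def)
      then have "?M w j * y = (\<Sum>(w', j')\<leftarrow>ws. ?M w j * ?M w' j')"
        by (simp add: sum_list_const_mult[symmetric] case_prod_unfold)
      also have "\<dots> \<in> R"
      proof (intro R_sum subsetI)
        fix z assume "z \<in> set (map (\<lambda>(w', j'). ?M w j * ?M w' j') ws)"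
        then obtain w' j' where "z = ?M w j * ?M w' j'" by auto
        then show "z \<in> R" using mon_mult[of w j w' j'] R_mon by auto
      qed
      finally show ?thesis .
    qed
    obtain ws where "x = (\<Sum>(w, j)\<leftarrow>ws. ?M w j)" using xy(1) by (auto simp: R_def)
    then have "x * y = (\<Sum>(w, j)\<leftarrow>ws. ?M w j * y)"
      by (simp add: sum_list_mult_const[symmetric] case_prod_unfold)
    also have "\<dots> \<in> R" by (intro R_sum) (use mon in auto)
    finally show ?thesis .
  qed
  have R_coef: "gp_coef q \<in> R" for q using R_mon[of "[]" q] by simp
  have "abs_gen_poly t \<in> R" for t
  proof (induction t)
    case (Coef q)
    then show ?case using R_coef[of q] by (simp add: gp_coef.abs_eq)
  next
    case (Indet i)
    have "gp_indet i = ?M [(1, i)] 1" by (simp add: gp_coef_hom(2))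
    then show ?case using R_mon[of "[(1, i)]" 1] by (simp add: gp_indet.abs_eq)
  next
    case (Plus s t)
    then show ?case using R_add by (simp flip: plus_gen_poly.abs_eq)
  next
    case (Neg t)
    have "- abs_gen_poly t = gp_coef (- 1) * abs_gen_poly t" by (simp add: hom gp_coef_hom(2))
    then show ?case using R_mult[OF R_coef Neg] by (simp flip: uminus_gen_poly.abs_eq)
  next
    case (Times s t)
    then show ?case using R_mult by (simp flip: times_gen_poly.abs_eq)
  qed
  then have "g \<in> R" using gen_poly_surj[of g] by auto
  then show ?thesis by (auto simp: R_def)
qed

text \<open>Inclusion-exclusion as an induction on the support: the sum over supports inside
  \<open>S\<close> splits by exact support, and all parts except that of \<open>S\<close> vanish
  already. It extracts the multilinear part of a polarised identity.\<close>

lemma sum_eq_zero_of_supports: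
  fixes g :: "'i \<Rightarrow> 'm::ab_group_add"
  assumes G: "finite G" and N: "finite N" and zero: "\<And>S. S \<subseteq> N \<Longrightarrow> (\<Sum>u | u \<in> G \<and> s u \<subseteq> S. g u) = 0"
  shows "(\<Sum>u | u \<in> G \<and> s u = N. g u) = 0"
proof -
  have "S \<subseteq> N \<Longrightarrow> (\<Sum>u | u \<in> G \<and> s u = S. g u) = 0" if "finite S" for S
    using that
  proof (induction S rule: finite_psubset_induct)
    case (psubset S)
    have "(\<Sum>u | u \<in> G \<and> s u \<subseteq> S. g u) = (\<Sum>T\<in>Pow S. \<Sum>u | u \<in> {u \<in> G. s u \<subseteq> S} \<and> s u = T. g u)"
      using G psubset.hyps(1) by (intro sum.group[symmetric]) auto
    also have "\<dots> = (\<Sum>T\<in>Pow S. \<Sum>u | u \<in> G \<and> s u = T. g u)"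
      by (intro sum.cong) auto
    also have "\<dots> = (\<Sum>T\<in>{S}. \<Sum>u | u \<in> G \<and> s u = T. g u)"
      using psubset by (intro sum.mono_neutral_right) auto
    finally show ?case using zero[OF psubset.prems] by simp
  qed
  then show ?thesis using N by blast
qed

text \<open>Multilinear expansion: choosing one summand \<open>p\<close> at each letter of
  \<open>w\<close> amounts to choosing a lift \<open>u\<close> of \<open>w\<close> along
  \<open>s\<close>.\<close>

lemma word_val_sum:
  fixes y :: "nat \<Rightarrow> 'r::{ring,monoid_mult}" and N :: "nat set"
  assumes N: "finite N"
  shows "word_val h (\<lambda>i. \<Sum>p | p \<in> N \<and> s p = i. y p) w j =
    (\<Sum>u | map (apsnd s) u = w \<and> snd ` set u \<subseteq> N. word_val h y u j)"
proof (induction w)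
  case Nil
  have *: "{u. map (apsnd s) u = [] \<and> snd ` set u \<subseteq> N} = {[]}" by auto
  then show ?case by (simp only: *) simp
next
  case (Cons x w)
  let ?L = "\<lambda>w. {u. map (apsnd s) u = w \<and> snd ` set u \<subseteq> N}"
  let ?P = "{p \<in> N. s p = snd x}"
  have L: "?L (x # w) = (\<lambda>(p, u). (fst x, p) # u) ` (?P \<times> ?L w)"
    by (cases x) (force simp: map_eq_Cons_conv image_iff apsnd_def map_prod_def split: prod.splits)
  have inj: "inj_on (\<lambda>(p, u). (fst x, p) # u) (?P \<times> ?L w)" by (auto simp: inj_on_def)
  have "(\<Sum>u\<in>?L (x # w). word_val h y u j) =
      (\<Sum>(p, u)\<in>?P \<times> ?L w. h (fst x) * y p * word_val h y u j)"
    unfolding L sum.reindex[OF inj] by (intro sum.cong) auto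
  also have "\<dots> = (\<Sum>p\<in>?P. \<Sum>u\<in>?L w. h (fst x) * y p * word_val h y u j)"
    by (rule sum.cartesian_product[symmetric])
  also have "\<dots> = h (fst x) * (\<Sum>p\<in>?P. y p) * (\<Sum>u\<in>?L w. word_val h y u j)"
    by (simp add: sum_distrib_left sum_distrib_right sum.swap[of _ ?P])
  finally show ?case using Cons by simp
qed

text \<open>Both cuts are at the first occurrence of the variable \<open>m\<close>.\<close>

lemma append_Cons_unique:
  assumes "u @ (i, m) # v = u' @ (i', m) # v'" "m \<notin> snd ` set u" "m \<notin> snd ` set u'"
  shows "u = u' \<and> i = i' \<and> v = v'"
  using assms
proof (induction u arbitrary: u')
  case Nil
  then show ?case by (cases u') auto
next
  case (Cons x u)
  then show ?case by (cases u') force+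
qed

section \<open>Independent values of multilinear words\<close>

context corner
begin

definition K_independent :: "('i \<Rightarrow> 'q) \<Rightarrow> 'i set \<Rightarrow> bool" where
  "K_independent f S \<longleftrightarrow>
     (\<forall>c. (\<forall>i. c i \<in> K) \<longrightarrow> (\<Sum>i\<in>S. c i * f i) = 0 \<longrightarrow> (\<forall>i\<in>S. c i = 0))"

lemma K_independentD:
  "K_independent f S \<Longrightarrow> (\<And>i. c i \<in> K) \<Longrightarrow> (\<Sum>i\<in>S. c i * f i) = 0 \<Longrightarrow> i \<in> S \<Longrightarrow> c i = 0"
  by (auto simp: K_independent_def)

lemma K_span_image:
  assumes "finite S" "x \<in> K_span (f ` S)"
  shows "\<exists>c. (\<forall>i. c i \<in> K) \<and> x = (\<Sum>i\<in>S. c i * f i)"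
  using assms
proof (induction S arbitrary: x rule: finite_induct)
  case empty
  then show ?case using K_closed(1) by (auto simp: K_span_def)
next
  case (insert a S)
  obtain k where k: "k \<in> K" "x - k * f a \<in> K_span (f ` S)"
  proof (cases "f a \<in> f ` S")
    case True
    then have "x \<in> K_span (f ` S)" using insert.prems by (simp add: insert_absorb)
    then show thesis using that[of 0] K_closed(1) by simp
  next
    case False
    then show thesis using K_span_insert[of "f ` S" "f a" x] insert.hyps(1) insert.prems that by auto
  qed
  obtain c where c: "\<forall>i. c i \<in> K" "x - k * f a = (\<Sum>i\<in>S. c i * f i)"
    using insert.IH[OF k(2)] by blast
  have "(\<Sum>i\<in>S. c i * f i) = (\<Sum>i\<in>S. (c(a := k)) i * f i)"
    using insert.hyps by (intro sum.cong) auto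
  then have "x = (\<Sum>i\<in>insert a S. (c(a := k)) i * f i)"
    using c(2) insert.hyps by (simp add: algebra_simps)
  then show ?case using c(1) k(1) by (intro exI[of _ "c(a := k)"]) auto
qed

lemma exists_basis:
  assumes "finite S" "S \<subseteq> V"
  shows "\<exists>B\<subseteq>S. K_independent (\<lambda>x. x) B \<and> S \<subseteq> K_span B"
  using assms
proof (induction S rule: finite_induct)
  case empty
  then show ?case by (auto simp: K_independent_def)
next
  case (insert x S)
  then obtain B where B: "B \<subseteq> S" "K_independent (\<lambda>x. x) B" "S \<subseteq> K_span B" by auto
  have fB: "finite B" using B(1) insert.hyps(1) finite_subset by blast
  show ?case
  proof (cases "x \<in> K_span B")
    case True
    then show ?thesis using B by blast
  next
    case False
    have xB: "x \<notin> B" using B(1) insert.hyps(2) by blast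
    have "K_independent (\<lambda>x. x) (insert x B)" unfolding K_independent_def
    proof (intro allI impI)
      fix c assume c: "\<forall>i. c i \<in> K" "(\<Sum>i\<in>insert x B. c i * i) = 0"
      have eq: "c x * x + (\<Sum>i\<in>B. c i * i) = 0" using c(2) xB fB by simp
      have "c x = 0"
      proof (rule ccontr)
        assume "c x \<noteq> 0"
        then obtain d where d: "d \<in> K" "d * c x = e" using K_inverse c(1) by blast
        have "d * (c x * x + (\<Sum>i\<in>B. c i * i)) = 0" using eq by simp
        then have "x = - (d * (\<Sum>i\<in>B. c i * i))"
          using d(2) V_D(1)[of x] insert.prems
          by (simp add: distrib_left eq_neg_iff_add_eq_0 flip: mult.assoc)
        also have "\<dots> \<in> K_span B" using c(1) d(1) by (intro K_span_uminus K_span_scale K_spanI) auto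
        finally show False using False by simp
      qed
      moreover have "\<forall>i\<in>B. c i = 0"
        using B(2) c(1) eq \<open>c x = 0\<close> by (auto simp: K_independent_def)
      ultimately show "\<forall>i\<in>insert x B. c i = 0" by simp
    qed
    moreover have "K_span B \<subseteq> K_span (insert x B)" using fB by (intro K_span_mono) auto
    moreover have "x \<in> K_span (insert x B)" using fB insert.prems by (intro K_span_base) auto
    ultimately show ?thesis using B by (intro exI[of _ "insert x B"]) auto
  qed
qed

lemma finite_rank_add: "finite_rank T \<Longrightarrow> finite_rank T' \<Longrightarrow> finite_rank (\<lambda>x. T x + T' x)"
proof -
  assume "finite_rank T" "finite_rank T'"
  then obtain W W' where W: "finite W" "W \<subseteq> V" "T ` A \<subseteq> K_span W"
    "finite W'" "W' \<subseteq> V" "T' ` A \<subseteq> K_span W'" by (auto simp: finite_rank_def)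
  have "K_span W \<subseteq> K_span (W \<union> W')" "K_span W' \<subseteq> K_span (W \<union> W')"
    using W by (simp_all add: K_span_mono)
  then have "(\<lambda>x. T x + T' x) ` A \<subseteq> K_span (W \<union> W')" using W by (auto intro!: K_span_add)
  then show ?thesis using W unfolding finite_rank_def by (intro exI[of _ "W \<union> W'"]) auto
qed

lemma finite_rank_mult:
  assumes "finite_rank T" "t \<in> A"
  shows "finite_rank (\<lambda>x. r * T (t * x) * s)"
proof -
  obtain W where W: "finite W" "W \<subseteq> V" "T ` A \<subseteq> K_span W"
    using assms(1) by (auto simp: finite_rank_def)
  have "(\<lambda>x. r * T (t * x) * s) ` A \<subseteq> K_span ((\<lambda>w. r * w * s) ` W)"
    using W assms(2) by (auto intro!: K_span_mult mult_closed)
  then show ?thesis using W unfolding finite_rank_def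
    by (intro exI[of _ "(\<lambda>w. r * w * s) ` W"]) (auto simp: V_closed)
qed

lemma finite_rank_elem:
  assumes "finite_rank T" "set rs \<subseteq> A \<times> A"
  shows "finite_rank (\<lambda>x. \<Sum>(r, s)\<leftarrow>rs. r * T (s * x))"
  using assms(2)
proof (induction rs)
  case Nil
  have "\<exists>W. finite W \<and> W \<subseteq> V" by (rule exI[of _ "{}"]) simp
  then show ?case by (auto simp: finite_rank_def)
next
  case (Cons a rs)
  then show ?case using finite_rank_add[OF finite_rank_mult[OF assms(1), of "snd a" "fst a" 1]]
    by (auto simp: case_prod_unfold)
qed

definition words :: "'q set \<Rightarrow> nat \<Rightarrow> (('q \<times> nat) list \<times> 'q) set" where
  "words B m = {(u, j). fst ` set u \<subseteq> B \<and> j \<in> B \<and> snd ` set u \<subseteq> {..<m} \<and> distinct (map snd u)}"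

lemma finite_words:
  assumes "finite B"
  shows "finite (words B m)"
proof (rule finite_subset)
  show "words B m \<subseteq> {u. set u \<subseteq> B \<times> {..<m} \<and> distinct u} \<times> B"
    by (auto simp: words_def distinct_map)
  show "finite ({u. set u \<subseteq> B \<times> {..<m} \<and> distinct u} \<times> B)"
    using assms by (intro finite_cartesian_product finite_subset_distinct) auto
qed

text \<open>Induction on the number of variables. A word containing the new variable
  \<open>m\<close> is \<open>f p * x * f q\<close> with \<open>p\<close> and \<open>q\<close> old
  words, so \<open>x\<close> has to make these products independent modulo the span of the old
  values. Amitsur's lemma gives such an \<open>x\<close>, provided no nontrivial combination of the
  maps \<open>x \<mapsto> f p * x * f q\<close> has finite rank.\<close>

lemma independent_words:
  assumes B: "finite B" "B \<subseteq> V" "K_independent (\<lambda>x. x) B"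
    and norank: "\<And>a b. a \<in> V \<Longrightarrow> b \<in> V \<Longrightarrow> finite_rank (\<lambda>x. a * x * b) \<Longrightarrow> a = 0 \<or> b = 0"
  shows "\<exists>y. (\<forall>p. y p \<in> A) \<and> K_independent (\<lambda>(u, j). word_val (\<lambda>q. q) y u j) (words B m)"
proof (induction m)
  case 0
  have words: "words B 0 = Pair [] ` B" by (auto simp: words_def)
  have "K_independent (\<lambda>(u, j). word_val (\<lambda>q. q) (\<lambda>_. 0) u j) (words B 0)"
    unfolding K_independent_def
  proof (intro allI impI)
    fix c :: "('q \<times> nat) list \<times> 'q \<Rightarrow> 'q"
    assume c: "\<forall>i. c i \<in> K" "(\<Sum>i\<in>words B 0. c i * (case i of (u, j) \<Rightarrow> word_val (\<lambda>q. q) (\<lambda>_. 0) u j)) = 0"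
    have "(\<Sum>j\<in>B. c ([], j) * j) = 0"
      using c(2) by (simp add: words sum.reindex inj_on_def)
    then have "\<forall>j\<in>B. c ([], j) = 0"
      using K_independentD[OF B(3), of "\<lambda>j. c ([], j)"] c(1) by blast
    then show "\<forall>i\<in>words B 0. c i = 0" by (auto simp: words)
  qed
  then show ?case by (intro exI[of _ "\<lambda>_. 0"]) simp
next
  case (Suc m)
  then obtain y where y: "\<And>p. y p \<in> A"
    and indep: "K_independent (\<lambda>(u, j). word_val (\<lambda>q. q) y u j) (words B m)" by blast
  define S where "S = words B m"
  define f where "f = (\<lambda>(u, j). word_val (\<lambda>q. q) y u j)"
  have fS: "finite S" using finite_words[OF B(1)] by (simp add: S_def)
  have f_indep: "K_independent f S" using indep by (simp add: f_def S_def)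
  have word_V: "word_val (\<lambda>q. q) v u j \<in> V" if "j \<in> B" for v u j
    using that B(2) by (induction u) (auto simp: V_closed(6) word_val.simps)
  have fV: "f p \<in> V" if "p \<in> S" for p using that word_V by (auto simp: f_def S_def words_def)
  have "\<forall>i\<in>S \<times> S. c i = 0"
    if c: "\<And>i. c i \<in> K" "finite_rank (\<lambda>x. \<Sum>i\<in>S \<times> S. c i * (f (fst i) * x * f (snd i)))" for c
  proof (rule ccontr)
    assume "\<not> (\<forall>i\<in>S \<times> S. c i = 0)"
    then obtain p0 q0 where pq: "p0 \<in> S" "q0 \<in> S" "c (p0, q0) \<noteq> 0" by auto
    define g where "g p = (\<Sum>q\<in>S. c (p, q) * f q)" for p
    have gV: "g p \<in> V" for p using fV by (auto simp: g_def V_closed(6) intro!: V_sum)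
    have g0: "g p0 \<noteq> 0"
      using K_independentD[OF f_indep, of "\<lambda>q. c (p0, q)" q0] c(1) pq unfolding g_def by blast
    have T: "(\<Sum>i\<in>S \<times> S. c i * (f (fst i) * x * f (snd i))) = (\<Sum>p\<in>S. f p * x * g p)" for x
    proof -
      have "(\<Sum>i\<in>S \<times> S. c i * (f (fst i) * x * f (snd i))) =
          (\<Sum>p\<in>S. \<Sum>q\<in>S. c (p, q) * (f p * x * f q))"
        by (simp add: sum.cartesian_product case_prod_unfold)
      also have "\<dots> = (\<Sum>p\<in>S. f p * x * g p)"
        by (simp add: g_def sum_distrib_left mult.assoc K_left_commute[OF c(1)])
      finally show ?thesis .
    qed
    \<comment> \<open>After grouping by \<open>p\<close>, Martindale's operator for
      \<open>f p0\<close> removes every other term. What remains is a single map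
      \<open>x \<mapsto> a * x * b\<close> of finite rank with \<open>a\<close> and \<open>b\<close>
      nonzero.\<close>
    have "f p0 \<notin> K_span (f ` (S - {p0}))"
    proof
      assume "f p0 \<in> K_span (f ` (S - {p0}))"
      then obtain d where d: "\<forall>i. d i \<in> K" "f p0 = (\<Sum>i\<in>S - {p0}. d i * f i)"
        using K_span_image[of "S - {p0}"] fS by blast
      define d' where "d' = d(p0 := - e)"
      have "(\<Sum>i\<in>S. d' i * f i) = d' p0 * f p0 + (\<Sum>i\<in>S - {p0}. d' i * f i)"
        using fS pq(1) by (simp add: sum.remove)
      also have "(\<Sum>i\<in>S - {p0}. d' i * f i) = f p0"
        unfolding d(2) by (intro sum.cong) (auto simp: d'_def)
      finally have "(\<Sum>i\<in>S. d' i * f i) = 0" using V_D(1)[OF fV[OF pq(1)]] by (simp add: d'_def)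
      moreover have "d' i \<in> K" for i using d(1) K_closed(2,5) by (cases i) (simp add: d'_def)
      ultimately have "d' p0 = 0" using K_independentD[OF f_indep, of d' p0] pq(1) by blast
      then show False using e_nonzero by (simp add: d'_def)
    qed
    then obtain rs where rs: "set rs \<subseteq> A \<times> A" "elem rs (f p0) \<noteq> 0"
      "\<forall>w\<in>f ` (S - {p0}). elem rs w = 0"
      using martindale[of "f ` (S - {p0})" "f p0"] fS fV pq(1) by blast
    have "finite_rank (\<lambda>x. \<Sum>p\<in>S. f p * x * g p)" using c(2) by (simp only: T)
    from finite_rank_elem[OF this rs(1)]
    have "finite_rank (\<lambda>x. \<Sum>(r, s)\<leftarrow>rs. r * (\<Sum>p\<in>S. f p * (s * x) * g p))" .
    moreover have "(\<Sum>(r, s)\<leftarrow>rs. r * (\<Sum>p\<in>S. f p * (s * x) * g p)) = elem rs (f p0) * x * g p0" for x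
    proof -
      have "(\<Sum>(r, s)\<leftarrow>rs. r * (\<Sum>p\<in>S. f p * (s * x) * g p)) = (\<Sum>p\<in>S. elem rs (f p) * x * g p)" for rs
        by (induction rs) (auto simp: distrib_right sum.distrib sum_distrib_left mult.assoc)
      also have "(\<Sum>p\<in>S. elem rs (f p) * x * g p) = (\<Sum>p\<in>{p0}. elem rs (f p) * x * g p)"
        using fS pq(1) rs(3) by (intro sum.mono_neutral_right) auto
      finally show ?thesis by simp
    qed
    ultimately have "finite_rank (\<lambda>x. elem rs (f p0) * x * g p0)" by simp
    then show False using norank[OF elem_V[OF fV[OF pq(1)]] gV] rs(2) g0 by blast
  qed
  then have "\<exists>x\<in>A. \<forall>c. (\<forall>i. c i \<in> K) \<longrightarrow>
      (\<Sum>i\<in>S \<times> S. c i * (f (fst i) * x * f (snd i))) \<in> K_span (f ` S) \<longrightarrow> (\<forall>i\<in>S \<times> S. c i = 0)"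
    using fS fV by (intro amitsur) (auto simp: algebra_simps V_closed)
  then obtain x where x: "x \<in> A" "\<And>c i. (\<And>i. c i \<in> K) \<Longrightarrow>
      (\<Sum>i\<in>S \<times> S. c i * (f (fst i) * x * f (snd i))) \<in> K_span (f ` S) \<Longrightarrow> i \<in> S \<times> S \<Longrightarrow> c i = 0"
    by blast
  define y' where "y' = y(m := x)"
  define f' where "f' = (\<lambda>(u, j). word_val (\<lambda>q. q) y' u j)"
  define comb :: "_ \<Rightarrow> ('q \<times> nat) list \<times> 'q"
    where "comb = (\<lambda>((u, i), (v, j)). (u @ (i, m) # v, j))"
  have f'_S: "f' p = f p" if p: "p \<in> S" for p
  proof -
    obtain u j where "p = (u, j)" "snd ` set u \<subseteq> {..<m}" using p by (auto simp: S_def words_def)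
    then show ?thesis by (auto simp: f'_def f_def y'_def intro!: word_val_cong)
  qed
  have f'_comb: "f' (comb i) = f (fst i) * x * f (snd i)" if "i \<in> S \<times> S" for i
  proof -
    obtain u a v b where i: "i = ((u, a), (v, b))" by (metis surj_pair)
    then have "f' (comb i) = f' (u, a) * x * f' (v, b)"
      by (simp add: comb_def f'_def word_val_append y'_def)
    then show ?thesis using that i f'_S by simp
  qed
  have comb_inj: "inj_on comb (S \<times> S)"
  proof (rule inj_onI)
    fix i i' assume *: "i \<in> S \<times> S" "i' \<in> S \<times> S" "comb i = comb i'"
    obtain u a v b where i: "i = ((u, a), (v, b))" by (metis surj_pair)
    obtain u' a' v' b' where i': "i' = ((u', a'), (v', b'))" by (metis surj_pair)
    have "m \<notin> snd ` set u" "m \<notin> snd ` set u'" using * by (auto simp: i i' S_def words_def)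
    then show "i = i'" using append_Cons_unique[of u a m v u' a' v'] * by (simp add: i i' comb_def)
  qed
  have disj: "S \<inter> comb ` (S \<times> S) = {}" by (auto simp: S_def words_def comb_def)
  \<comment> \<open>Only an inclusion: two old words may share a variable, and then their
    combination is not multilinear. Such combinations get coefficient zero in \<open>c'\<close>
    below.\<close>
  have cover: "words B (Suc m) \<subseteq> S \<union> comb ` (S \<times> S)"
  proof
    fix p assume "p \<in> words B (Suc m)"
    then obtain w j where p: "p = (w, j)" "fst ` set w \<subseteq> B" "j \<in> B" "snd ` set w \<subseteq> {..<Suc m}"
      "distinct (map snd w)" by (auto simp: words_def)
    show "p \<in> S \<union> comb ` (S \<times> S)"
    proof (cases "m \<in> snd ` set w")
      case False
      then have "snd ` set w \<subseteq> {..<m}" using p(4) by (simp add: lessThan_Suc subset_insert)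
      then show ?thesis using p by (auto simp: S_def words_def)
    next
      case True
      then obtain i where "(i, m) \<in> set w" by auto
      then obtain u v where w: "w = u @ (i, m) # v" by (meson split_list)
      have m: "m \<notin> snd ` set u" "m \<notin> snd ` set v" using p(5) by (auto simp: w)
      moreover have "snd ` set u \<subseteq> {..<Suc m}" "snd ` set v \<subseteq> {..<Suc m}"
        using p(4) by (auto simp: w)
      ultimately have "snd ` set u \<subseteq> {..<m}" "snd ` set v \<subseteq> {..<m}"
        by (simp_all add: lessThan_Suc subset_insert)
      then have "((u, i), (v, j)) \<in> S \<times> S" using p by (auto simp: S_def words_def w)
      moreover have "p = comb ((u, i), (v, j))" by (simp add: comb_def p(1) w)
      ultimately show ?thesis by blast
    qed
  qed
  have "K_independent f' (words B (Suc m))" unfolding K_independent_def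
  proof (intro allI impI)
    fix c assume c: "\<forall>i. c i \<in> K" "(\<Sum>i\<in>words B (Suc m). c i * f' i) = 0"
    define c' where "c' i = (if i \<in> words B (Suc m) then c i else 0)" for i
    have c'K: "c' i \<in> K" for i using c(1) K_closed(1) by (cases i) (simp add: c'_def)
    have "(\<Sum>i\<in>words B (Suc m). c i * f' i) = (\<Sum>i\<in>S \<union> comb ` (S \<times> S). c' i * f' i)"
      using cover fS by (intro sum.mono_neutral_cong_left) (auto simp: c'_def)
    also have "\<dots> = (\<Sum>i\<in>S. c' i * f' i) + (\<Sum>i\<in>S \<times> S. c' (comb i) * f' (comb i))"
      using fS disj comb_inj by (simp add: sum.union_disjoint sum.reindex)
    also have "\<dots> = (\<Sum>i\<in>S. c' i * f i) + (\<Sum>i\<in>S \<times> S. c' (comb i) * (f (fst i) * x * f (snd i)))"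
      using f'_S f'_comb by simp
    finally have eq: "(\<Sum>i\<in>S. c' i * f i) + (\<Sum>i\<in>S \<times> S. c' (comb i) * (f (fst i) * x * f (snd i))) = 0"
      using c(2) by simp
    have "(\<Sum>i\<in>S. c' i * f i) \<in> K_span (f ` S)"
      using c'K fS fV by (intro K_span_sum K_span_scale K_span_base) auto
    then have "- (\<Sum>i\<in>S. c' i * f i) \<in> K_span (f ` S)" by (rule K_span_uminus)
    also have "- (\<Sum>i\<in>S. c' i * f i) = (\<Sum>i\<in>S \<times> S. c' (comb i) * (f (fst i) * x * f (snd i)))"
      using eq by (rule minus_unique)
    finally have mem: "(\<Sum>i\<in>S \<times> S. c' (comb i) * (f (fst i) * x * f (snd i))) \<in> K_span (f ` S)" .
    have z: "c' (comb i) = 0" if "i \<in> S \<times> S" for i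
      by (rule x(2)[of "\<lambda>i. c' (comb i)", OF c'K mem that])
    then have "(\<Sum>i\<in>S. c' i * f i) = 0" using eq by simp
    then have "c' i = 0" if "i \<in> S" for i
      using that by (rule K_independentD[OF f_indep c'K])
    then have "\<forall>i\<in>words B (Suc m). c' i = 0" using z cover by blast
    then show "\<forall>i\<in>words B (Suc m). c i = 0" by (simp add: c'_def)
  qed
  moreover have "\<forall>p. y' p \<in> A" using y x(1) by (simp add: y'_def)
  ultimately show ?case by (intro exI[of _ y']) (simp add: f'_def)
qed

end

lemma sum_list_group:
  fixes h :: "'k::comm_monoid_add \<Rightarrow> 'r::semiring_0"
  assumes h: "h 0 = 0" "\<And>x y. h (x + y) = h x + h y" and F: "finite F" "snd ` set L \<subseteq> F"
  shows "(\<Sum>(k, x)\<leftarrow>L. h k * W x) = (\<Sum>x\<in>F. h (\<Sum>(k, x')\<leftarrow>L. if x' = x then k else 0) * W x)"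
  using F(2)
proof (induction L)
  case Nil
  then show ?case by (simp add: h(1))
next
  case (Cons a L)
  obtain k x where a: "a = (k, x)" by fastforce
  have x: "x \<in> F" using Cons.prems a by simp
  have "(\<Sum>y\<in>F. h (if x = y then k else 0) * W y) = (\<Sum>y\<in>F. if x = y then h k * W y else 0)"
    by (intro sum.cong) (auto simp: h(1))
  also have "\<dots> = h k * W x" using F(1) x by simp
  finally show ?case using Cons by (simp add: a h(2) distrib_right sum.distrib)
qed

section \<open>From a generalized identity to a map of finite rank\<close>

context corner
begin

text \<open>After multiplication by \<open>e\<close>, the finitely many coefficients of the words
  are expanded in a basis \<open>B\<close> of their span and equal words are collected. The new
  coefficients cannot all vanish, since \<open>gp_coef e * f\<close> is nonzero.\<close>

lemma gpi_word_relation: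
  fixes f :: "'q gen_poly"
  assumes f: "gp_coef e * f \<noteq> 0"
    and vanish: "\<forall>\<phi> :: 'q gen_poly \<Rightarrow> 'q. is_ring_hom \<phi> \<and> \<phi> ` range gp_indet \<subseteq> A \<and>
      (\<forall>q. \<phi> (gp_coef q) = q) \<longrightarrow> \<phi> f = 0"
  obtains B F c where "finite B" "B \<subseteq> V" "K_independent (\<lambda>x. x) B" "finite F"
    "\<And>u j. (u, j) \<in> F \<Longrightarrow> fst ` set u \<subseteq> B \<and> j \<in> B" "\<And>i. c i \<in> K" "\<exists>i\<in>F. c i \<noteq> 0"
    "\<And>x. (\<And>p. x p \<in> A) \<Longrightarrow> (\<Sum>(u, j)\<in>F. c (u, j) * word_val (\<lambda>q. q) x u j) = 0"
proof -
  let ?M = "\<lambda>w j. word_val gp_coef gp_indet w j :: 'q gen_poly"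
  note hom = is_ring_homD[OF gp_coef_hom(1)]
  have e_comm: "x * gp_coef e = gp_coef e * x" for x :: "'q gen_poly"
    using gp_coef_central[OF e_central] by (simp add: ring_centre_def)
  have ee: "gp_coef e * gp_coef e = gp_coef e" by (simp add: e_idem flip: hom(2))
  have coef_comm: "gp_coef k * x = x * gp_coef k" if "k \<in> K" for k and x :: "'q gen_poly"
    using gp_coef_central[of k] that by (simp add: ring_centre_def K_def)
  obtain ws where ws: "f = (\<Sum>(w, j)\<leftarrow>ws. ?M w j)" using gen_poly_word_sum by blast
  let ?E = "\<lambda>w. map (apfst ((*) e)) w"
  have E: "gp_coef e * ?M w j = ?M (?E w) (e * j)" for w j
  proof (induction w)
    case Nil
    then show ?case by (simp add: hom)
  next
    case (Cons x w)
    have "gp_coef e * ?M (x # w) j = gp_coef e * gp_coef e * gp_coef (fst x) * gp_indet (snd x) * ?M w j"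
      by (simp only: ee word_val.simps mult.assoc)
    also have "\<dots> = gp_coef e * gp_coef (fst x) * gp_indet (snd x) * (gp_coef e * ?M w j)"
      by (simp add: mult.assoc) (metis e_comm mult.assoc)
    finally show ?case using Cons by (simp add: hom)
  qed
  define S where "S = (\<Union>(w, j)\<in>set ws. insert (e * j) (fst ` set (?E w)))"
  have "finite S" "S \<subseteq> V" by (auto simp: S_def V_closed)
  then obtain B where B: "B \<subseteq> S" "K_independent (\<lambda>x. x) B" "S \<subseteq> K_span B" using exists_basis by blast
  have fB: "finite B" "B \<subseteq> V" using B(1) \<open>finite S\<close> \<open>S \<subseteq> V\<close> finite_subset by blast+
  define ok where "ok = (\<lambda>(k, (w :: ('q \<times> nat) list), j). k \<in> K \<and> fst ` set w \<subseteq> B \<and> j \<in> B)"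
  define R where "R = {\<Sum>(k, w, j)\<leftarrow>L. gp_coef k * ?M w j | L. list_all ok L}"
  have R_add: "x + y \<in> R" if xy: "x \<in> R" "y \<in> R" for x y
  proof -
    obtain L where 1: "x = (\<Sum>(k, w, j)\<leftarrow>L. gp_coef k * ?M w j)" "list_all ok L"
      using xy(1) unfolding R_def by blast
    obtain L' where 2: "y = (\<Sum>(k, w, j)\<leftarrow>L'. gp_coef k * ?M w j)" "list_all ok L'"
      using xy(2) unfolding R_def by blast
    have "x + y = (\<Sum>(k, w, j)\<leftarrow>L @ L'. gp_coef k * ?M w j)" by (simp add: 1 2)
    moreover have "list_all ok (L @ L')" using 1 2 by simp
    ultimately show ?thesis unfolding R_def by blast
  qed
  have R0: "0 \<in> R" unfolding R_def by (rule CollectI, rule exI[of _ "[]"]) simp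
  have R_sum: "sum g T \<in> R" if "\<And>i. i \<in> T \<Longrightarrow> g i \<in> R" for g and T :: "'q set"
    using that by (induction T rule: infinite_finite_induct) (auto simp: R0 R_add)
  have R_list: "sum_list xs \<in> R" if "set xs \<subseteq> R" for xs
    using that by (induction xs) (auto simp: R0 R_add)
  have R_mon: "gp_coef k * ?M w j \<in> R" if "k \<in> K" "fst ` set w \<subseteq> B" "j \<in> B" for k w j
    unfolding R_def by (rule CollectI, rule exI[of _ "[(k, w, j)]"]) (use that in \<open>auto simp: ok_def\<close>)
  \<comment> \<open>Elements of \<open>K\<close> are central in the free product too, so the scalar
    of a word can be moved in front of a new letter.\<close>
  have R_prefix: "gp_coef k * gp_coef b * gp_indet i * x \<in> R" if xR: "x \<in> R" and "k \<in> K" "b \<in> B" for k b i x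
  proof -
    obtain L where L: "x = (\<Sum>(k, w, j)\<leftarrow>L. gp_coef k * ?M w j)" "list_all ok L"
      using xR unfolding R_def by blast
    have "gp_coef k * gp_coef b * gp_indet i * (gp_coef k' * ?M w j) =
        gp_coef (k * k') * ?M ((b, i) # w) j" if "k' \<in> K" for k' w j
    proof -
      have "gp_coef b * gp_indet i * (gp_coef k' * ?M w j) = gp_coef k' * (gp_coef b * gp_indet i * ?M w j)"
        using coef_comm[OF that, of "gp_coef b * gp_indet i"] by (simp add: mult.assoc[symmetric])
      then show ?thesis by (simp add: hom mult.assoc)
    qed
    then have mon: "gp_coef k * gp_coef b * gp_indet i * (gp_coef k' * ?M w j) \<in> R"
      if "ok (k', w, j)" for k' w j
      using R_mon[of "k * k'" "(b, i) # w" j] that \<open>k \<in> K\<close> \<open>b \<in> B\<close> by (auto simp: ok_def K_closed(6))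
    have "gp_coef k * gp_coef b * gp_indet i * x =
        (\<Sum>(k', w, j)\<leftarrow>L. gp_coef k * gp_coef b * gp_indet i * (gp_coef k' * ?M w j))"
      unfolding L(1) by (simp add: sum_list_const_mult[symmetric] case_prod_unfold)
    also have "\<dots> \<in> R" using L(2) by (intro R_list) (auto simp: list_all_iff intro!: mon)
    finally show ?thesis .
  qed
  have coef_sum: "gp_coef (\<Sum>b\<in>T. h b) = (\<Sum>b\<in>T. gp_coef (h b))" for h and T :: "'q set"
    by (induction T rule: infinite_finite_induct) (auto simp: hom)
  have R_span: "?M w j \<in> R" if "fst ` set w \<subseteq> K_span B" "j \<in> K_span B" for w j
    using that
  proof (induction w)
    case Nil
    obtain c where c: "\<And>w. c w \<in> K" "j = (\<Sum>b\<in>B. c b * b)" using Nil(2) by (elim K_spanE) blast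
    have "?M [] j = (\<Sum>b\<in>B. gp_coef (c b) * ?M [] b)" by (simp add: c(2) coef_sum hom)
    also have "\<dots> \<in> R" using c(1) by (intro R_sum R_mon) auto
    finally show ?case .
  next
    case (Cons x w)
    obtain c where c: "\<And>w. c w \<in> K" "fst x = (\<Sum>b\<in>B. c b * b)" using Cons.prems by (auto elim!: K_spanE)
    have "?M (x # w) j = (\<Sum>b\<in>B. gp_coef (c b) * gp_coef b * gp_indet (snd x) * ?M w j)"
      by (simp add: c(2) coef_sum hom sum_distrib_right)
    also have "\<dots> \<in> R" using c(1) Cons by (intro R_sum R_prefix) auto
    finally show ?case .
  qed
  have "gp_coef e * f = (\<Sum>(w, j)\<leftarrow>ws. ?M (?E w) (e * j))"
    unfolding ws by (simp add: sum_list_const_mult[symmetric] case_prod_unfold E)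
  also have "\<dots> \<in> R"
  proof (intro R_list subsetI)
    fix z assume "z \<in> set (map (\<lambda>(w, j). ?M (?E w) (e * j)) ws)"
    then obtain w j where wj: "(w, j) \<in> set ws" "z = ?M (?E w) (e * j)" by auto
    then have "fst ` set (?E w) \<subseteq> S" "e * j \<in> S" unfolding S_def by (auto intro!: bexI[OF _ wj(1)])
    then show "z \<in> R" unfolding wj(2) using B(3) by (intro R_span) auto
  qed
  finally obtain L where L: "gp_coef e * f = (\<Sum>(k, w, j)\<leftarrow>L. gp_coef k * ?M w j)" "list_all ok L"
    unfolding R_def by blast
  define F where "F = snd ` set L"
  define c where "c x = (\<Sum>(k, x')\<leftarrow>L. if x' = x then k else 0)" for x
  have F: "finite F" by (simp add: F_def)
  have cK: "c x \<in> K" for x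
  proof -
    have "list_all ok L \<Longrightarrow> (\<Sum>(k, x')\<leftarrow>L. if x' = x then k else 0) \<in> K" for L
      by (induction L) (auto simp: K_closed(1,3) ok_def)
    then show ?thesis using L(2) by (simp add: c_def)
  qed
  have group: "(\<Sum>(k, w, j)\<leftarrow>L. h k * W (w, j)) = (\<Sum>x\<in>F. h (c x) * W x)"
    if "h 0 = 0" "\<And>x y. h (x + y) = h x + h y" for h :: "'q \<Rightarrow> 'r::ring" and W
    using sum_list_group[of h F L W, OF that F] by (simp add: F_def c_def case_prod_unfold)
  have ef: "gp_coef e * f = (\<Sum>(w, j)\<in>F. gp_coef (c (w, j)) * ?M w j)"
    using group[of gp_coef "\<lambda>(w, j). ?M w j", OF hom(3) hom(1)] by (simp add: L(1) case_prod_unfold)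
  have "\<exists>i\<in>F. c i \<noteq> 0"
  proof (rule ccontr)
    assume "\<not> ?thesis"
    then have "gp_coef e * f = 0" unfolding ef by (intro sum.neutral) (auto simp: hom)
    then show False using f by simp
  qed
  moreover have "(\<Sum>(u, j)\<in>F. c (u, j) * word_val (\<lambda>q. q) x u j) = 0" if x: "\<And>p. x p \<in> A" for x
  proof -
    \<comment> \<open>The universal property turns the assignment \<open>x\<close> into a
      substitution that is the identity on coefficients.\<close>
    have "\<exists>!\<phi>. is_ring_hom \<phi> \<and> (\<forall>q. \<phi> (gp_coef q) = q) \<and> (\<forall>i. \<phi> (gp_indet i) = x i)"
      by (rule gen_poly_universal) (auto simp: is_ring_hom_def)
    then obtain \<phi> where \<phi>: "is_ring_hom \<phi>" "\<And>q. \<phi> (gp_coef q) = q" "\<And>i. \<phi> (gp_indet i) = x i"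
      by blast
    then have "\<phi> ` range gp_indet \<subseteq> A" using x by auto
    then have "\<phi> f = 0" using vanish \<phi> by blast
    then have "0 = \<phi> (gp_coef e * f)" using is_ring_homD(2)[OF \<phi>(1)] by simp
    also have "\<dots> = (\<Sum>(w, j)\<in>F. \<phi> (gp_coef (c (w, j)) * ?M w j))"
      unfolding ef using F by (induction F rule: finite_induct) (auto simp: is_ring_homD[OF \<phi>(1)])
    also have "\<dots> = (\<Sum>(w, j)\<in>F. c (w, j) * word_val (\<lambda>q. q) x w j)"
      by (simp add: is_ring_homD[OF \<phi>(1)] word_val_hom[OF \<phi>(1)] comp_def \<phi>(2,3))
    finally show ?thesis by simp
  qed
  moreover have "fst ` set u \<subseteq> B \<and> j \<in> B" if "(u, j) \<in> F" for u j
    using that L(2) by (fastforce simp: F_def list_all_iff ok_def)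
  ultimately show thesis using that[of B F c] fB B(2) F cK by blast
qed

text \<open>A longest word \<open>w0\<close> survives polarisation. No word is longer than
  \<open>m\<close>, so the words using all \<open>m\<close> new variables are multilinear and take
  independent values at a suitable point; a lift of \<open>w0\<close> is among them, with the
  coefficient of \<open>w0\<close>.\<close>

theorem gpi_finite_rank:
  fixes f :: "'q gen_poly"
  assumes f: "gp_coef e * f \<noteq> 0"
    and vanish: "\<forall>\<phi> :: 'q gen_poly \<Rightarrow> 'q. is_ring_hom \<phi> \<and> \<phi> ` range gp_indet \<subseteq> A \<and>
      (\<forall>q. \<phi> (gp_coef q) = q) \<longrightarrow> \<phi> f = 0"
  shows "\<exists>a\<in>V. \<exists>b\<in>V. a \<noteq> 0 \<and> b \<noteq> 0 \<and> finite_rank (\<lambda>x. a * x * b)"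
proof (rule ccontr)
  assume "\<not> ?thesis"
  then have norank: "a = 0 \<or> b = 0" if "a \<in> V" "b \<in> V" "finite_rank (\<lambda>x. a * x * b)" for a b
    using that by blast
  obtain B F c where B: "finite B" "B \<subseteq> V" "K_independent (\<lambda>x. x) B" and F: "finite F"
    "\<And>u j. (u, j) \<in> F \<Longrightarrow> fst ` set u \<subseteq> B \<and> j \<in> B" and c: "\<And>i. c i \<in> K" "\<exists>i\<in>F. c i \<noteq> 0"
    and zero: "\<And>x. (\<And>p. x p \<in> A) \<Longrightarrow> (\<Sum>(u, j)\<in>F. c (u, j) * word_val (\<lambda>q. q) x u j) = 0"
    using gpi_word_relation[OF f vanish] by blast
  define F' where "F' = {i\<in>F. c i \<noteq> 0}"
  have F': "finite F'" "F' \<noteq> {}" using F(1) c(2) by (auto simp: F'_def)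
  define m where "m = Max ((\<lambda>i. length (fst i)) ` F')"
  have "m \<in> (\<lambda>i. length (fst i)) ` F'" unfolding m_def using F' by (intro Max_in) auto
  then obtain w0 j0 where w0: "(w0, j0) \<in> F'" "length w0 = m" by auto
  have len: "length u \<le> m" if "(u, j) \<in> F'" for u j
    using that F' unfolding m_def by (intro Max_ge) (auto intro!: image_eqI[of _ _ "(u, j)"])
  obtain y where y: "\<And>p. y p \<in> A"
    and indep: "K_independent (\<lambda>(u, j). word_val (\<lambda>q. q) y u j) (words B m)"
    using independent_words[OF B norank] by blast
  let ?w = "\<lambda>(u, j). word_val (\<lambda>q. q) y u j"
  \<comment> \<open>The new variables are the positions in \<open>w0\<close>, and \<open>s\<close>
    recalls the old variable standing at a position.\<close>
  define s where "s p = snd (w0 ! p)" for p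
  let ?lift = "\<lambda>(u, j). (map (apsnd s) u, j)"
  define G where "G = {(u, j). ?lift (u, j) \<in> F' \<and> snd ` set u \<subseteq> {..<m}}"
  let ?supp = "\<lambda>(u, j). snd ` set u"
  have finG: "finite G"
  proof (rule finite_subset)
    let ?X = "(\<Union>(u, j)\<in>F'. fst ` set u)" and ?J = "snd ` F'"
    show "G \<subseteq> {u. set u \<subseteq> ?X \<times> {..<m} \<and> length u \<le> m} \<times> ?J"
    proof
      fix i assume "i \<in> G"
      then obtain u j where i: "i = (u, j)" "(map (apsnd s) u, j) \<in> F'" "snd ` set u \<subseteq> {..<m}"
        by (auto simp: G_def)
      have "set u \<subseteq> ?X \<times> {..<m}"
      proof
        fix p assume p: "p \<in> set u"
        have "fst p \<in> fst ` set (map (apsnd s) u)" using p by (simp add: image_image)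
        then have "fst p \<in> ?X" by (intro UN_I[OF i(2)]) (simp only: prod.case)
        then show "p \<in> ?X \<times> {..<m}" using i(3) p by (cases p) auto
      qed
      moreover have "length u \<le> m" using len[OF i(2)] by simp
      ultimately show "i \<in> {u. set u \<subseteq> ?X \<times> {..<m} \<and> length u \<le> m} \<times> ?J"
        using i(2) by (force simp: i(1))
    qed
    show "finite ({u. set u \<subseteq> ?X \<times> {..<m} \<and> length u \<le> m} \<times> ?J)"
      using F'(1) by (intro finite_cartesian_product finite_lists_length_le) auto
  qed
  txt \<open>Substituting \<open>\<Sum>p\<in>S. y p\<close> over the positions \<open>p\<close> of a variable in the word \<open>w0\<close> polarises
    the identity; its multilinear part is indexed by the words whose support is all of \<open>{..<m}\<close>.\<close>
  have polar: "(\<Sum>i | i \<in> G \<and> ?supp i \<subseteq> S. c (?lift i) * ?w i) = 0" if S: "S \<subseteq> {..<m}" for S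
  proof -
    have finS: "finite S" using S finite_subset by blast
    let ?x = "\<lambda>i. \<Sum>p | p \<in> S \<and> s p = i. y p"
    have "(\<Sum>i | i \<in> G \<and> ?supp i \<subseteq> S. c (?lift i) * ?w i) =
        (\<Sum>k\<in>F'. \<Sum>i | i \<in> {i \<in> G. ?supp i \<subseteq> S} \<and> ?lift i = k. c (?lift i) * ?w i)"
      using finG F'(1) by (intro sum.group[symmetric]) (auto simp: G_def)
    also have "\<dots> = (\<Sum>(w, j)\<in>F'. c (w, j) * word_val (\<lambda>q. q) ?x w j)"
    proof (intro sum.cong refl)
      fix k assume k: "k \<in> F'"
      obtain w j where kk: "k = (w, j)" by fastforce
      let ?U = "{u. map (apsnd s) u = w \<and> snd ` set u \<subseteq> S}"
      have set_eq: "{i \<in> {i \<in> G. ?supp i \<subseteq> S}. ?lift i = k} = (\<lambda>u. (u, j)) ` ?U"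
        using k S by (auto simp: G_def kk)
      have "(\<Sum>i | i \<in> {i \<in> G. ?supp i \<subseteq> S} \<and> ?lift i = k. c (?lift i) * ?w i) =
          (\<Sum>u\<in>?U. c (w, j) * word_val (\<lambda>q. q) y u j)"
        unfolding set_eq by (subst sum.reindex) (auto simp: inj_on_def intro!: sum.cong)
      then show "(\<Sum>i | i \<in> {i \<in> G. ?supp i \<subseteq> S} \<and> ?lift i = k. c (?lift i) * ?w i) =
          (case k of (w, j) \<Rightarrow> c (w, j) * word_val (\<lambda>q. q) ?x w j)"
        by (simp add: kk word_val_sum[OF finS] sum_distrib_left)
    qed
    also have "\<dots> = (\<Sum>(w, j)\<in>F. c (w, j) * word_val (\<lambda>q. q) ?x w j)"
      using F(1) by (intro sum.mono_neutral_left) (auto simp: F'_def)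
    also have "\<dots> = 0" using y by (intro zero sum_closed) auto
    finally show ?thesis .
  qed
  define H where "H = {i \<in> G. ?supp i = {..<m}}"
  have H_sum: "(\<Sum>i\<in>H. c (?lift i) * ?w i) = 0"
    unfolding H_def by (rule sum_eq_zero_of_supports[OF finG _ polar]) simp
  have H_words: "H \<subseteq> words B m"
  proof
    fix i assume i: "i \<in> H"
    obtain u j where ij: "i = (u, j)" by fastforce
    have u: "(map (apsnd s) u, j) \<in> F'" "snd ` set u = {..<m}" using i by (auto simp: ij H_def G_def)
    \<comment> \<open>At most \<open>m\<close> letters carry all \<open>m\<close> variables, so each
      variable occurs exactly once.\<close>
    have "length (map snd u) = card (set (map snd u))"
      using len[OF u(1)] u(2) card_length[of "map snd u"] by simp
    then have "distinct (map snd u)" using card_distinct[of "map snd u"] by simp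
    moreover have "fst ` set (map (apsnd s) u) \<subseteq> B \<and> j \<in> B"
      by (rule F(2)) (use u(1) in \<open>simp add: F'_def\<close>)
    moreover have "fst ` set (map (apsnd s) u) = fst ` set u" by (force simp: image_image)
    ultimately show "i \<in> words B m" using u(2) by (simp add: ij words_def)
  qed
  define c' where "c' i = (if i \<in> H then c (?lift i) else 0)" for i
  have "(\<Sum>i\<in>words B m. c' i * ?w i) = (\<Sum>i\<in>H. c (?lift i) * ?w i)"
    using H_words finite_words[OF B(1)] by (intro sum.mono_neutral_cong_right) (auto simp: c'_def)
  moreover have "c' i \<in> K" for i using c(1) K_closed(1) by (simp add: c'_def)
  ultimately have c'0: "c' i = 0" if "i \<in> words B m" for i
    using K_independentD[OF indep, of c' i] H_sum that by simp
  \<comment> \<open>The lift of \<open>w0\<close> in which the letter at position \<open>p\<close>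
    carries the variable \<open>p\<close>.\<close>
  define u0 where "u0 = zip (map fst w0) [0..<m]"
  have lift0: "map (apsnd s) u0 = w0"
    by (rule nth_equalityI) (auto simp: u0_def w0(2) s_def)
  have supp0: "snd ` set u0 = {..<m}"
  proof -
    have "map snd u0 = [0..<m]" using w0(2) by (simp add: u0_def)
    then have "snd ` set u0 = set [0..<m]" by (metis set_map)
    then show ?thesis by auto
  qed
  have "(u0, j0) \<in> H" using w0(1) by (simp add: H_def G_def lift0 supp0)
  then have "c (w0, j0) = 0" using c'0[of "(u0, j0)"] H_words by (auto simp: c'_def lift0)
  then show False using w0(1) by (simp add: F'_def)
qed

end

section \<open>Derivations of the ring of quotients\<close>

text \<open>Here \<open>F\<close> is the image of the scalar ring in the centre of \<open>Q\<close>,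
  so that integrality of the centre becomes an equation inside \<open>Q\<close>.\<close>

locale quotient_derivation = right_quotient_ring A for A :: "'q::{ring,monoid_mult} set" +
  fixes F :: "'q set" and \<delta> :: "'q \<Rightarrow> 'q"
  assumes \<delta>_add: "\<delta> (p + q) = \<delta> p + \<delta> q"
    and \<delta>_mult: "\<delta> (p * q) = \<delta> p * q + p * \<delta> q"
    and \<delta>_closed: "x \<in> A \<Longrightarrow> \<delta> x \<in> A"
    and scalar_add: "\<alpha> \<in> F \<Longrightarrow> \<beta> \<in> F \<Longrightarrow> \<alpha> + \<beta> \<in> F"
    and scalar_central: "\<alpha> \<in> F \<Longrightarrow> \<alpha> \<in> ring_centre"
    and \<delta>_scalar: "\<alpha> \<in> F \<Longrightarrow> \<delta> \<alpha> = 0"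
    and integral: "c \<in> ring_centre \<Longrightarrow>
      \<exists>n \<alpha>. (\<forall>i. \<alpha> i \<in> F) \<and> \<alpha> n = 1 \<and> (\<Sum>i\<le>n. \<alpha> i * c ^ i) = 0"
    and torsion_free: "(n::nat) > 0 \<Longrightarrow> x \<in> A \<Longrightarrow> (\<Sum>i<n. x) = 0 \<Longrightarrow> x = 0"
begin

lemma \<delta>_zero [simp]: "\<delta> 0 = 0"
  using \<delta>_add[of 0 0] by simp

lemma \<delta>_sum: "\<delta> (\<Sum>i\<in>S. f i) = (\<Sum>i\<in>S. \<delta> (f i))"
  by (induction S rule: infinite_finite_induct) (auto simp: \<delta>_add)

lemma \<delta>_central: "c \<in> ring_centre \<Longrightarrow> \<delta> c \<in> ring_centre"
proof -
  assume c: "c \<in> ring_centre"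
  have "\<delta> c * q = q * \<delta> c" for q
  proof -
    have "\<delta> (c * q) = \<delta> (q * c)" using c by (simp add: ring_centre_def)
    moreover have "c * \<delta> q = \<delta> q * c" using c by (simp add: ring_centre_def)
    ultimately show ?thesis by (simp add: \<delta>_mult)
  qed
  then show ?thesis by (simp add: ring_centre_def)
qed

lemma torsion_free_quotient:
  assumes "(n::nat) > 0" "(\<Sum>i<n. q) = (0 :: 'q)"
  shows "q = 0"
proof (rule eq_zeroI[of q])
  fix r assume "r \<in> A" "q * r \<in> A"
  then show "q * r = 0"
    using torsion_free[OF assms(1), of "q * r"] assms(2) by (simp only: mult_zero_left flip: sum_distrib_right)
qed

text \<open>The integer factor of the power rule is written as a sum of equal terms, the form in
  which torsion-freeness is stated.\<close>

lemma \<delta>_power: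
  assumes c: "c \<in> ring_centre"
  shows "\<delta> (c ^ Suc n) = (\<Sum>k<Suc n. c ^ n * \<delta> c)"
proof (induction n)
  case 0
  then show ?case by simp
next
  case (Suc n)
  have comm: "\<delta> c * q = q * \<delta> c" for q using \<delta>_central[OF c] by (simp add: ring_centre_def)
  have "\<delta> (c ^ Suc (Suc n)) = \<delta> c * c ^ Suc n + c * (\<Sum>k<Suc n. c ^ n * \<delta> c)"
    by (simp only: power_Suc[of c "Suc n"] \<delta>_mult Suc)
  also have "\<delta> c * c ^ Suc n = c ^ Suc n * \<delta> c" by (rule comm)
  also have "c * (\<Sum>k<Suc n. c ^ n * \<delta> c) = (\<Sum>k<Suc n. c ^ Suc n * \<delta> c)"
    by (simp only: sum_distrib_left mult.assoc power_Suc)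
  finally show ?case by (simp add: add.commute)
qed

lemma \<delta>_idempotent:
  assumes "e \<in> ring_centre" "e * e = e"
  shows "\<delta> e = 0"
proof -
  have "\<delta> e * e = e * \<delta> e" using assms(1) by (simp add: ring_centre_def)
  then have eq: "\<delta> e = e * \<delta> e + e * \<delta> e" using \<delta>_mult[of e e] assms(2) by simp
  have "e * \<delta> e = e * \<delta> e + e * \<delta> e"
    using arg_cong[OF eq, of "(*) e"] assms(2) by (simp add: distrib_left flip: mult.assoc)
  then show ?thesis using eq by simp
qed

end

section \<open>The derivation on a corner and dual operators\<close>

locale corner_derivation = corner A e + quotient_derivation A F \<delta>
  for A :: "'q::{ring,monoid_mult} set" and e F \<delta>
begin

lemma \<delta>_e: "\<delta> e = 0"
  using \<delta>_idempotent[OF e_central e_idem] .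

lemma \<delta>_V: "q \<in> V \<Longrightarrow> \<delta> q \<in> V"
  using \<delta>_mult[of e q] \<delta>_e by (simp add: V_def)

text \<open>A relation of least degree with invertible leading coefficient satisfied by \<open>c\<close> is separable
  in characteristic zero, so differentiating it gives \<open>\<delta> c = 0\<close>.\<close>

lemma \<delta>_K:
  assumes c: "c \<in> K"
  shows "\<delta> c = 0"
proof (rule ccontr)
  assume nz: "\<delta> c \<noteq> 0"
  have cc: "c \<in> ring_centre" using c by (simp add: K_def)
  have "\<delta> c \<in> K" using \<delta>_central[OF cc] \<delta>_V[OF K_V[OF c]] by (simp add: K_def V_def)
  then obtain d where d: "d \<in> K" "d * \<delta> c = e" using K_inverse nz by blast
  then have d': "\<delta> c * d = e" using K_commute[of d "\<delta> c"] by simp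
  define P where "P n \<longleftrightarrow> (\<exists>\<alpha>. (\<forall>i. \<alpha> i \<in> F) \<and> e * \<alpha> n \<noteq> 0 \<and> (\<Sum>i\<le>n. e * (\<alpha> i * c ^ i)) = 0)" for n
  have "\<exists>n. P n"
  proof -
    obtain n \<alpha> where \<alpha>: "\<forall>i. \<alpha> i \<in> F" "\<alpha> n = 1" "(\<Sum>i\<le>n. \<alpha> i * c ^ i) = 0"
      using integral[OF cc] by blast
    have "(\<Sum>i\<le>n. e * (\<alpha> i * c ^ i)) = 0" using \<alpha>(3) by (simp flip: sum_distrib_left)
    then have "P n" unfolding P_def using \<alpha> e_nonzero by (intro exI[of _ \<alpha>]) simp
    then show ?thesis ..
  qed
  then have P: "P (LEAST n. P n)" by (rule LeastI_ex)
  show False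
  proof (cases "LEAST n. P n")
    case 0
    then show False using P by (auto simp: P_def)
  next
    case (Suc m)
    then obtain \<alpha> where \<alpha>: "\<And>i. \<alpha> i \<in> F" "e * \<alpha> (Suc m) \<noteq> 0" "(\<Sum>i\<le>Suc m. e * (\<alpha> i * c ^ i)) = 0"
      using P by (auto simp: P_def)
    \<comment> \<open>The coefficients of the formal derivative: \<open>Suc i\<close> copies of
      \<open>\<alpha> (Suc i)\<close>. Differentiating the relation gives this polynomial in
      \<open>c\<close> times \<open>\<delta> c\<close>, and \<open>\<delta> c\<close> can be
      cancelled with its inverse \<open>d\<close>.\<close>
    define \<beta> where "\<beta> i = (\<Sum>k<Suc i. \<alpha> (Suc i))" for i
    have \<delta>\<alpha>: "\<delta> (e * (\<alpha> i * q)) = e * (\<alpha> i * \<delta> q)" for i q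
      by (simp add: \<delta>_mult \<delta>_e \<delta>_scalar \<alpha>(1))
    have "\<delta> (e * \<alpha> 0) = 0" by (simp add: \<delta>_mult \<delta>_e \<delta>_scalar \<alpha>(1))
    then have "0 = (\<Sum>i\<le>m. \<delta> (e * (\<alpha> (Suc i) * c ^ Suc i)))"
      using arg_cong[OF \<alpha>(3), of \<delta>] by (simp add: \<delta>_sum \<delta>_add sum.atMost_Suc_shift \<delta>\<alpha> del: sum.atMost_Suc power_Suc)
    also have "\<dots> = (\<Sum>i\<le>m. e * (\<beta> i * c ^ i)) * \<delta> c"
      unfolding \<delta>\<alpha> \<delta>_power[OF cc] \<beta>_def
      by (simp only: sum_distrib_left sum_distrib_right mult.assoc)
    finally have "(\<Sum>i\<le>m. e * (\<beta> i * c ^ i)) * \<delta> c * d = 0" by simp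
    then have "(\<Sum>i\<le>m. e * (\<beta> i * c ^ i)) * e = 0" by (simp add: mult.assoc d')
    moreover have "(\<Sum>i\<le>m. e * (\<beta> i * c ^ i)) \<in> V" by (intro V_sum V_closed(7))
    ultimately have "(\<Sum>i\<le>m. e * (\<beta> i * c ^ i)) = 0" using V_D(2) by simp
    moreover have "e * \<beta> m \<noteq> 0"
    proof
      assume "e * \<beta> m = 0"
      then have "(\<Sum>k<Suc m. e * \<alpha> (Suc m)) = 0" by (simp only: \<beta>_def sum_distrib_left)
      then show False using torsion_free_quotient[of "Suc m"] \<alpha>(2) by blast
    qed
    moreover have "\<beta> i \<in> F" for i
    proof -
      have "(\<Sum>k<Suc n. x) \<in> F" if "x \<in> F" for n x
        by (induction n) (use that scalar_add in auto)
      then show ?thesis using \<alpha>(1) by (simp only: \<beta>_def)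
    qed
    ultimately have "P m" unfolding P_def by blast
    then have "(LEAST n. P n) \<le> m" by (rule Least_le)
    then show False using Suc by simp
  qed
qed

lemma \<delta>_K_sum:
  assumes "\<And>w. c w \<in> K"
  shows "\<delta> (\<Sum>w\<in>W. c w * w) = (\<Sum>w\<in>W. c w * \<delta> w)"
  using assms by (simp add: \<delta>_sum \<delta>_mult \<delta>_K)

lemma K_independent_notin_span:
  assumes B: "finite B" "B \<subseteq> V" "K_independent (\<lambda>x. x) B" and w: "w \<in> B"
  shows "w \<notin> K_span (B - {w})"
proof
  assume "w \<in> K_span (B - {w})"
  then obtain d where d: "\<And>i. d i \<in> K" "w = (\<Sum>i\<in>B - {w}. d i * i)" by (elim K_spanE) blast
  have "(\<Sum>i\<in>B. (d(w := - e)) i * i) = - e * w + (\<Sum>i\<in>B - {w}. (d(w := - e)) i * i)"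
    using B(1) w by (simp add: sum.remove)
  also have "(\<Sum>i\<in>B - {w}. (d(w := - e)) i * i) = (\<Sum>i\<in>B - {w}. d i * i)"
    by (intro sum.cong) auto
  finally have "(\<Sum>i\<in>B. (d(w := - e)) i * i) = 0" using d(2) V_D(1)[of w] B(2) w by auto
  moreover have "(d(w := - e)) i \<in> K" for i using d(1) K_closed(2,5) by simp
  ultimately have "(d(w := - e)) w = 0" using K_independentD[OF B(3)] w by blast
  then show False using e_nonzero by simp
qed

text \<open>Operators dual to \<open>B\<close> up to a common factor \<open>z\<close>. Martindale's
  lemma gives one operator for each basis element, but with unrelated values. To make the old value
  \<open>z\<close> and the new value \<open>elem rs v\<close> agree, primeness supplies
  \<open>t\<close> with \<open>z * t * elem rs v\<close> nonzero; the old operators are multiplied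
  on the right by \<open>t * elem rs v\<close> and the new one on the left by
  \<open>z * t\<close>.\<close>

lemma dual_basis:
  assumes B: "finite B" "B \<subseteq> V" "K_independent (\<lambda>x. x) B"
  shows "\<exists>z\<in>V. z \<noteq> 0 \<and> (\<exists>E. \<forall>w\<in>B. \<forall>w'\<in>B. elem (E w) w' = (if w = w' then z else 0))"
proof -
  have "\<exists>z\<in>V. z \<noteq> 0 \<and> (\<exists>E. \<forall>w\<in>T. \<forall>w'\<in>B. elem (E w) w' = (if w = w' then z else 0))"
    if "finite T" "T \<subseteq> B" for T
    using that
  proof (induction T rule: finite_induct)
    case empty
    then show ?case using e_nonzero K_V[OF K_closed(2)] by auto
  next
    case (insert v T)
    then obtain z where z: "z \<in> V" "z \<noteq> 0"
      and "\<exists>E. \<forall>w\<in>T. \<forall>w'\<in>B. elem (E w) w' = (if w = w' then z else 0)" by auto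
    then obtain E where E: "\<And>w w'. w \<in> T \<Longrightarrow> w' \<in> B \<Longrightarrow> elem (E w) w' = (if w = w' then z else 0)"
      by blast
    have v: "v \<in> B" using insert.prems by simp
    obtain rs where rs: "elem rs v \<noteq> 0" "\<And>w. w \<in> B - {v} \<Longrightarrow> elem rs w = 0"
      using martindale[of "B - {v}" v] K_independent_notin_span[OF B v] B(1,2) v by blast
    have "elem rs v \<in> V" using B(2) v by (intro elem_V) auto
    from primeE[OF z(1) this z(2) rs(1)] obtain t where t: "z * t * elem rs v \<noteq> 0" by blast
    define y u where "y = z * t" and "u = t * elem rs v"
    then have yu: "y * elem rs v = z * u" by (simp add: mult.assoc)
    define E' where "E' w = (if w = v then map (\<lambda>(r, s). (y * r, s)) rs
      else map (\<lambda>(r, s). (r, s * u)) (E w))" for w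
    have "elem (E' w) w' = (if w = w' then z * u else 0)" if "w \<in> insert v T" "w' \<in> B" for w w'
      using that rs(2)[of w'] E[of w w'] insert.hyps(2)
      by (auto simp: E'_def elem_left elem_right yu)
    moreover have "z * u \<noteq> 0" using t by (simp add: u_def mult.assoc)
    moreover have "z * u \<in> V" using z(1) by (simp add: V_closed)
    ultimately show ?case by blast
  qed
  from this[OF B(1) subset_refl] show ?thesis .
qed

section \<open>Elementary operators and the differential identity\<close>

definition elementary :: "('q \<Rightarrow> 'q) \<Rightarrow> bool" where
  "elementary T \<longleftrightarrow> (\<exists>rs. \<forall>x\<in>A. T x = elem rs x)"

lemma elementary_single: "elementary (\<lambda>x. r * x * s)"
  unfolding elementary_def by (rule exI[of _ "[(r, s)]"]) simp

lemma elementary_add: "elementary T \<Longrightarrow> elementary T' \<Longrightarrow> elementary (\<lambda>x. T x + T' x)"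
  unfolding elementary_def by (metis elem_simps(3))

lemma elementary_diff:
  assumes "elementary T" "elementary T'"
  shows "elementary (\<lambda>x. T x - T' x)"
proof -
  obtain rs rs' where "\<forall>x\<in>A. T x = elem rs x" "\<forall>x\<in>A. T' x = elem rs' x"
    using assms by (auto simp: elementary_def)
  then show ?thesis unfolding elementary_def
    by (intro exI[of _ "rs @ map (\<lambda>(r, s). (- r, s)) rs'"]) (simp add: elem_uminus)
qed

lemma elementary_sum: "(\<And>i. i \<in> S \<Longrightarrow> elementary (T i)) \<Longrightarrow> elementary (\<lambda>x. \<Sum>i\<in>S. T i x)"
proof (induction S rule: infinite_finite_induct)
  case empty
  show ?case unfolding elementary_def by (rule exI[of _ "[]"]) simp
next
  case (infinite S)
  then show ?case unfolding elementary_def by (intro exI[of _ "[]"]) simp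
qed (simp add: elementary_add)

lemma elementary_elem: "elementary (\<lambda>x. p * elem rs (a * x * b))"
proof (induction rs)
  case Nil
  show ?case using elementary_single[of 0 0] by simp
next
  case (Cons y rs)
  obtain r s where y: "y = (r, s)" by fastforce
  have "elementary (\<lambda>x. (p * r * a) * x * (b * s) + p * elem rs (a * x * b))"
    by (intro elementary_add elementary_single Cons)
  then show ?case by (simp add: y distrib_left mult.assoc)
qed

text \<open>Isolates the part of an operator with left coefficient \<open>a\<close>, the other left
  coefficients having a span that avoids \<open>a\<close>. This is the form in which Martindale's
  lemma can kill the others and keep \<open>a\<close>.\<close>

lemma elem_normal_form:
  assumes a: "a \<in> V" "a \<noteq> 0"
  shows "\<exists>q0 P h. q0 \<in> V \<and> finite P \<and> P \<subseteq> V \<and> a \<notin> K_span P \<and>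
    (\<forall>x. e * elem rs x = a * x * q0 + (\<Sum>p\<in>P. p * x * h p))"
proof (induction rs)
  case Nil
  have "a \<notin> K_span {}" using a(2) by (auto simp: K_span_def)
  then show ?case by (intro exI[of _ 0] exI[of _ "{}"]) (auto simp: V_closed)
next
  case (Cons y rs)
  obtain r s where y: "y = (r, s)" by fastforce
  obtain q0 P h where q0: "q0 \<in> V" and P: "finite P" "P \<subseteq> V" "a \<notin> K_span P"
    and eq: "\<And>x. e * elem rs x = a * x * q0 + (\<Sum>p\<in>P. p * x * h p)" using Cons by blast
  have eq': "e * elem (y # rs) x = (e * r) * x * s + (a * x * q0 + (\<Sum>p\<in>P. p * x * h p))" for x
    by (simp add: y distrib_left eq mult.assoc)
  have pull: "(\<Sum>p\<in>P. c p * p) * x * q = (\<Sum>p\<in>P. p * x * (c p * q))" if "\<And>p. c p \<in> K" for c x q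
    using that by (simp add: sum_distrib_right mult.assoc K_left_commute[OF that])
  consider "e * r \<in> K_span P" | "e * r \<notin> K_span P" "a \<notin> K_span (insert (e * r) P)"
    | "e * r \<notin> K_span P" "a \<in> K_span (insert (e * r) P)" by blast
  then show ?case
  proof cases
    case 1
    then obtain c where c: "\<And>p. c p \<in> K" "e * r = (\<Sum>p\<in>P. c p * p)" by (elim K_spanE) blast
    have "e * elem (y # rs) x = a * x * q0 + (\<Sum>p\<in>P. p * x * (h p + c p * s))" for x
      unfolding eq' c(2) pull[OF c(1)] by (simp add: distrib_left sum.distrib)
    then show ?thesis using q0 P
      by (intro exI[of _ q0] exI[of _ P] exI[of _ "\<lambda>p. h p + c p * s"]) simp
  next
    case 2
    then have "e * r \<notin> P" using K_span_base[of P] P by blast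
    then have sum: "(\<Sum>p\<in>insert (e * r) P. p * x * (h(e * r := s)) p) =
        (e * r) * x * s + (\<Sum>p\<in>P. p * x * h p)" for x
      using P(1) by simp (intro sum.cong, auto)
    have "e * elem (y # rs) x = a * x * q0 + (\<Sum>p\<in>insert (e * r) P. p * x * (h(e * r := s)) p)" for x
      unfolding eq' sum by (simp add: algebra_simps)
    then show ?thesis using q0 P 2(2) V_closed(7)[of r]
      by (intro exI[of _ q0] exI[of _ "insert (e * r) P"] exI[of _ "h(e * r := s)"]) auto
  next
    \<comment> \<open>Adding \<open>e * r\<close> to \<open>P\<close> would capture
      \<open>a\<close>. By exchange \<open>e * r\<close> is then a combination of \<open>a\<close>
      and \<open>P\<close>, so its term is distributed over the existing ones.\<close>
    case 3
    then have "e * r \<notin> P" using K_span_base[of P] P by blast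
    then obtain k where k: "k \<in> K" "a - k * (e * r) \<in> K_span P"
      using K_span_insert[OF P(1) _ 3(2)] by blast
    have "k \<noteq> 0" using k(2) P(3) by auto
    then obtain d where d: "d \<in> K" "d * k = e" using K_inverse k(1) by blast
    obtain c where c: "\<And>p. c p \<in> K" "a - k * (e * r) = (\<Sum>p\<in>P. c p * p)" using k(2) by (elim K_spanE) blast
    have "d * (a - k * (e * r)) = d * a - e * r"
      using d(2) by (simp add: right_diff_distrib e_idem flip: mult.assoc)
    then have "e * r = d * a - d * (\<Sum>p\<in>P. c p * p)" using c(2) by (simp add: algebra_simps)
    then have "(e * r) * x * s = a * x * (d * s) - (\<Sum>p\<in>P. p * x * (c p * (d * s)))" for x
      using pull[of c x "d * s", OF c(1)] K_left_commute[OF d(1)]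
      by (simp add: left_diff_distrib mult.assoc)
    then have "e * elem (y # rs) x = a * x * (q0 + d * s) + (\<Sum>p\<in>P. p * x * (h p - c p * (d * s)))" for x
      unfolding eq' by (simp add: distrib_left right_diff_distrib sum_subtractf)
    moreover have "q0 + d * s \<in> V" using q0 K_V[OF d(1)] by (simp add: V_closed)
    ultimately show ?thesis using P
      by (intro exI[of _ "q0 + d * s"] exI[of _ P] exI[of _ "\<lambda>p. h p - c p * (d * s)"]) simp
  qed
qed

text \<open>Write \<open>a x b\<close> as a combination of a finite basis with coordinates in
  \<open>K\<close>. As \<delta> is \<open>K\<close>-linear, \<open>\<delta> (a x b)\<close> has the
  same coordinates with respect to the \<open>\<delta> w\<close>, and the dual operators recover the
  coordinates, times \<open>z\<close>, from \<open>a x b\<close> itself. The Leibniz rule then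
  isolates \<open>a * \<delta> x * b\<close>.\<close>

lemma differential_identity:
  assumes ab: "a \<in> V" "b \<in> V" "b \<noteq> 0" and rank: "finite_rank (\<lambda>x. a * x * b)"
  shows "\<exists>b'\<in>V. b' \<noteq> 0 \<and> elementary (\<lambda>x. a * \<delta> x * b')"
proof -
  obtain W where W: "finite W" "W \<subseteq> V" "\<And>x. x \<in> A \<Longrightarrow> a * x * b \<in> K_span W"
    using rank by (auto simp: finite_rank_def)
  obtain B where B: "B \<subseteq> W" "K_independent (\<lambda>x. x) B" "W \<subseteq> K_span B"
    using exists_basis[OF W(1,2)] by blast
  have fB: "finite B" "B \<subseteq> V" using B(1) W(1,2) finite_subset by blast+
  have WB: "x \<in> K_span B" if x: "x \<in> K_span W" for x
  proof -
    obtain c where c: "\<And>w. c w \<in> K" "x = (\<Sum>w\<in>W. c w * w)" using x by (elim K_spanE) blast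
    show ?thesis unfolding c(2) using B(3) c(1) by (intro K_span_sum K_span_scale) auto
  qed
  obtain z E where z: "z \<in> V" "z \<noteq> 0"
    and E: "\<And>w w'. w \<in> B \<Longrightarrow> w' \<in> B \<Longrightarrow> elem (E w) w' = (if w = w' then z else 0)"
    using dual_basis[OF fB B(2)] by metis
  \<comment> \<open>The coordinates are known only times \<open>z\<close>; \<open>t\<close> is
    inserted so that the right factor \<open>b * t * z\<close> stays nonzero.\<close>
  obtain t where t: "b * t * z \<noteq> 0" using primeE[OF ab(2) z(1) ab(3) z(2)] by blast
  have D: "\<delta> (a * x * b) * t * z = (\<Sum>w\<in>B. \<delta> w * t * elem (E w) (a * x * b))" if x: "x \<in> A" for x
  proof -
    obtain c where c: "\<And>w. c w \<in> K" "a * x * b = (\<Sum>w\<in>B. c w * w)"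
      using WB[OF W(3)[OF x]] by (elim K_spanE) blast
    have "elem (E w) (a * x * b) = c w * z" if w: "w \<in> B" for w
    proof -
      have "elem (E w) (a * x * b) = (\<Sum>w'\<in>B. if w = w' then c w' * z else 0)"
        unfolding c(2) elem_sum elem_scale[OF c(1)] using E[OF w] by (intro sum.cong) auto
      then show ?thesis using fB(1) w by simp
    qed
    then have "(\<Sum>w\<in>B. \<delta> w * t * elem (E w) (a * x * b)) = (\<Sum>w\<in>B. c w * \<delta> w * t * z)"
      by (intro sum.cong) (simp_all add: mult.assoc K_left_commute[OF c(1)])
    then show ?thesis by (simp add: c(2) \<delta>_K_sum[OF c(1)] sum_distrib_right)
  qed
  have "elementary (\<lambda>x. (\<Sum>w\<in>B. \<delta> w * t * elem (E w) (a * x * b))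
      - (\<delta> a * x * (b * t * z) + a * x * (\<delta> b * t * z)))"
    by (intro elementary_diff elementary_add elementary_sum elementary_elem elementary_single)
  moreover have "a * \<delta> x * (b * t * z) = (\<Sum>w\<in>B. \<delta> w * t * elem (E w) (a * x * b))
      - (\<delta> a * x * (b * t * z) + a * x * (\<delta> b * t * z))" if "x \<in> A" for x
    unfolding D[OF that, symmetric] by (simp add: \<delta>_mult distrib_right distrib_left mult.assoc)
  ultimately have "elementary (\<lambda>x. a * \<delta> x * (b * t * z))" by (simp add: elementary_def)
  then show ?thesis using t ab(2) by (intro bexI[of _ "b * t * z"]) (auto simp: V_closed)
qed

text \<open>In the identity for \<open>a * \<delta> x * b\<close> replace \<open>x\<close> by
  \<open>s * x\<close>, multiply by \<open>u\<close> on the left and sum over an operator with terms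
  \<open>(u, s)\<close>. If the operator kills the unwanted left coefficients \<open>P\<close> but
  not \<open>a\<close>, only the term with right factor \<open>q\<close> remains, at the price of a
  term \<open>p * x * b\<close> in which \<delta> has hit the \<open>s\<close>.\<close>

lemma twisted_commutator_identity:
  assumes ab: "a \<in> V" "b \<in> V" "a \<noteq> 0" "b \<noteq> 0" and rank: "finite_rank (\<lambda>x. a * x * b)"
  obtains a' p b' q where "a' \<in> A" "a' \<in> V" "a' \<noteq> 0" "p \<in> A" "p \<in> V" "b' \<in> A" "b' \<in> V" "b' \<noteq> 0"
    "q \<in> A" "q \<in> V" "\<And>x. x \<in> A \<Longrightarrow> a' * \<delta> x * b' = a' * x * q - p * x * b'"
proof -
  \<comment> \<open>With \<open>a * r\<close> in \<open>A\<close> instead of \<open>a\<close>, both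
    \<open>a'\<close> and \<open>p\<close> below are in \<open>A\<close>.\<close>
  obtain r where r: "r \<in> A" "a * r \<noteq> 0" "a * r \<in> A" using dense[OF ab(3)] by blast
  have "finite_rank (\<lambda>x. 1 * (a * (r * x) * b) * 1)" by (rule finite_rank_mult[OF rank r(1)])
  then have "finite_rank (\<lambda>x. a * r * x * b)" by (simp add: mult.assoc)
  moreover have arV: "a * r \<in> V" using ab(1) by (simp add: V_closed)
  ultimately obtain b0 where b0: "b0 \<in> V" "b0 \<noteq> 0" "elementary (\<lambda>x. a * r * \<delta> x * b0)"
    using differential_identity[of "a * r" b] ab by blast
  then obtain rs where rs: "\<And>x. x \<in> A \<Longrightarrow> a * r * \<delta> x * b0 = elem rs x"
    by (auto simp: elementary_def)
  obtain q0 P h where q0: "q0 \<in> V" and P: "finite P" "P \<subseteq> V" "a * r \<notin> K_span P"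
    and nf: "\<And>x. e * elem rs x = a * r * x * q0 + (\<Sum>p\<in>P. p * x * h p)"
    using elem_normal_form[OF arV r(2)] by metis
  have id: "a * r * \<delta> x * b0 = a * r * x * q0 + (\<Sum>p\<in>P. p * x * h p)" if "x \<in> A" for x
    using rs[OF that] nf[of x] V_D(1)[OF arV] by (metis mult.assoc)
  obtain ts where ts: "set ts \<subseteq> A \<times> A" "elem ts (a * r) \<noteq> 0" "\<And>p. p \<in> P \<Longrightarrow> elem ts p = 0"
    using martindale[OF P(1,2) arV P(3)] by blast
  define a' where "a' = elem ts (a * r)"
  define p where "p = (\<Sum>(u, s)\<leftarrow>ts. u * (a * r) * \<delta> s)"
  have a'p: "a' \<in> A" "p \<in> A" using ts(1) unfolding a'_def p_def
    by (induction ts) (auto intro!: add_closed mult_closed \<delta>_closed r(3))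
  have "p \<in> V" unfolding p_def
    by (induction ts) (auto simp: V_closed arV)
  have id': "a' * \<delta> x * b0 = a' * x * q0 - p * x * b0" if x: "x \<in> A" for x
  proof -
    have "(\<Sum>(u, s)\<leftarrow>ts. u * (a * r * \<delta> (s * x) * b0)) = p * x * b0 + a' * \<delta> x * b0"
      unfolding a'_def p_def by (induction ts) (auto simp: \<delta>_mult algebra_simps)
    moreover have "(\<Sum>(u, s)\<leftarrow>ts. u * (a * r * \<delta> (s * x) * b0)) =
        elem ts (a * r) * x * q0 + (\<Sum>p\<in>P. elem ts p * x * h p)"
      using ts(1)
    proof (induction ts)
      case (Cons y ts)
      obtain u s where y: "y = (u, s)" by fastforce
      have sx: "s * x \<in> A" using Cons.prems x by (simp add: y mult_closed)
      have "u * (a * r * \<delta> (s * x) * b0) = u * (a * r * (s * x) * q0 + (\<Sum>p\<in>P. p * (s * x) * h p))"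
        by (simp only: id[OF sx])
      then show ?case using Cons
        by (simp add: y distrib_left distrib_right sum_distrib_left sum.distrib mult.assoc add_ac)
    qed simp
    ultimately have "p * x * b0 + a' * \<delta> x * b0 = a' * x * q0" using ts(3) by (simp add: a'_def)
    then show ?thesis by (simp add: algebra_simps)
  qed
  \<comment> \<open>Two right factors from \<open>A\<close> bring \<open>b0\<close> and
    \<open>q0\<close> into \<open>A\<close> together, without killing \<open>b0\<close>.\<close>
  obtain s0 where s0: "s0 \<in> A" "b0 * s0 \<noteq> 0" "b0 * s0 \<in> A" using dense[OF b0(2), of b0] by blast
  obtain s1 where s1: "s1 \<in> A" "b0 * s0 * s1 \<noteq> 0" "q0 * s0 * s1 \<in> A"
    using dense[OF s0(2), of "q0 * s0"] by blast
  show thesis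
  proof (rule that[of a' p "b0 * s0 * s1" "q0 * s0 * s1"])
    show "a' \<in> V" "a' \<noteq> 0" using elem_V[OF arV] ts(2) by (auto simp: a'_def)
    show "b0 * s0 * s1 \<in> A" using s0(3) s1(1) mult_closed by blast
    show "a' * \<delta> x * (b0 * s0 * s1) = a' * x * (q0 * s0 * s1) - p * x * (b0 * s0 * s1)" if "x \<in> A" for x
      using arg_cong[OF id'[OF that], of "\<lambda>y. y * s0 * s1"] by (simp add: left_diff_distrib mult.assoc)
  qed (use a'p \<open>p \<in> V\<close> s1 b0(1) q0 in \<open>auto simp: V_closed\<close>)
qed

text \<open>With \<open>g u = a \<delta>(u) + p u\<close> the identity of the previous lemma reads
  \<open>g u x b = a u (x q - \<delta>(x) b)\<close>, so the sought element, to be characterised by \<open>g u = a u y\<close>, has to map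
  \<open>x b\<close> to \<open>x q - \<delta>(x) b\<close>.\<close>

theorem corner_inner:
  assumes ab: "a0 \<in> V" "b0 \<in> V" "a0 \<noteq> 0" "b0 \<noteq> 0" and rank: "finite_rank (\<lambda>x. a0 * x * b0)"
  obtains y z where "y \<in> V" "\<And>r. r \<in> A \<Longrightarrow> e * \<delta> r = r * y - y * r"
    "z \<in> A" "z \<in> V" "z \<noteq> 0" "y * z \<in> A" "z * y \<in> A"
proof -
  obtain a p b q where a: "a \<in> A" "a \<in> V" "a \<noteq> 0" and p: "p \<in> A" "p \<in> V"
    and b: "b \<in> A" "b \<in> V" "b \<noteq> 0" and q: "q \<in> A" "q \<in> V"
    and id: "\<And>x. x \<in> A \<Longrightarrow> a * \<delta> x * b = a * x * q - p * x * b"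
    using twisted_commutator_identity[OF ab rank] by metis
  define g where "g u = a * \<delta> u + p * u" for u
  have gV: "g u \<in> V" for u using a(2) p(2) by (simp add: g_def V_closed)
  have gA: "g u \<in> A" if "u \<in> A" for u
    using a(1) p(1) \<delta>_closed that by (simp add: g_def add_closed mult_closed)
  have g_e: "g u * (e * x) = g u * x" for u x
    using V_D(2)[OF gV] by (simp flip: mult.assoc)
  have g_mult: "g (u * r) = g u * r + a * u * \<delta> r" for u r
    by (simp add: g_def \<delta>_mult algebra_simps)
  have g_id: "g u * x * b = a * u * (x * q - \<delta> x * b)" if "u \<in> A" "x \<in> A" for u x
    using id[OF mult_closed[OF that]] by (simp add: g_def \<delta>_mult algebra_simps)
  \<comment> \<open>\<open>rel x w\<close> says that \<open>w\<close> is a possible value of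
    \<open>y * x\<close>. Asking for the equation at all \<open>u\<close> makes \<open>w\<close>
    unique, by primeness of \<open>eQ\<close>.\<close>
  define rel where "rel x w \<longleftrightarrow> w \<in> A \<and> w \<in> V \<and> (\<forall>u\<in>A. a * u * w = g u * x)" for x w
  define I where "I = {x\<in>A. e * x \<in> A \<and> (\<exists>w. rel x w)}"
  define \<psi> where "\<psi> x = (THE w. rel x w)" for x
  have \<psi>_eq: "\<psi> x = w" if "rel x w" for x w
    unfolding \<psi>_def
  proof (rule the_equality)
    show "rel x w" by (rule that)
    fix w' assume "rel x w'"
    then have "a * u * (w - w') = 0" if "u \<in> A" for u
      using \<open>rel x w\<close> that by (simp add: rel_def right_diff_distrib)
    moreover have "w - w' \<in> V" using \<open>rel x w\<close> \<open>rel x w'\<close> by (simp add: rel_def V_closed)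
    ultimately show "w' = w" using prime[OF a(2)] a(3) by force
  qed
  have \<psi>: "rel x (\<psi> x)" if "x \<in> I" for x using that \<psi>_eq by (auto simp: I_def)
  \<comment> \<open>Ensures that \<open>I\<close> contains everything killed by \<open>e\<close>, as
    \<open>faithful_ideal\<close> requires.\<close>
  have rel_zero: "rel x 0" if "e * x = 0" for x
    using g_e[of _ x] that by (simp add: rel_def V_closed)
  have rel_diff: "rel (x - x') (w - w')" and rel_add: "rel (x + x') (w + w')"
    if "rel x w" "rel x' w'" for x x' w w'
    using that by (auto simp: rel_def right_diff_distrib distrib_left V_closed diff_closed add_closed)
  have rel_right: "rel (x * r) (w * r)" if "rel x w" "r \<in> A" for x w r
    using that by (auto simp: rel_def V_closed mult_closed simp flip: mult.assoc)
  \<comment> \<open>The rule \<open>y r = r y - e \<delta>(r)\<close> already at the level of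
    values. It makes \<open>I\<close> a left ideal and later yields the commutator formula.\<close>
  have rel_left: "rel (r * x) (r * w - \<delta> r * (e * x))" if "rel x w" "r \<in> A" "e * x \<in> A" for x w r
  proof -
    have "a * u * (r * w - \<delta> r * (e * x)) = g u * (r * x)" if u: "u \<in> A" for u
    proof -
      have "a * u * \<delta> r * (e * x) = a * u * \<delta> r * x"
        using V_D(2)[of "a * u * \<delta> r"] a(2) by (simp add: V_closed flip: mult.assoc)
      moreover have "a * u * r * w = g (u * r) * x"
        using \<open>rel x w\<close> mult_closed[OF u \<open>r \<in> A\<close>] by (metis rel_def mult.assoc)
      ultimately show ?thesis by (simp add: g_mult algebra_simps)
    qed
    moreover have "r * w - \<delta> r * (e * x) \<in> A" "r * w - \<delta> r * (e * x) \<in> V"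
      using that by (auto simp: rel_def V_closed intro!: diff_closed mult_closed \<delta>_closed)
    ultimately show ?thesis by (simp add: rel_def)
  qed
  have I_I: "x \<in> I" if "x \<in> A" "e * x \<in> A" "rel x w" for x w using that by (auto simp: I_def)
  have I_D: "x \<in> A" "e * x \<in> A" if "x \<in> I" for x using that by (auto simp: I_def)
  have e_left: "e * (r * x) = r * (e * x)" for r x by (metis e_commute mult.assoc)
  have I: "ideal I" unfolding ideal_def
  proof (intro conjI ballI)
    show "I \<subseteq> A" using I_D by blast
    show "0 \<in> I" using I_I[OF _ _ rel_zero] by simp
    show "x - y \<in> I" if "x \<in> I" "y \<in> I" for x y
      by (rule I_I[OF _ _ rel_diff[OF \<psi>[OF that(1)] \<psi>[OF that(2)]]])
        (use that I_D in \<open>auto simp: right_diff_distrib intro!: diff_closed\<close>)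
    fix x r assume x: "x \<in> I" "r \<in> A"
    show "x * r \<in> I"
      by (rule I_I[OF _ _ rel_right[OF \<psi>[OF x(1)] x(2)]])
        (use x I_D in \<open>auto simp: mult_closed simp flip: mult.assoc\<close>)
    show "r * x \<in> I"
      by (rule I_I[OF _ _ rel_left[OF \<psi>[OF x(1)] x(2) I_D(2)[OF x(1)]]])
        (use x I_D in \<open>auto simp: mult_closed e_left\<close>)
  qed
  have xb: "x * b \<in> I" "\<psi> (x * b) = x * q - \<delta> x * b" if "x \<in> A" for x
  proof -
    have "rel (x * b) (x * q - \<delta> x * b)" unfolding rel_def
      using g_id that b(1,2) q by (auto simp: V_closed intro!: diff_closed mult_closed \<delta>_closed simp flip: mult.assoc)
    moreover have "e * (x * b) = x * b" using b(2) V_D(1) by (simp add: V_closed)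
    ultimately show "x * b \<in> I" "\<psi> (x * b) = x * q - \<delta> x * b"
      using I_I \<psi>_eq that b(1) mult_closed by auto
  qed
  obtain r0 where r0: "r0 \<in> A" "b * r0 * b \<noteq> 0" using primeE[OF b(2,2,3,3)] by blast
  have "faithful I"
  proof (rule faithful_ideal[OF I])
    show "b * r0 * b \<in> I" using xb(1)[of "b * r0"] b(1) r0(1) mult_closed by blast
    show "x \<in> I" if "x \<in> A" "e * x = 0" for x
      by (rule I_I[OF that(1) _ rel_zero[OF that(2)]]) (simp add: that(2))
  qed (use r0 b(2) in \<open>auto simp: V_closed\<close>)
  moreover have "\<psi> x \<in> A" "\<psi> x \<in> V" if "x \<in> I" for x using \<psi>[OF that] by (auto simp: rel_def)
  moreover have "\<psi> (x + y) = \<psi> x + \<psi> y" if "x \<in> I" "y \<in> I" for x y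
    by (rule \<psi>_eq[OF rel_add[OF \<psi>[OF that(1)] \<psi>[OF that(2)]]])
  moreover have "\<psi> (x * r) = \<psi> x * r" if "x \<in> I" "r \<in> A" for x r
    by (rule \<psi>_eq[OF rel_right[OF \<psi>[OF that(1)] that(2)]])
  ultimately obtain y0 where y0: "\<And>x. x \<in> I \<Longrightarrow> y0 * x = \<psi> x"
    using extend_ideal[OF I, of \<psi>] by blast
  define y where "y = e * y0"
  have yV: "y \<in> V" by (simp add: y_def V_closed)
  have y: "y * x = \<psi> x" if "x \<in> I" for x
    using y0[OF that] V_D(1)[OF \<open>x \<in> I \<Longrightarrow> \<psi> x \<in> V\<close>[OF that]] by (simp add: y_def mult.assoc)
  have ad: "e * \<delta> r = r * y - y * r" if r: "r \<in> A" for r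
  proof -
    have "(y * r - r * y + e * \<delta> r) * x = 0" if x: "x \<in> I" for x
    proof -
      have "\<psi> (r * x) = r * \<psi> x - \<delta> r * (e * x)"
        by (rule \<psi>_eq[OF rel_left[OF \<psi>[OF x] r I_D(2)[OF x]]])
      moreover have "\<delta> r * (e * x) = e * \<delta> r * x" by (simp add: e_left mult.assoc)
      ultimately show ?thesis using y[OF x] y[OF idealD(5)[OF I x r]]
        by (simp add: distrib_right left_diff_distrib mult.assoc)
    qed
    then have "y * r - r * y + e * \<delta> r = 0" by (rule faithfulD[OF I \<open>faithful I\<close>])
    then show ?thesis by (simp add: algebra_simps eq_neg_iff_add_eq_0)
  qed
  have ay: "a * u * y = g u" if u: "u \<in> A" for u
  proof -
    have "(a * u * y - g u) * x = 0" if "x \<in> I" for x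
      using y[OF that] \<psi>[OF that] u by (simp add: rel_def left_diff_distrib mult.assoc)
    then have "a * u * y - g u = 0" by (rule faithfulD[OF I \<open>faithful I\<close>])
    then show ?thesis by simp
  qed
  obtain t where t: "t \<in> A" "b * t * a \<noteq> 0" using primeE[OF b(2) a(2) b(3) a(3)] by blast
  \<comment> \<open>The witness is \<open>z = (c u b) (t a v)\<close>. Its first factor is in
    \<open>I\<close>, so \<open>y\<close> maps it into \<open>A\<close>; its end \<open>a v\<close>
    satisfies \<open>a v y = g v\<close>, which is in \<open>A\<close> as well.\<close>
  define c where "c = b * t * a"
  have c: "c \<in> A" "c \<in> V" "c \<noteq> 0" using t a b by (auto simp: c_def mult_closed V_closed)
  obtain u where u: "u \<in> A" "c * u * c \<noteq> 0" using primeE[OF c(2,2,3,3)] by blast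
  obtain v where v: "v \<in> A" "c * u * c * v \<noteq> 0" using dense[OF u(2)] by blast
  show thesis
  proof (rule that[OF yV ad])
    show "c * u * c * v \<in> A" "c * u * c * v \<in> V" "c * u * c * v \<noteq> 0"
      using c u(1) v by (auto simp: mult_closed V_closed)
    have cu: "c * u \<in> A" using c(1) u(1) mult_closed by blast
    have "y * (c * u * c * v) = y * (c * u * b) * (t * a * v)"
      by (simp add: c_def mult.assoc)
    also have "\<dots> = \<psi> (c * u * b) * (t * a * v)" by (simp only: y[OF xb(1)[OF cu]])
    also have "\<dots> \<in> A" using xb(2)[OF cu] cu t(1) a(1) v(1) b(1) q(1)
      by (auto intro!: mult_closed diff_closed \<delta>_closed)
    finally show "y * (c * u * c * v) \<in> A" .
    have "c * u * c * v * y = c * u * b * t * g v"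
      using ay[OF v(1)] by (simp add: c_def mult.assoc)
    also have "\<dots> \<in> A" using gA[OF v(1)] cu b(1) t(1) by (auto intro!: mult_closed)
    finally show "c * u * c * v * y \<in> A" .
  qed
qed

end

section \<open>Extending derivations to the quotient ring, and two-sided multipliers\<close>

context right_quotient_ring
begin

text \<open>The Leibniz rule dictates \<open>\<delta> q * x = d (q * x) - q * d x\<close>. The right
  side is a right linear map with values in \<open>A\<close> where \<open>q * x\<close> and
  \<open>q * d x\<close> are both in \<open>A\<close>, which is a dense right ideal;
  \<open>extend\<close> then provides \<open>\<delta> q\<close>.\<close>

lemma extend_derivation:
  assumes d_add: "\<And>x y. x \<in> A \<Longrightarrow> y \<in> A \<Longrightarrow> d (x + y) = d x + d y"
    and d_mult: "\<And>x y. x \<in> A \<Longrightarrow> y \<in> A \<Longrightarrow> d (x * y) = d x * y + x * d y"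
    and d_closed: "\<And>x. x \<in> A \<Longrightarrow> d x \<in> A"
  shows "\<exists>\<delta>. (\<forall>p q. \<delta> (p + q) = \<delta> p + \<delta> q) \<and> (\<forall>p q. \<delta> (p * q) = \<delta> p * q + p * \<delta> q) \<and>
    (\<forall>x\<in>A. \<delta> x = d x) \<and> (\<forall>q. \<forall>x\<in>A. q * x \<in> A \<longrightarrow> \<delta> q * x = d (q * x) - q * d x)"
proof -
  have d_diff: "d (x - y) = d x - d y" if "x \<in> A" "y \<in> A" for x y
    using d_add[OF diff_closed[OF that] that(2)] by (simp add: algebra_simps)
  have "\<exists>y. \<forall>x\<in>{x\<in>A. q * x \<in> A \<and> q * d x \<in> A}. y * x = d (q * x) - q * d x" for q
  proof (rule extend)
    let ?J = "{x\<in>A. q * x \<in> A \<and> q * d x \<in> A}"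
    have d0: "d 0 = 0" using d_diff[of 0 0] by simp
    show "?J \<subseteq> A" "0 \<in> ?J" by (auto simp: d0)
    show "x - y \<in> ?J" if "x \<in> ?J" "y \<in> ?J" for x y
      using that by (auto simp: d_diff right_diff_distrib intro: diff_closed)
    fix x r assume x: "x \<in> ?J"
    show "d (q * x) - q * d x \<in> A" using x by (auto intro!: diff_closed d_closed)
    { assume r: "r \<in> A"
      have "q * d (x * r) = q * d x * r + q * x * d r"
        using x r d_mult by (simp add: distrib_left mult.assoc)
      moreover have "q * (x * r) = q * x * r" by (simp add: mult.assoc)
      ultimately show "x * r \<in> ?J" using x r by (auto intro!: add_closed mult_closed d_closed)
      have "d (q * x * r) = d (q * x) * r + q * x * d r" using x r d_mult by blast
      then show "d (q * (x * r)) - q * d (x * r) = (d (q * x) - q * d x) * r"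
        using \<open>q * d (x * r) = _\<close> by (simp add: left_diff_distrib mult.assoc) }
    show "d (q * (x + y)) - q * d (x + y) = d (q * x) - q * d x + (d (q * y) - q * d y)"
      if "y \<in> ?J" for y
      using x that by (simp add: d_add distrib_left)
  next
    fix p q' assume p: "p \<in> A" "q' \<in> A" "q' \<noteq> 0"
    obtain r where r: "r \<in> A" "q' * r \<noteq> 0" "q * p * r \<in> A" using dense[OF p(3)] by blast
    obtain s where s: "s \<in> A" "q' * r * s \<noteq> 0" "q * d (p * r) * s \<in> A" using dense[OF r(2)] by blast
    have "d (p * (r * s)) = d (p * r) * s + p * r * d s"
      using d_mult[OF mult_closed[OF p(1) r(1)] s(1)] by (simp add: mult.assoc)
    then have "q * d (p * (r * s)) = q * d (p * r) * s + q * p * r * d s"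
      by (simp add: distrib_left mult.assoc)
    moreover have "\<dots> \<in> A" by (rule add_closed[OF s(3) mult_closed[OF r(3) d_closed[OF s(1)]]])
    moreover have "q * p * r * s \<in> A" using r(3) s(1) mult_closed by blast
    ultimately show "\<exists>r\<in>A. q' * r \<noteq> 0 \<and> p * r \<in> {x\<in>A. q * x \<in> A \<and> q * d x \<in> A}"
      using p(1) r(1) s(1,2) by (intro bexI[of _ "r * s"]) (auto simp: mult.assoc mult_closed)
  qed
  then obtain \<delta> where \<delta>0: "\<And>q x. x \<in> A \<Longrightarrow> q * x \<in> A \<Longrightarrow> q * d x \<in> A \<Longrightarrow> \<delta> q * x = d (q * x) - q * d x"
    by (metis (mono_tags, lifting) mem_Collect_eq)
  \<comment> \<open>The condition \<open>q * d x \<in> A\<close> is removed by testing on those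
    \<open>r\<close> that bring \<open>q * d x\<close> into \<open>A\<close>.\<close>
  have \<delta>: "\<delta> q * x = d (q * x) - q * d x" if x: "x \<in> A" "q * x \<in> A" for q x
  proof -
    have "\<delta> q * x - (d (q * x) - q * d x) = 0"
    proof (rule eq_zeroI[of "q * d x"])
      fix r assume r: "r \<in> A" "q * d x * r \<in> A"
      have qd: "q * d (x * r) = q * d x * r + q * x * d r"
        using d_mult[OF x(1) r(1)] by (simp add: distrib_left mult.assoc)
      then have "q * d (x * r) \<in> A" using r x d_closed add_closed mult_closed by auto
      moreover have "q * (x * r) \<in> A" using mult_closed[OF x(2) r(1)] by (simp add: mult.assoc)
      ultimately have "\<delta> q * (x * r) = d (q * (x * r)) - q * d (x * r)"
        using \<delta>0 x r mult_closed by blast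
      also have "d (q * (x * r)) = d (q * x) * r + q * x * d r"
        using d_mult[OF x(2) r(1)] by (simp add: mult.assoc)
      finally show "(\<delta> q * x - (d (q * x) - q * d x)) * r = 0"
        by (simp add: qd left_diff_distrib mult.assoc)
    qed
    then show ?thesis by simp
  qed
  show ?thesis
  proof (intro exI[of _ \<delta>] conjI allI ballI impI)
    fix p q :: 'q
    have "\<delta> (p + q) - (\<delta> p + \<delta> q) = 0"
    proof (rule eq_zeroI2[where p = p and p' = q])
      fix r assume r: "r \<in> A" "p * r \<in> A" "q * r \<in> A"
      then have "\<delta> (p + q) * r = d (p * r + q * r) - (p * d r + q * d r)"
        using \<delta>[of r "p + q"] add_closed by (simp add: distrib_right)
      then have "(\<delta> (p + q) - (\<delta> p + \<delta> q)) * r =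
          d (p * r) + d (q * r) - (p * d r + q * d r) - (d (p * r) - p * d r + (d (q * r) - q * d r))"
        using \<delta>[OF r(1,2)] \<delta>[OF r(1,3)] d_add[OF r(2,3)] by (simp only: left_diff_distrib distrib_right)
      then show "(\<delta> (p + q) - (\<delta> p + \<delta> q)) * r = 0" by simp
    qed
    then show "\<delta> (p + q) = \<delta> p + \<delta> q" by simp
    have "\<delta> (p * q) - (\<delta> p * q + p * \<delta> q) = 0"
    proof (rule eq_zeroI2[where p = q and p' = "p * q"])
      fix r assume r: "r \<in> A" "q * r \<in> A" "p * q * r \<in> A"
      have "\<delta> p * (q * r) = d (p * q * r) - p * d (q * r)"
        using \<delta>[OF r(2), of p] r(3) by (simp add: mult.assoc)
      then show "(\<delta> (p * q) - (\<delta> p * q + p * \<delta> q)) * r = 0"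
        using \<delta>[OF r(1,2)] \<delta>[OF r(1,3)]
        by (simp add: left_diff_distrib right_diff_distrib distrib_right mult.assoc)
    qed
    then show "\<delta> (p * q) = \<delta> p * q + p * \<delta> q" by simp
  next
    fix x assume x: "x \<in> A"
    have "\<delta> x - d x = 0"
      by (rule eq_zeroI[of 0]) (use x \<delta> d_mult mult_closed in \<open>simp add: left_diff_distrib\<close>)
    then show "\<delta> x = d x" by simp
  qed (rule \<delta>)
qed

definition essential :: "'q set \<Rightarrow> bool" where
  "essential I \<longleftrightarrow> ideal I \<and> (\<forall>J. ideal J \<longrightarrow> J \<noteq> {0} \<longrightarrow> I \<inter> J \<noteq> {0})"

lemma ideal_Int: "ideal I \<Longrightarrow> ideal J \<Longrightarrow> ideal (I \<inter> J)"
  by (auto simp: ideal_def)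

lemma essential_Int: "essential I \<Longrightarrow> essential J \<Longrightarrow> essential (I \<inter> J)"
  unfolding essential_def by (metis ideal_Int Int_assoc)

text \<open>The counterpart of \<open>Qsm\<close> for ring ideals of \<open>A\<close>;
  \<open>multipliers_Qsm\<close> compares the two.\<close>

definition multipliers :: "'q set" where
  "multipliers = {q. \<exists>I. essential I \<and> (\<forall>x\<in>I. q * x \<in> A \<and> x * q \<in> A)}"

lemma multipliers_zero: "0 \<in> multipliers"
proof -
  have "ideal A" by (auto simp: ideal_def diff_closed mult_closed)
  moreover have "A \<inter> J = J" if "ideal J" for J using idealD(1)[OF that] by blast
  ultimately have "essential A" by (simp add: essential_def)
  then show ?thesis by (auto simp: multipliers_def)
qed

lemma multipliers_add:
  assumes "p \<in> multipliers" "q \<in> multipliers"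
  shows "p + q \<in> multipliers"
proof -
  obtain I where I: "essential I" "\<And>x. x \<in> I \<Longrightarrow> p * x \<in> A \<and> x * p \<in> A"
    using assms(1) unfolding multipliers_def by blast
  obtain J where J: "essential J" "\<And>x. x \<in> J \<Longrightarrow> q * x \<in> A \<and> x * q \<in> A"
    using assms(2) unfolding multipliers_def by blast
  have "\<forall>x\<in>I \<inter> J. (p + q) * x \<in> A \<and> x * (p + q) \<in> A"
    using I(2) J(2) by (auto simp: distrib_left distrib_right intro: add_closed)
  then show ?thesis unfolding multipliers_def using essential_Int[OF I(1) J(1)] by blast
qed

end

section \<open>From primitive idempotents to the whole ring\<close>

context quotient_derivation
begin

definition inner_part :: "'q \<Rightarrow> bool" where
  "inner_part e \<longleftrightarrow> (\<exists>q\<in>multipliers. \<forall>r\<in>A. e * \<delta> r = r * q - q * r)"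

lemma inner_part_zero: "inner_part 0"
  unfolding inner_part_def using multipliers_zero by (intro bexI[of _ 0]) auto

lemma inner_part_add:
  assumes "inner_part e" "inner_part e'"
  shows "inner_part (e + e')"
proof -
  obtain q q' where q: "q \<in> multipliers" "q' \<in> multipliers" "\<forall>r\<in>A. e * \<delta> r = r * q - q * r"
    "\<forall>r\<in>A. e' * \<delta> r = r * q' - q' * r" using assms by (auto simp: inner_part_def)
  then have "(e + e') * \<delta> r = r * (q + q') - (q + q') * r" if "r \<in> A" for r
    using that by (simp add: distrib_left distrib_right)
  then show ?thesis unfolding inner_part_def using multipliers_add[OF q(1,2)] by blast
qed

text \<open>\<open>corner_inner\<close> gives the element \<open>y\<close> inducing
  \<open>e \<delta>\<close>. It remains to see that \<open>y\<close> multiplies an essential ideal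
  into \<open>A\<close> from both sides, which the witness \<open>z\<close> and primeness
  ensure.\<close>

lemma inner_part_primitive:
  assumes e: "e \<in> ring_centre" "e * e = e" "e \<noteq> 0"
      "\<And>f. f \<in> ring_centre \<Longrightarrow> f * f = f \<Longrightarrow> e * f = 0 \<or> e * f = e"
    and f: "gp_coef e * f \<noteq> 0"
    and vanish: "\<forall>\<phi> :: 'q gen_poly \<Rightarrow> 'q. is_ring_hom \<phi> \<and> \<phi> ` range gp_indet \<subseteq> A \<and>
      (\<forall>q. \<phi> (gp_coef q) = q) \<longrightarrow> \<phi> f = 0"
  shows "inner_part e"
proof -
  interpret corner_derivation A e F \<delta> by unfold_locales (use e in auto)
  obtain a b where "a \<in> V" "b \<in> V" "a \<noteq> 0" "b \<noteq> 0" "finite_rank (\<lambda>x. a * x * b)"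
    using gpi_finite_rank[OF f vanish] by blast
  from corner_inner[OF this] obtain y z where yV: "y \<in> V"
    and ad: "\<And>r. r \<in> A \<Longrightarrow> e * \<delta> r = r * y - y * r"
    and z: "z \<in> A" "z \<in> V" "z \<noteq> 0" "y * z \<in> A" "z * y \<in> A" by blast
  \<comment> \<open>The condition \<open>e * x \<in> A\<close> is what makes \<open>I\<close> an
    ideal: \<open>y * (r * x)\<close> and \<open>r * (y * x)\<close> differ by
    \<open>\<delta> r * (e * x)\<close>, and similarly on the other side.\<close>
  define I where "I = {x\<in>A. e * x \<in> A \<and> y * x \<in> A \<and> x * y \<in> A}"
  have e_left: "e * (r * x) = r * (e * x)" for r x by (metis e_commute mult.assoc)
  have I: "ideal I" unfolding ideal_def
  proof (intro conjI ballI)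
    show "I \<subseteq> A" "0 \<in> I" by (auto simp: I_def)
    show "x - x' \<in> I" if "x \<in> I" "x' \<in> I" for x x'
      using that by (auto simp: I_def right_diff_distrib left_diff_distrib intro: diff_closed)
    fix x r assume x: "x \<in> I" and r: "r \<in> A"
    have yr: "y * (r * x) = r * (y * x) - \<delta> r * (e * x)"
    proof -
      have "y * r = r * y - e * \<delta> r" using ad[OF r] by simp
      then have "y * (r * x) = (r * y - e * \<delta> r) * x" by (simp flip: mult.assoc)
      then show ?thesis using e_left[of "\<delta> r" x] by (simp add: left_diff_distrib mult.assoc)
    qed
    have ry: "x * r * y = x * y * r + (e * x) * \<delta> r"
    proof -
      have "(e * x) * \<delta> r = x * (e * \<delta> r)" by (simp add: e_left mult.assoc)
      then show ?thesis using ad[OF r] by (simp add: right_diff_distrib mult.assoc)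
    qed
    show "x * r \<in> I" using x r ry
      by (auto simp: I_def intro!: mult_closed add_closed \<delta>_closed simp flip: mult.assoc)
    show "r * x \<in> I" using x r
      by (auto simp: I_def yr e_left mult.assoc intro!: mult_closed diff_closed \<delta>_closed)
  qed
  have N: "x \<in> I" if "x \<in> A" "e * x = 0" for x
  proof -
    have "y * x = y * (e * x)" "x * y = (e * x) * y"
      using V_D[OF yV] by (metis mult.assoc, metis e_commute mult.assoc)
    then show ?thesis using that by (simp add: I_def)
  qed
  have "z \<in> I" using z V_D(1) by (simp add: I_def)
  \<comment> \<open>An element killed by \<open>e\<close> is in \<open>I\<close> already. Any other
    \<open>j\<close> has by primeness a nonzero multiple \<open>j * r * z\<close>, which is in
    \<open>I\<close> because \<open>z\<close> is.\<close>
  have "essential I" unfolding essential_def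
  proof (intro conjI allI impI)
    fix J assume J: "ideal J" "J \<noteq> {0}"
    then obtain j where j: "j \<in> J" "j \<noteq> 0" using idealD(2)[OF J(1)] by blast
    show "I \<inter> J \<noteq> {0}"
    proof (cases "e * j = 0")
      case True
      then show ?thesis using N[of j] j idealD(1)[OF J(1)] by blast
    next
      case False
      from primeE[OF V_closed(7) z(2) False z(3)] obtain r where r: "r \<in> A" "e * j * r * z \<noteq> 0" .
      then have "j * r * z \<noteq> 0" by (metis mult.assoc mult_zero_right)
      moreover have "j * r * z \<in> J" using idealD(4)[OF J(1)] j(1) r(1) z(1) by blast
      moreover have "j * r * z \<in> I"
        using idealD(5)[OF I \<open>z \<in> I\<close> mult_closed[OF _ r(1)]] j(1) idealD(1)[OF J(1)] by blast
      ultimately show ?thesis by blast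
    qed
  qed (rule I)
  then have "y \<in> multipliers" by (auto simp: multipliers_def I_def)
  then show ?thesis using ad by (auto simp: inner_part_def)
qed

text \<open>An idempotent over which the derivation is not inner splits, and one of its two parts is
  again of this kind.\<close>

theorem inner_of_gpi:
  assumes chain: "\<And>E :: nat \<Rightarrow> 'q. (\<And>n. E n \<in> ring_centre) \<Longrightarrow> (\<And>n. E n * E n = E n) \<Longrightarrow>
      (\<And>n. E n * E (Suc n) = E (Suc n)) \<Longrightarrow> \<exists>n. E (Suc n) = E n"
    and f: "\<And>c. c \<in> ring_centre \<Longrightarrow> c \<noteq> 0 \<Longrightarrow> gp_coef c * f \<noteq> 0"
    and vanish: "\<forall>\<phi> :: 'q gen_poly \<Rightarrow> 'q. is_ring_hom \<phi> \<and> \<phi> ` range gp_indet \<subseteq> A \<and>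
      (\<forall>q. \<phi> (gp_coef q) = q) \<longrightarrow> \<phi> f = 0"
  shows "\<exists>q\<in>multipliers. \<forall>r\<in>A. \<delta> r = r * q - q * r"
proof (rule ccontr)
  assume no: "\<not> ?thesis"
  define bad where "bad e \<longleftrightarrow> e \<in> ring_centre \<and> e * e = e \<and> \<not> inner_part e" for e
  have "bad 1" using no by (auto simp: bad_def inner_part_def ring_centre_def)
  have step: "\<exists>e'. bad e' \<and> e * e' = e' \<and> e' \<noteq> e" if e: "bad e" for e
  proof -
    have ec: "e \<in> ring_centre" "e * e = e" using e by (auto simp: bad_def)
    have "e \<noteq> 0" using e inner_part_zero by (auto simp: bad_def)
    then obtain g where g: "g \<in> ring_centre" "g * g = g" "e * g \<noteq> 0" "e * g \<noteq> e"
      using inner_part_primitive[OF ec _ _ f vanish] ec e by (auto simp: bad_def)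
    have comm: "q * e = e * q" "q * g = g * q" for q using ec(1) g(1) by (auto simp: ring_centre_def)
    define h where "h = e * g"
    have h: "h \<in> ring_centre" "h * h = h" "e * h = h" "h * e = h"
    proof -
      show "h \<in> ring_centre" unfolding h_def by (rule ring_centre_closed(4)[OF ec(1) g(1)])
      show "e * h = h" using ec(2) by (simp add: h_def flip: mult.assoc)
      then show "h * e = h" using comm(1)[of h] by simp
      have "g * h = e * (g * g)" using comm(1)[of g] by (simp add: h_def flip: mult.assoc)
      then show "h * h = h" using \<open>e * h = h\<close> g(2) by (simp add: h_def mult.assoc)
    qed
    have h': "e - h \<in> ring_centre" "(e - h) * (e - h) = e - h" "e * (e - h) = e - h"
      using ring_centre_closed(2)[OF ec(1) h(1)] ec(2) h
      by (simp_all add: left_diff_distrib right_diff_distrib)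
    have "inner_part e" if "inner_part h" "inner_part (e - h)" using inner_part_add[OF that] by simp
    then consider "\<not> inner_part h" | "\<not> inner_part (e - h)" using e by (auto simp: bad_def)
    then show ?thesis
    proof cases
      case 1
      then show ?thesis using h g(4) by (intro exI[of _ h]) (auto simp: bad_def h_def)
    next
      case 2
      then show ?thesis using h' g(3) by (intro exI[of _ "e - h"]) (auto simp: bad_def h_def)
    qed
  qed
  \<comment> \<open>Repeated splitting would give a strictly decreasing sequence of idempotents,
    starting from the assumed failure at 1.\<close>
  have "\<exists>E. \<forall>n::nat. bad (E n) \<and> (E n * E (Suc n) = E (Suc n) \<and> E (Suc n) \<noteq> E n)"
    by (rule dependent_nat_choice) (use \<open>bad 1\<close> step in blast)+
  then obtain E :: "nat \<Rightarrow> 'q" where E: "\<And>n. bad (E n)" "\<And>n. E n * E (Suc n) = E (Suc n)" "\<And>n. E (Suc n) \<noteq> E n"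
    by blast
  then show False using chain[of E] by (auto simp: bad_def)
qed

end

section \<open>The Utumi ring of quotients\<close>

lemma utumi_cases:
  obtains J f where "partial_right_hom (J, f)" "q = abs_utumi (J, f)"
  using Quotient_abs_rep[OF Quotient_utumi, of q] Quotient_rep_reflp[OF Quotient_utumi, of q]
  by (cases "rep_utumi q") (auto simp: utumi_rel_self)

text \<open>The bridge between the two pictures: a representing map on its domain is left
  multiplication by its class.\<close>

lemma utumi_times_embed:
  assumes f: "partial_right_hom (J, f)" and x: "x \<in> J"
  shows "abs_utumi (J, f) * utumi_embed x = utumi_embed (f x)"
proof -
  have g: "partial_right_hom (UNIV, \<lambda>y. x * y)" by (rule partial_right_hom_left_mult)
  have xy: "x * y \<in> J" "f (x * y) = f x * y" for y
    using partial_right_homD(2,4)[OF f] right_idealD(3) x by blast+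
  have "abs_utumi (J, f) * utumi_embed x = abs_utumi ({y \<in> UNIV. x * y \<in> J}, \<lambda>y. f (x * y))"
    unfolding utumi_embed_def
    by (subst times_utumi.abs_eq) (use f g in \<open>auto simp: utumi_rel_self\<close>)
  then show ?thesis by (simp add: xy utumi_embed_def)
qed

lemma utumi_embed_zero [simp]: "utumi_embed 0 = 0"
  using utumi_embed_hom(1)[of 0 0] by simp

lemma utumi_embed_diff: "utumi_embed (x - y) = utumi_embed x - utumi_embed y"
  using utumi_embed_hom(1)[of "x - y" y] by (simp add: algebra_simps)

lemma utumi_embed_sum: "utumi_embed (\<Sum>i\<in>S. f i) = (\<Sum>i\<in>S. utumi_embed (f i))"
  by (induction S rule: infinite_finite_induct) (auto simp: utumi_embed_hom)

text \<open>A nonzero class cannot vanish on the intersection of the two domains, and a point of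
  that intersection serves as \<open>r\<close>.\<close>

lemma utumi_dense:
  fixes p q :: "'a::ring utumi"
  assumes ann: "\<And>x::'a. (\<And>r. x * r = 0) \<Longrightarrow> x = 0" and q: "q \<noteq> 0"
  obtains r where "q * utumi_embed r \<noteq> 0" "p * utumi_embed r \<in> range utumi_embed"
proof -
  obtain J f where f: "partial_right_hom (J, f)" "q = abs_utumi (J, f)" by (rule utumi_cases)
  obtain L g where g: "partial_right_hom (L, g)" "p = abs_utumi (L, g)" by (rule utumi_cases)
  have JL: "quotient_domain (J \<inter> L)"
    using quotient_domain_Int partial_right_homD(1) f(1) g(1) by blast
  have "\<exists>x\<in>J \<inter> L. f x \<noteq> 0"
  proof (rule ccontr)
    assume "\<not> ?thesis"
    then have "utumi_rel (J, f) (UNIV, \<lambda>x. 0)"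
      using JL by (intro utumi_relI[OF f(1) partial_right_hom_zero]) auto
    then have "q = 0"
      using abs_utumi_eq_iff[OF f(1) partial_right_hom_zero] f(2) by (simp add: zero_utumi.abs_eq)
    then show False using q by simp
  qed
  then obtain x where x: "x \<in> J" "x \<in> L" "f x \<noteq> 0" by blast
  have "utumi_embed (f x) \<noteq> utumi_embed 0" using x(3) by (simp add: inj_eq[OF utumi_embed_inj[OF ann]] del: utumi_embed_zero)
  then show thesis using that[of x] utumi_times_embed[OF f(1) x(1)] utumi_times_embed[OF g(1) x(2)]
    by (auto simp: f(2) g(2))
qed

text \<open>\<open>A\<close> need not have a unit, so \<open>a\<close> itself may be missing from
  the ideal spanned by the \<open>r * a * s\<close>. That ideal has square zero and vanishes; then
  every \<open>r * a\<close> has zero products on the right and vanishes too; finally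
  \<open>a\<close> is in the right annihilator of \<open>A\<close>, again an ideal of square
  zero.\<close>

lemma (in assoc_algebra) semiprime_elementwise:
  fixes a :: 'a
  assumes semi: "semiprime_algebra scale" and a: "\<And>r. a * r * a = 0"
  shows "a = 0"
proof -
  let ?T = "{r * a * s | r s. True}"
  let ?I = "span ?T"
  have I: "algebra_ideal scale ?I" unfolding algebra_ideal_def
  proof (intro conjI ballI allI)
    fix x c assume "x \<in> ?I"
    then show "c * x \<in> ?I"
    proof (induction rule: span_induct_alt)
      case (step k x y)
      then obtain r s where "x = r * a * s" by blast
      then have "c * x = (c * r) * a * s" by (simp add: mult.assoc)
      then have "c * x \<in> ?T" by blast
      then show ?case using step
        by (simp add: distrib_left scale_mult_right[symmetric] span_add span_scale span_base)
    qed (simp add: span_zero)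
    show "x * c \<in> ?I" using \<open>x \<in> ?I\<close>
    proof (induction rule: span_induct_alt)
      case (step k x y)
      then obtain r s where "x = r * a * s" by blast
      then have "x * c = r * a * (s * c)" by (simp add: mult.assoc)
      then have "x * c \<in> ?T" by blast
      then show ?case using step
        by (simp add: distrib_right scale_mult_left[symmetric] span_add span_scale span_base)
    qed (simp add: span_zero)
  qed simp
  have zero: "x * y = 0" if x: "x \<in> ?I" and y: "y \<in> ?I" for x y
  proof -
    have xT: "x * t = 0" if "t \<in> ?T" for t
      using x
    proof (induction rule: span_induct_alt)
      case (step k u v)
      obtain r s r' s' where "u = r * a * s" "t = r' * a * s'" using step(1) \<open>t \<in> ?T\<close> by blast
      then have "u * t = r * (a * (s * r') * a) * s'" by (simp add: mult.assoc)
      then have "u * t = 0" using a by simp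
      then show ?case using step by (simp add: distrib_right scale_mult_left[symmetric])
    qed simp
    show ?thesis using y
      by (induction rule: span_induct_alt) (simp_all add: distrib_left scale_mult_right[symmetric] xT)
  qed
  have "{x * y | x y. x \<in> ?I \<and> y \<in> ?I} \<subseteq> {0}" using zero by blast
  then have "ideal_product scale ?I ?I \<subseteq> span {0}" unfolding ideal_product_def by (rule span_mono)
  then have "ideal_product scale ?I ?I = {0}"
    using span_zero by (auto simp: ideal_product_def span_singleton)
  then have I0: "?I = {0}" using semi I by (auto simp: semiprime_algebra_def)
  have "r * a * s = 0" for r s
  proof -
    have "r * a * s \<in> ?I" by (rule span_base) blast
    then show ?thesis unfolding I0 by blast
  qed
  then have ra: "r * a = 0" for r using semiprime_left_annihilator[OF semi, of "r * a"] by simp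
  let ?R = "{x. \<forall>r::'a. r * x = 0}"
  have "subspace ?R" by (auto simp: subspace_def distrib_left scale_mult_right[symmetric])
  then have "algebra_ideal scale ?R" by (simp add: algebra_ideal_def flip: mult.assoc)
  moreover have "{x * y | x y. x \<in> ?R \<and> y \<in> ?R} \<subseteq> {0}" by auto
  then have "ideal_product scale ?R ?R \<subseteq> span {0}" unfolding ideal_product_def by (rule span_mono)
  then have "ideal_product scale ?R ?R = {0}"
    using span_zero by (auto simp: ideal_product_def span_singleton)
  ultimately have "?R = {0}" using semi by (auto simp: semiprime_algebra_def)
  then show ?thesis using ra by blast
qed

lemma (in assoc_algebra) right_quotient_ring_utumi:
  assumes semi: "semiprime_algebra scale"
  shows "right_quotient_ring (range utumi_embed :: 'a utumi set)"
proof
  note ann = semiprime_left_annihilator[OF semi]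
  let ?A = "range utumi_embed :: 'a utumi set"
  have inj: "utumi_embed x = utumi_embed y \<longleftrightarrow> x = y" for x y :: 'a
    by (rule inj_eq[OF utumi_embed_inj[OF ann]])
  show "0 \<in> ?A" by (rule range_eqI[of _ _ 0]) simp
  fix x y :: "'a utumi"
  { assume "x \<in> ?A" "y \<in> ?A"
    then obtain a b where "x = utumi_embed a" "y = utumi_embed b" by blast
    then have "x - y = utumi_embed (a - b)" "x * y = utumi_embed (a * b)"
      by (simp_all add: utumi_embed_diff utumi_embed_hom)
    then show "x - y \<in> ?A" "x * y \<in> ?A" by blast+ }
  { assume "x \<noteq> 0"
    then show "\<exists>r\<in>?A. x * r \<noteq> 0 \<and> y * r \<in> ?A" using utumi_dense[OF ann, of x y] by blast }
  { assume x: "x \<in> ?A" "\<And>r. r \<in> ?A \<Longrightarrow> x * r * x = 0"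
    then obtain a where a: "x = utumi_embed a" by blast
    have "utumi_embed (a * r * a) = utumi_embed 0" for r
      using x(2)[of "utumi_embed r"] by (simp add: a utumi_embed_hom)
    then have "a = 0" using semiprime_elementwise[OF semi] inj by blast
    then show "x = 0" by (simp add: a) }
next
  note ann = semiprime_left_annihilator[OF semi]
  have inj: "utumi_embed x = utumi_embed y \<longleftrightarrow> x = y" for x y :: 'a
    by (rule inj_eq[OF utumi_embed_inj[OF ann]])
  let ?A = "range utumi_embed :: 'a utumi set"
  fix J :: "'a utumi set" and \<phi>
  assume J: "J \<subseteq> ?A" "0 \<in> J" "\<And>x y. x \<in> J \<Longrightarrow> y \<in> J \<Longrightarrow> x - y \<in> J"
      "\<And>x r. x \<in> J \<Longrightarrow> r \<in> ?A \<Longrightarrow> x * r \<in> J"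
    and dense: "\<And>p q. p \<in> ?A \<Longrightarrow> q \<in> ?A \<Longrightarrow> q \<noteq> 0 \<Longrightarrow> \<exists>r\<in>?A. q * r \<noteq> 0 \<and> p * r \<in> J"
    and \<phi>: "\<And>x. x \<in> J \<Longrightarrow> \<phi> x \<in> ?A" "\<And>x y. x \<in> J \<Longrightarrow> y \<in> J \<Longrightarrow> \<phi> (x + y) = \<phi> x + \<phi> y"
      "\<And>x r. x \<in> J \<Longrightarrow> r \<in> ?A \<Longrightarrow> \<phi> (x * r) = \<phi> x * r"
  \<comment> \<open>Both the dense right ideal and the map are transported back along the embedding
    to obtain a partial homomorphism in the original sense.\<close>
  define J' where "J' = {x. utumi_embed x \<in> J}"
  define f where "f x = inv utumi_embed (\<phi> (utumi_embed x))" for x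
  have f: "utumi_embed (f x) = \<phi> (utumi_embed x)" if "x \<in> J'" for x
    using that \<phi>(1) by (simp add: f_def J'_def f_inv_into_f)
  have "right_ideal J'" using J by (auto simp: right_ideal_def J'_def utumi_embed_diff utumi_embed_hom)
  moreover have "\<exists>r. x * r \<noteq> 0 \<and> y * r \<in> J'" if "x \<noteq> 0" for x y
  proof -
    have "utumi_embed x \<noteq> 0" using that inj[of x 0] by simp
    then obtain r where "utumi_embed x * utumi_embed r \<noteq> 0" "utumi_embed y * utumi_embed r \<in> J"
      using dense by blast
    then have "x * r \<noteq> 0 \<and> y * r \<in> J'" by (auto simp: J'_def simp flip: utumi_embed_hom)
    then show ?thesis ..
  qed
  ultimately have "quotient_domain J'" by (simp add: quotient_domain_def dense_right_ideal_def)
  moreover have "f (x + y) = f x + f y" if "x \<in> J'" "y \<in> J'" for x y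
  proof -
    have "x + y \<in> J'" using right_idealD(5)[OF \<open>right_ideal J'\<close> that] .
    then have "utumi_embed (f (x + y)) = utumi_embed (f x + f y)"
      using that f \<phi>(2) by (simp add: utumi_embed_hom J'_def)
    then show ?thesis by (simp add: inj)
  qed
  moreover have "f (x * r) = f x * r" if "x \<in> J'" for x r
  proof -
    have "x * r \<in> J'" using right_idealD(3)[OF \<open>right_ideal J'\<close> that] .
    then have "utumi_embed (f (x * r)) = utumi_embed (f x * r)"
      using that f \<phi>(3) by (simp add: utumi_embed_hom J'_def)
    then show ?thesis by (simp add: inj)
  qed
  ultimately have hom: "partial_right_hom (J', f)" by (auto simp: partial_right_hom_def)
  show "\<exists>q. \<forall>x\<in>J. q * x = \<phi> x"
  proof (intro exI ballI)
    fix x assume "x \<in> J"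
    then obtain a where "x = utumi_embed a" "a \<in> J'" using J(1) by (auto simp: J'_def)
    then show "abs_utumi (J', f) * x = \<phi> x" using utumi_times_embed[OF hom] f by simp
  qed
qed

section \<open>Essential ideals of the algebra and the symmetric ring of quotients\<close>

context assoc_algebra
begin

abbreviation "emb \<equiv> utumi_embed :: 'a \<Rightarrow> 'a utumi"

lemma algebra_idealD:
  assumes "algebra_ideal scale I"
  shows "0 \<in> I" "x \<in> I \<Longrightarrow> y \<in> I \<Longrightarrow> x + y \<in> I" "x \<in> I \<Longrightarrow> scale \<alpha> x \<in> I"
    "x \<in> I \<Longrightarrow> y \<in> I \<Longrightarrow> x - y \<in> I" "x \<in> I \<Longrightarrow> a * x \<in> I" "x \<in> I \<Longrightarrow> x * a \<in> I"
  using assms by (auto simp: algebra_ideal_def subspace_0 subspace_add subspace_scale subspace_diff)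

lemma algebra_idealI:
  assumes "0 \<in> I" "\<And>x y. x \<in> I \<Longrightarrow> y \<in> I \<Longrightarrow> x + y \<in> I" "\<And>x \<alpha>. x \<in> I \<Longrightarrow> scale \<alpha> x \<in> I"
    "\<And>x a. x \<in> I \<Longrightarrow> a * x \<in> I" "\<And>x a. x \<in> I \<Longrightarrow> x * a \<in> I"
  shows "algebra_ideal scale I"
  using assms by (auto simp: algebra_ideal_def subspace_def)

lemma algebra_ideal_Int:
  "algebra_ideal scale I \<Longrightarrow> algebra_ideal scale J \<Longrightarrow> algebra_ideal scale (I \<inter> J)"
  by (auto simp: algebra_ideal_def subspace_inter)

lemma essential_ideal_Int:
  "essential_ideal scale I \<Longrightarrow> essential_ideal scale J \<Longrightarrow> essential_ideal scale (I \<inter> J)"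
  unfolding essential_ideal_def by (metis algebra_ideal_Int Int_assoc)

lemma algebra_ideal_product:
  assumes I: "algebra_ideal scale I"
  shows "algebra_ideal scale (ideal_product scale I I)"
proof -
  let ?T = "{x * y | x y. x \<in> I \<and> y \<in> I}"
  have left: "a * x \<in> span ?T" and right: "x * a \<in> span ?T" if "x \<in> span ?T" for a x
  proof -
    show "a * x \<in> span ?T" using that
    proof (induction rule: span_induct_alt)
      case (step k x y)
      then obtain u v where "x = u * v" "u \<in> I" "v \<in> I" by blast
      then have "a * x \<in> ?T" using algebra_idealD(5)[OF I] by (auto simp flip: mult.assoc)
      then show ?case using step
        by (simp add: distrib_left scale_mult_right[symmetric] span_add span_scale span_base)
    qed (simp add: span_zero)
    show "x * a \<in> span ?T" using that
    proof (induction rule: span_induct_alt)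
      case (step k x y)
      then obtain u v where "x = u * v" "u \<in> I" "v \<in> I" by blast
      then have "x * a \<in> ?T" using algebra_idealD(6)[OF I] by (auto simp: mult.assoc)
      then show ?case using step
        by (simp add: distrib_right scale_mult_left[symmetric] span_add span_scale span_base)
    qed (simp add: span_zero)
  qed
  then show ?thesis by (simp add: algebra_ideal_def ideal_product_def)
qed

text \<open>For a nonzero ideal \<open>J\<close>, the square of \<open>I \<inter> J\<close> is
  nonzero and lies both in the square of \<open>I\<close> and in \<open>J\<close>.\<close>

lemma essential_ideal_square:
  assumes semi: "semiprime_algebra scale" and I: "essential_ideal scale I"
  shows "essential_ideal scale (ideal_product scale I I)"
  unfolding essential_ideal_def
proof (intro conjI allI impI)
  have aI: "algebra_ideal scale I" using I by (simp add: essential_ideal_def)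
  then show "algebra_ideal scale (ideal_product scale I I)" by (rule algebra_ideal_product)
  fix J assume J: "algebra_ideal scale J \<and> J \<noteq> {0}"
  let ?L = "I \<inter> J"
  have L: "algebra_ideal scale ?L" "?L \<noteq> {0}"
    using I J aI by (auto simp: essential_ideal_def intro: algebra_ideal_Int)
  then have "ideal_product scale ?L ?L \<noteq> {0}" using semi by (simp add: semiprime_algebra_def)
  moreover have "ideal_product scale ?L ?L \<subseteq> ideal_product scale I I"
    unfolding ideal_product_def by (intro span_mono) blast
  moreover have "ideal_product scale ?L ?L \<subseteq> J"
    unfolding ideal_product_def
    using J by (intro span_minimal) (auto simp: algebra_ideal_def)
  moreover have "0 \<in> ideal_product scale ?L ?L" by (simp add: ideal_product_def span_zero)
  ultimately show "ideal_product scale I I \<inter> J \<noteq> {0}" by blast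
qed

lemma essential_ideal_UNIV: "essential_ideal scale UNIV"
  by (auto simp: essential_ideal_def algebra_ideal_def)

text \<open>Since 0 is in \<open>I\<close>, the sums in the definition can be separated into their
  two terms.\<close>

lemma Qsm_iff:
  "q \<in> Qsm scale \<longleftrightarrow>
    (\<exists>I. essential_ideal scale I \<and> (\<forall>x\<in>I. q * emb x \<in> range emb \<and> emb x * q \<in> range emb))"
proof
  assume "q \<in> Qsm scale"
  then obtain I where I: "essential_ideal scale I"
    "{q * emb x + emb y * q | x y. x \<in> I \<and> y \<in> I} \<subseteq> range emb" by (auto simp: Qsm_def)
  have 0: "0 \<in> I" using I(1) algebra_idealD(1) by (auto simp: essential_ideal_def)
  have "q * emb x \<in> range emb \<and> emb x * q \<in> range emb" if x: "x \<in> I" for x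
  proof -
    have "q * emb x + emb 0 * q \<in> range emb" "q * emb 0 + emb x * q \<in> range emb"
      using I(2) x 0 by blast+
    then show ?thesis by simp
  qed
  then show "\<exists>I. essential_ideal scale I \<and> (\<forall>x\<in>I. q * emb x \<in> range emb \<and> emb x * q \<in> range emb)"
    using I(1) by blast
next
  assume "\<exists>I. essential_ideal scale I \<and> (\<forall>x\<in>I. q * emb x \<in> range emb \<and> emb x * q \<in> range emb)"
  then obtain I where I: "essential_ideal scale I"
    "\<And>x. x \<in> I \<Longrightarrow> q * emb x \<in> range emb \<and> emb x * q \<in> range emb" by blast
  have "q * emb x + emb y * q \<in> range emb" if xy: "x \<in> I" "y \<in> I" for x y
  proof -
    obtain u v where "q * emb x = emb u" "emb y * q = emb v" using I(2) xy by blast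
    then have "q * emb x + emb y * q = emb (u + v)" by (simp add: utumi_embed_hom)
    then show ?thesis by blast
  qed
  then show "q \<in> Qsm scale" using I(1) by (auto simp: Qsm_def)
qed

lemma Qsm_embed: "emb a \<in> Qsm scale"
  unfolding Qsm_iff using essential_ideal_UNIV
  by (intro exI[of _ UNIV]) (auto simp flip: utumi_embed_hom)

lemma Qsm_add_diff:
  assumes "p \<in> Qsm scale" "q \<in> Qsm scale"
  shows "p + q \<in> Qsm scale" "p - q \<in> Qsm scale"
proof -
  obtain I where I: "essential_ideal scale I"
    "\<And>x. x \<in> I \<Longrightarrow> p * emb x \<in> range emb \<and> emb x * p \<in> range emb"
    using assms(1) unfolding Qsm_iff by blast
  obtain J where J: "essential_ideal scale J"
    "\<And>x. x \<in> J \<Longrightarrow> q * emb x \<in> range emb \<and> emb x * q \<in> range emb"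
    using assms(2) unfolding Qsm_iff by blast
  have closed: "u + v \<in> range emb" "u - v \<in> range emb" if "u \<in> range emb" "v \<in> range emb" for u v
    using that by (auto simp flip: utumi_embed_hom utumi_embed_diff)
  note IJ = essential_ideal_Int[OF I(1) J(1)]
  show "p + q \<in> Qsm scale" unfolding Qsm_iff
    using I(2) J(2) by (intro exI[of _ "I \<inter> J"] conjI IJ) (simp add: distrib_left distrib_right closed)
  show "p - q \<in> Qsm scale" unfolding Qsm_iff
    using I(2) J(2)
    by (intro exI[of _ "I \<inter> J"] conjI IJ) (simp add: left_diff_distrib right_diff_distrib closed)
qed

text \<open>On a product \<open>u * v\<close> from \<open>M\<close>, the inner factor
  \<open>q\<close> is absorbed by \<open>u\<close> on the right and \<open>p\<close> by
  \<open>v\<close> on the left, leaving an element of the ideal on which the other factor acts.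
  Hence the square of \<open>M\<close>, which is still essential, serves for
  \<open>p * q\<close>.\<close>

lemma Qsm_mult:
  assumes semi: "semiprime_algebra scale" and pq: "p \<in> Qsm scale" "q \<in> Qsm scale"
  shows "p * q \<in> Qsm scale"
proof -
  obtain I where I: "essential_ideal scale I"
    "\<And>x. x \<in> I \<Longrightarrow> p * emb x \<in> range emb \<and> emb x * p \<in> range emb"
    using pq(1) unfolding Qsm_iff by blast
  obtain J where J: "essential_ideal scale J"
    "\<And>x. x \<in> J \<Longrightarrow> q * emb x \<in> range emb \<and> emb x * q \<in> range emb"
    using pq(2) unfolding Qsm_iff by blast
  define M where "M = I \<inter> J"
  have M: "essential_ideal scale M" unfolding M_def by (rule essential_ideal_Int[OF I(1) J(1)])
  have aI: "algebra_ideal scale I" "algebra_ideal scale J"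
    using I J by (auto simp: essential_ideal_def)
  let ?P = "\<lambda>x. p * q * emb x \<in> range emb \<and> emb x * (p * q) \<in> range emb"
  have prod: "?P (u * v)" if uv: "u \<in> M" "v \<in> M" for u v
  proof -
    obtain a where a: "q * emb u = emb a" using J(2) uv by (auto simp: M_def)
    obtain b where b: "emb v * p = emb b" using I(2) uv by (auto simp: M_def)
    have "p * q * emb (u * v) = p * emb (a * v)" by (simp add: utumi_embed_hom mult.assoc flip: a)
    moreover have "emb (u * v) * (p * q) = emb u * (emb v * p) * q" by (simp add: utumi_embed_hom mult.assoc)
    then have "emb (u * v) * (p * q) = emb (u * b) * q" by (simp add: b utumi_embed_hom)
    ultimately show ?thesis
      using I(2)[of "a * v"] J(2)[of "u * b"] uv algebra_idealD(5)[OF aI(1), of v a]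
        algebra_idealD(6)[OF aI(2), of u b] by (simp add: M_def)
  qed
  have "?P x" if "x \<in> ideal_product scale M M" for x
    using that unfolding ideal_product_def
  proof (induction rule: span_induct_alt)
    case base
    then show ?case by (simp add: range_eqI[of _ _ 0])
  next
    case (step k x y)
    then obtain u v where uv: "x = u * v" "u \<in> M" "v \<in> M" by blast
    have "scale k x = scale k u * v" by (simp add: uv scale_mult_left)
    moreover have "scale k u \<in> M"
      using uv(2) M algebra_idealD(3) by (simp add: essential_ideal_def)
    ultimately have "?P (scale k x)" using prod uv(3) by simp
    then obtain a b where "p * q * emb (scale k x) = emb a" "emb (scale k x) * (p * q) = emb b" by blast
    moreover obtain c d where "p * q * emb y = emb c" "emb y * (p * q) = emb d" using step by blast
    ultimately have "p * q * emb (scale k x + y) = emb (a + c)" "emb (scale k x + y) * (p * q) = emb (b + d)"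
      by (simp_all only: utumi_embed_hom distrib_left distrib_right)
    then show ?case by blast
  qed
  then show ?thesis unfolding Qsm_iff using essential_ideal_square[OF semi M] by blast
qed

text \<open>Density moves \<open>t\<close> into \<open>A\<close>, where the left annihilator of
  \<open>I\<close> is an ideal. If nonzero, it would meet \<open>I\<close> in a nonzero element
  \<open>y\<close> with \<open>y A y = 0\<close>.\<close>

lemma essential_annihilator:
  assumes semi: "semiprime_algebra scale" and I: "essential_ideal scale I"
    and t: "\<And>x. x \<in> I \<Longrightarrow> t * emb x = 0"
  shows "t = 0"
proof (rule ccontr)
  note ann = semiprime_left_annihilator[OF semi]
  assume "t \<noteq> 0"
  then obtain r where r: "t * emb r \<noteq> 0" "t * emb r \<in> range emb" using utumi_dense[OF ann] by blast
  then obtain s where s: "t * emb r = emb s" by blast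
  have aI: "algebra_ideal scale I" using I by (simp add: essential_ideal_def)
  let ?L = "{s. \<forall>x\<in>I. s * x = 0}"
  have "emb (s * x) = emb 0" if "x \<in> I" for x
    using t[OF algebra_idealD(5)[OF aI that, of r]] by (simp add: utumi_embed_hom flip: s mult.assoc)
  then have "s \<in> ?L" using inj_eq[OF utumi_embed_inj[OF ann]] by blast
  moreover have "s \<noteq> 0" using r s by auto
  moreover have "algebra_ideal scale ?L"
    by (rule algebra_idealI)
      (auto simp: distrib_right scale_mult_left[symmetric] mult.assoc algebra_idealD(5)[OF aI])
  ultimately have "I \<inter> ?L \<noteq> {0}" using I unfolding essential_ideal_def by blast
  moreover have "0 \<in> I \<inter> ?L" using algebra_idealD(1)[OF aI] by simp
  ultimately obtain y where y: "y \<in> I" "y \<in> ?L" "y \<noteq> 0" by blast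
  have "y * r * y = 0" for r using y(2) algebra_idealD(5)[OF aI y(1), of r] by (simp add: mult.assoc)
  then show False using semiprime_elementwise[OF semi] y(3) by blast
qed

text \<open>The definite description needs uniqueness: an element \<open>p\<close> sends an
  essential ideal into \<open>A\<close>, where two extensions agree, so by the Leibniz rule their
  difference at \<open>p\<close> annihilates that ideal.\<close>

lemma Der_extension_eqI:
  assumes semi: "semiprime_algebra scale" and D: "D \<in> Der scale" and q: "q \<in> Qsm scale"
    and inner: "\<And>x. emb (D x) = emb x * q - q * emb x"
  shows "Der_extension scale D = (\<lambda>x\<in>Qsm scale. x * q - q * x)"
  unfolding Der_extension_def
proof (rule the_equality)
  note ann = semiprime_left_annihilator[OF semi]
  let ?\<delta> = "\<lambda>x\<in>Qsm scale. x * q - q * x"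
  have central: "utumi_scalar scale \<alpha> * p = p * utumi_scalar scale \<alpha>" for \<alpha> p
    using utumi_scalar_central[OF ann] by (simp add: extended_centroid_def ring_centre_def)
  have scalar: "utumi_scale scale \<alpha> p \<in> Qsm scale" if p: "p \<in> Qsm scale" for \<alpha> p
  proof -
    obtain I where I: "essential_ideal scale I"
      "\<And>x. x \<in> I \<Longrightarrow> p * emb x \<in> range emb \<and> emb x * p \<in> range emb"
      using p unfolding Qsm_iff by blast
    have "utumi_scale scale \<alpha> p * emb x \<in> range emb \<and> emb x * utumi_scale scale \<alpha> p \<in> range emb"
      if x: "x \<in> I" for x
    proof -
      have "utumi_scale scale \<alpha> p * emb x = utumi_scale scale \<alpha> (p * emb x)"
        "emb x * utumi_scale scale \<alpha> p = utumi_scale scale \<alpha> (emb x * p)"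
        by (simp_all add: utumi_scale_def mult.assoc) (metis central mult.assoc)
      then show ?thesis using I(2)[OF x] utumi_scale_embed by auto
    qed
    then show ?thesis unfolding Qsm_iff using I(1) by blast
  qed
  have "?\<delta> \<in> Der_Qsm scale" unfolding Der_Qsm_def
  proof (intro CollectI conjI ballI allI)
    show "?\<delta> \<in> Qsm scale \<rightarrow>\<^sub>E Qsm scale"
      using q by (auto intro!: Qsm_add_diff Qsm_mult[OF semi])
    fix p assume p: "p \<in> Qsm scale"
    show "?\<delta> (utumi_scale scale \<alpha> p) = utumi_scale scale \<alpha> (?\<delta> p)" for \<alpha>
    proof -
      have "q * (utumi_scalar scale \<alpha> * p) = utumi_scalar scale \<alpha> * (q * p)"
        using central by (metis mult.assoc)
      then show ?thesis using p scalar[OF p]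
        by (simp add: utumi_scale_def right_diff_distrib mult.assoc)
    qed
    fix p' assume p': "p' \<in> Qsm scale"
    show "?\<delta> (p + p') = ?\<delta> p + ?\<delta> p'" "?\<delta> (p * p') = ?\<delta> p * p' + p * ?\<delta> p'"
      using p p' Qsm_add_diff(1)[OF p p'] Qsm_mult[OF semi p p']
      by (simp_all add: algebra_simps)
  qed
  moreover have "?\<delta> (emb x) = emb (D x)" for x using inner Qsm_embed by simp
  ultimately show *: "?\<delta> \<in> Der_Qsm scale \<and> (\<forall>x. ?\<delta> (emb x) = emb (D x))" by blast
  fix \<delta> assume \<delta>: "\<delta> \<in> Der_Qsm scale \<and> (\<forall>x. \<delta> (emb x) = emb (D x))"
  show "\<delta> = ?\<delta>"
  proof (rule extensionalityI[of _ "Qsm scale"])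
    show "\<delta> \<in> extensional (Qsm scale)" using \<delta> by (auto simp: Der_Qsm_def PiE_def)
    fix p assume p: "p \<in> Qsm scale"
    then obtain I where I: "essential_ideal scale I" "\<And>x. x \<in> I \<Longrightarrow> p * emb x \<in> range emb"
      unfolding Qsm_iff by blast
    have mult: "\<epsilon> (p * emb x) = \<epsilon> p * emb x + p * \<epsilon> (emb x)" if "\<epsilon> \<in> Der_Qsm scale" for \<epsilon> x
      using that p Qsm_embed[of x] by (auto simp: Der_Qsm_def)
    have "(\<delta> p - ?\<delta> p) * emb x = 0" if x: "x \<in> I" for x
    proof -
      obtain y where y: "p * emb x = emb y" using I(2)[OF x] by blast
      have "\<delta> p * emb x + p * emb (D x) = ?\<delta> p * emb x + p * emb (D x)"
        using mult[of \<delta> x] mult[of ?\<delta> x] \<delta> * y by metis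
      then show ?thesis by (simp only: left_diff_distrib add_right_cancel) simp
    qed
    then have "\<delta> p - ?\<delta> p = 0" by (rule essential_annihilator[OF semi I(1)])
    then show "\<delta> p = ?\<delta> p" by simp
  qed simp
qed

lemma quotient_derivation_utumi:
  assumes semi: "semiprime_algebra scale" and tf: "torsion_free TYPE('a)"
    and integral: "extended_centroid_integral scale" and D: "D \<in> Der scale"
  obtains \<delta> where "quotient_derivation (range emb) (range (utumi_scalar scale)) \<delta>"
    "\<And>x. \<delta> (emb x) = emb (D x)"
proof -
  note ann = semiprime_left_annihilator[OF semi]
  note inj = utumi_embed_inj[OF ann]
  interpret right_quotient_ring "range emb" by (rule right_quotient_ring_utumi[OF semi])
  have hom: "module_hom scale scale D" and D_mult: "\<And>x y. D (x * y) = D x * y + x * D y"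
    using D by (auto simp: Der_def)
  interpret D: module_hom scale scale D by (rule hom)
  define d where "d x = emb (D (inv emb x))" for x
  have d: "d (emb x) = emb (D x)" for x by (simp add: d_def inv_f_f[OF inj])
  have d_add: "d (x + y) = d x + d y" and d_mult: "d (x * y) = d x * y + x * d y"
    if "x \<in> range emb" "y \<in> range emb" for x y
  proof -
    obtain a b where ab: "x = emb a" "y = emb b" using \<open>x \<in> _\<close> \<open>y \<in> _\<close> by blast
    show "d (x + y) = d x + d y"
      unfolding ab utumi_embed_hom(1)[symmetric] d by (simp add: D.add utumi_embed_hom)
    show "d (x * y) = d x * y + x * d y"
      unfolding ab utumi_embed_hom(2)[symmetric] d by (simp add: D_mult utumi_embed_hom)
  qed
  have d_closed: "d x \<in> range emb" for x by (simp add: d_def)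
  from extend_derivation[of d, OF d_add d_mult d_closed]
  obtain \<delta> where \<delta>: "\<And>p q. \<delta> (p + q) = \<delta> p + \<delta> q" "\<And>p q. \<delta> (p * q) = \<delta> p * q + p * \<delta> q"
    "\<And>x. x \<in> range emb \<Longrightarrow> \<delta> x = d x"
    "\<And>q x. x \<in> range emb \<Longrightarrow> q * x \<in> range emb \<Longrightarrow> \<delta> q * x = d (q * x) - q * d x"
    by metis
  have scalar_emb: "utumi_scalar scale \<alpha> * emb x = emb (scale \<alpha> x)" for \<alpha> x
    using utumi_scale_embed by (simp add: utumi_scale_def)
  have "quotient_derivation (range emb) (range (utumi_scalar scale)) \<delta>"
  proof
    show "\<delta> (p + q) = \<delta> p + \<delta> q" "\<delta> (p * q) = \<delta> p * q + p * \<delta> q" for p q by fact+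
    show "\<delta> x \<in> range emb" if "x \<in> range emb" for x using \<delta>(3)[OF that] by (simp add: d_def)
    show "\<alpha> + \<beta> \<in> range (utumi_scalar scale)"
      if "\<alpha> \<in> range (utumi_scalar scale)" "\<beta> \<in> range (utumi_scalar scale)" for \<alpha> \<beta>
      using that by (auto simp flip: utumi_scalar_hom)
    fix \<alpha> assume "\<alpha> \<in> range (utumi_scalar scale)"
    then obtain k where k: "\<alpha> = utumi_scalar scale k" by blast
    show "\<alpha> \<in> ring_centre" using utumi_scalar_central[OF ann] by (simp add: k extended_centroid_def)
    \<comment> \<open>Linearity of \<open>D\<close> over the scalars gives
      \<open>d (\<alpha> * r) = \<alpha> * d r\<close>, so \<open>\<delta> \<alpha>\<close>
      annihilates \<open>A\<close>.\<close>
    show "\<delta> \<alpha> = 0"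
    proof (rule eq_zeroI[of 0])
      fix r assume "r \<in> range emb"
      then obtain x where x: "r = emb x" by blast
      have "\<alpha> * r \<in> range emb" by (simp add: x k scalar_emb)
      then have "\<delta> \<alpha> * r = d (\<alpha> * r) - \<alpha> * d r" by (intro \<delta>(4)) (auto simp: x)
      then show "\<delta> \<alpha> * r = 0" by (simp add: x k scalar_emb d D.scale)
    qed
  next
    fix c :: "'a utumi" assume "c \<in> ring_centre"
    then obtain p where p: "monic_without_constant p"
      "(\<Sum>i\<le>degree p. utumi_scale scale (coeff p i) (c ^ i)) = 0"
      using integral by (auto simp: extended_centroid_integral_def extended_centroid_def)
    then show "\<exists>n \<alpha>. (\<forall>i. \<alpha> i \<in> range (utumi_scalar scale)) \<and> \<alpha> n = 1 \<and> (\<Sum>i\<le>n. \<alpha> i * c ^ i) = 0"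
      by (intro exI[of _ "degree p"] exI[of _ "\<lambda>i. utumi_scalar scale (coeff p i)"])
        (auto simp: monic_without_constant_def utumi_scale_def utumi_scalar_hom)
  next
    fix n :: nat and x assume n: "n > 0" and x: "x \<in> range emb" "(\<Sum>i<n. x) = 0"
    then obtain a where a: "x = emb a" by blast
    then have "emb (\<Sum>i<n. a) = emb 0" using x(2) by (simp only: utumi_embed_sum utumi_embed_zero)
    then have "(\<Sum>i<n. a) = 0" using inj by (simp only: inj_eq)
    then have "a = 0" using tf n unfolding torsion_free_def by blast
    then show "x = 0" by (simp add: a)
  qed
  then show thesis using that[of \<delta>] \<delta>(3) d by simp
qed

text \<open>A strictly decreasing chain gives nonzero orthogonal differences \<open>g n\<close>,
  each with a nonzero element of \<open>A\<close> below it. Annihilators in \<open>A\<close> of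
  central elements are ideals, and these elements distinguish them in a way that each of the three
  conditions forbids.\<close>

lemma central_idempotent_chain:
  fixes E :: "nat \<Rightarrow> 'a utumi"
  assumes semi: "semiprime_algebra scale"
    and cond: "prime_algebra scale \<or> weakly_Noetherian scale \<or> finitely_cogenerated scale"
    and E: "\<And>n. E n \<in> ring_centre" "\<And>n. E n * E n = E n" "\<And>n. E n * E (Suc n) = E (Suc n)"
  shows "\<exists>n. E (Suc n) = E n"
proof (rule ccontr)
  assume no: "\<not> ?thesis"
  note ann = semiprime_left_annihilator[OF semi]
  note inj = inj_eq[OF utumi_embed_inj[OF ann]]
  have comm: "p * E n = E n * p" for p n using E(1) by (simp add: ring_centre_def)
  have le: "E i * E n = E n" if "i \<le> n" for i n
    using that
  proof (induction n rule: dec_induct)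
    case (step n)
    have "E i * E (Suc n) = E i * E n * E (Suc n)" by (simp add: mult.assoc E(3))
    then show ?case by (simp add: step E(3))
  qed (rule E(2))
  define g where "g n = E n - E (Suc n)" for n
  have g0: "g n \<noteq> 0" for n using no unfolding g_def by (metis right_minus_eq)
  have Eg: "E i * g n = g n" if "i \<le> n" for i n
    using le[of i n] le[of i "Suc n"] that by (simp add: g_def right_diff_distrib)
  have Eg0: "E (Suc n) * g n = 0" for n
    using comm[of "E (Suc n)" n] E(2,3) by (simp add: g_def right_diff_distrib)
  have gcomm: "p * g n = g n * p" for p n
    by (simp add: g_def right_diff_distrib left_diff_distrib comm)
  have gg: "g i * g n = 0" if "i < n" for i n
    using Eg[of i n] Eg[of "Suc i" n] that by (simp add: g_def[of i] left_diff_distrib)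
  have element: "\<exists>x r. x \<noteq> 0 \<and> emb x = g n * emb r" for n
  proof -
    obtain r where r: "g n * emb r \<noteq> 0" "g n * emb r \<in> range emb" using utumi_dense[OF ann g0] by blast
    then show ?thesis by (metis imageE utumi_embed_zero)
  qed
  have ideal: "algebra_ideal scale {x. \<forall>c\<in>S. c * emb x = 0}" if S: "S \<subseteq> ring_centre" for S
  proof (rule algebra_idealI)
    fix x a \<alpha> assume x: "x \<in> {x. \<forall>c\<in>S. c * emb x = 0}"
    have "c * emb (scale \<alpha> x) = utumi_scalar scale \<alpha> * (c * emb x)" if "c \<in> S" for c
    proof -
      have "emb (scale \<alpha> x) = utumi_scalar scale \<alpha> * emb x"
        using utumi_scale_embed[of \<alpha> x] by (simp add: utumi_scale_def)
      moreover have "c * utumi_scalar scale \<alpha> = utumi_scalar scale \<alpha> * c"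
        using S that by (auto simp: ring_centre_def)
      ultimately show ?thesis by (metis mult.assoc)
    qed
    then show "scale \<alpha> x \<in> {x. \<forall>c\<in>S. c * emb x = 0}" using x by simp
    have "c * emb (a * x) = emb a * (c * emb x)" if "c \<in> S" for c
    proof -
      have "c * emb a = emb a * c" using S that by (auto simp: ring_centre_def)
      then show ?thesis by (simp only: utumi_embed_hom mult.assoc[symmetric])
    qed
    then show "a * x \<in> {x. \<forall>c\<in>S. c * emb x = 0}" using x by simp
    show "x * a \<in> {x. \<forall>c\<in>S. c * emb x = 0}" using x by (simp add: utumi_embed_hom flip: mult.assoc)
  qed (auto simp: utumi_embed_hom distrib_left)
  have g_central: "g n \<in> ring_centre" for n unfolding g_def by (intro ring_centre_closed E(1))
  from cond consider "prime_algebra scale" | "weakly_Noetherian scale" | "finitely_cogenerated scale" by blast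
  then show False
  proof cases
    case 1
    \<comment> \<open>\<open>E 1\<close> is chosen because \<open>E 0\<close> may be the unit:
      \<open>g 0\<close> and \<open>g 1\<close> witness that the annihilators of \<open>E 1\<close>
      and of \<open>1 - E 1\<close> are both nonzero.\<close>
    let ?I = "{x. \<forall>c\<in>{E 1}. c * emb x = 0}" and ?J = "{x. \<forall>c\<in>{1 - E 1}. c * emb x = 0}"
    have one: "1 - E 1 \<in> ring_centre"
      by (intro ring_centre_closed E(1)) (simp add: ring_centre_def)
    obtain x r where x: "x \<noteq> 0" "emb x = g 0 * emb r" using element by blast
    obtain y s where y: "y \<noteq> 0" "emb y = g 1 * emb s" using element by blast
    have "x \<in> ?I" using Eg0[of 0] by (simp add: x(2) flip: mult.assoc)
    moreover have "y \<in> ?J" using Eg[of 1 1] by (simp add: y(2) left_diff_distrib flip: mult.assoc)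
    moreover have "algebra_ideal scale ?I" "algebra_ideal scale ?J"
      by (rule ideal, use E(1) one in simp)+
    ultimately have nz: "ideal_product scale ?I ?J \<noteq> {0}"
      using 1 x(1) y(1) unfolding prime_algebra_def by blast
    have "u * v = 0" if "u \<in> ?I" "v \<in> ?J" for u v
    proof -
      have "emb v = E 1 * emb v" using that(2) by (simp add: left_diff_distrib)
      then have "emb (u * v) = emb u * E 1 * emb v" by (metis utumi_embed_hom(2) mult.assoc)
      also have "\<dots> = emb 0" using that(1) comm[of "emb u" 1] by simp
      finally show ?thesis by (simp only: inj)
    qed
    then have "{x * y | x y. x \<in> ?I \<and> y \<in> ?J} \<subseteq> {0}" by blast
    then have "ideal_product scale ?I ?J \<subseteq> span {0}" unfolding ideal_product_def by (rule span_mono)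
    then show False using nz span_zero by (auto simp: ideal_product_def span_singleton)
  next
    case 2
    let ?I = "\<lambda>n. {x. \<forall>c\<in>{E n}. c * emb x = 0}"
    have "?I n \<subseteq> ?I (Suc n)" for n
    proof
      fix x assume "x \<in> ?I n"
      moreover have "E (Suc n) * emb x = E (Suc n) * (E n * emb x)"
        using comm[of "E (Suc n)" n] E(3)[of n] by (simp flip: mult.assoc)
      ultimately show "x \<in> ?I (Suc n)" by simp
    qed
    moreover have "algebra_ideal scale (?I n)" for n by (rule ideal) (use E(1) in simp)
    ultimately obtain N where N: "\<forall>n\<ge>N. ?I n = ?I N"
      using 2[unfolded weakly_Noetherian_def, rule_format, of ?I] by blast
    obtain x r where x: "x \<noteq> 0" "emb x = g N * emb r" using element by blast
    have "x \<in> ?I (Suc N)" using Eg0[of N] by (simp add: x(2) flip: mult.assoc)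
    moreover have "?I (Suc N) = ?I N" using N by (meson le_SucI order_refl)
    ultimately have "x \<in> ?I N" by (simp only:)
    then have "E N * emb x = 0" by simp
    moreover have "E N * emb x = emb x" using Eg[of N N] by (simp add: x(2) flip: mult.assoc)
    ultimately show False using x(1) inj[of x 0] by simp
  next
    case 3
    \<comment> \<open>The ideals \<open>J n\<close> decrease, but their intersection
      \<open>Z\<close> may be nonzero; adding its left annihilator \<open>R\<close> makes the
      intersection zero. An element below \<open>g N\<close> lies in \<open>R\<close> and in every
      \<open>J n\<close> with \<open>n \<le> N\<close>, so no finite subfamily has intersection
      zero.\<close>
    define J where "J n = {x. \<forall>c\<in>g ` {..<n}. c * emb x = 0}" for n
    define Z where "Z = {x. \<forall>c\<in>range g. c * emb x = 0}"
    define R where "R = {y. \<forall>x\<in>Z. y * x = 0}"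
    have J: "algebra_ideal scale (J n)" for n unfolding J_def by (rule ideal) (use g_central in auto)
    have Z: "algebra_ideal scale Z" unfolding Z_def by (rule ideal) (use g_central in auto)
    have R: "algebra_ideal scale R" unfolding R_def
      by (rule algebra_idealI)
        (auto simp: distrib_right scale_mult_left[symmetric] mult.assoc algebra_idealD(5)[OF Z])
    have "\<Inter>(insert R (range J)) \<subseteq> {0}"
    proof
      fix y assume y: "y \<in> \<Inter>(insert R (range J))"
      then have "y \<in> J n" for n by blast
      then have "y \<in> Z" by (fastforce simp: Z_def J_def)
      then have "y * r * y = 0" for r
        using y algebra_idealD(5)[OF Z, of y r] by (simp add: R_def mult.assoc)
      then have "y = 0" by (rule semiprime_elementwise[OF semi])
      then show "y \<in> {0}" by simp
    qed
    moreover have "0 \<in> \<Inter>(insert R (range J))"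
      using algebra_idealD(1)[OF R] algebra_idealD(1)[OF J] by simp
    ultimately have "\<Inter>(insert R (range J)) = {0}" by blast
    moreover have "\<forall>I\<in>insert R (range J). algebra_ideal scale I" using J R by blast
    ultimately have "\<exists>\<J>\<subseteq>insert R (range J). finite \<J> \<and> \<Inter>\<J> = {0}"
      by (intro 3[unfolded finitely_cogenerated_def, rule_format] conjI)
    then obtain \<J> where \<J>: "\<J> \<subseteq> insert R (range J)" "finite \<J>" "\<Inter>\<J> = {0}" by (elim exE conjE)
    then have "finite (\<J> - {R})" "\<J> - {R} \<subseteq> range J" by auto
    from finite_subset_image[OF this] obtain M where M: "finite M" "\<J> - {R} = J ` M" by blast
    obtain N where N: "\<And>n. n \<in> M \<Longrightarrow> n \<le> N" using M(1) finite_nat_set_iff_bounded_le by auto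
    obtain x r where x: "x \<noteq> 0" "emb x = g N * emb r" using element by blast
    have "x \<in> J n" if "n \<le> N" for n
      using gg that by (auto simp: J_def x(2) simp flip: mult.assoc)
    moreover have "x \<in> R" unfolding R_def
    proof (intro CollectI ballI)
      fix z assume "z \<in> Z"
      then have "emb (x * z) = emb r * (g N * emb z)"
        using gcomm[of "emb r" N] by (simp add: utumi_embed_hom x(2) flip: mult.assoc)
      also have "\<dots> = emb 0" using \<open>z \<in> Z\<close> by (simp add: Z_def)
      finally show "x * z = 0" by (simp only: inj)
    qed
    ultimately have "x \<in> \<Inter>\<J>" using M(2) N by blast
    then show False using \<J>(3) x(1) by simp
  qed
qed

text \<open>The ideal witnessing that \<open>q\<close> is a multiplier need not be closed under
  scalars, so it is replaced by the set of all \<open>x\<close> that \<open>q\<close> multiplies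
  into \<open>A\<close> from both sides. This is an algebra ideal because commutators of
  \<open>q\<close> with \<open>A\<close> lie in \<open>A\<close>, and it meets every nonzero algebra
  ideal because the witnessing ideal does.\<close>

lemma multipliers_Qsm:
  assumes semi: "semiprime_algebra scale"
    and q: "q \<in> right_quotient_ring.multipliers (range emb)"
    and inner: "\<And>x. emb (D x) = emb x * q - q * emb x"
  shows "q \<in> Qsm scale"
proof -
  interpret right_quotient_ring "range emb" by (rule right_quotient_ring_utumi[OF semi])
  note ann = semiprime_left_annihilator[OF semi]
  obtain I where I: "essential I" "\<And>x. x \<in> I \<Longrightarrow> q * x \<in> range emb \<and> x * q \<in> range emb"
    using q by (auto simp: multipliers_def)
  let ?M = "{x. q * emb x \<in> range emb \<and> emb x * q \<in> range emb}"
  have central: "utumi_scalar scale \<alpha> * p = p * utumi_scalar scale \<alpha>" for \<alpha> p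
    using utumi_scalar_central[OF ann] by (simp add: extended_centroid_def ring_centre_def)
  have closed: "u + v \<in> range emb" "u - v \<in> range emb" "u * v \<in> range emb"
    if "u \<in> range emb" "v \<in> range emb" for u v
    using that by (auto simp flip: utumi_embed_hom utumi_embed_diff)
  have scalar_closed: "utumi_scalar scale \<alpha> * u \<in> range emb" if "u \<in> range emb" for u \<alpha>
    using that utumi_scale_embed[of \<alpha>] by (auto simp: utumi_scale_def)
  have "algebra_ideal scale ?M"
  proof (rule algebra_idealI)
    fix x a assume x: "x \<in> ?M"
    have "q * emb (a * x) = emb a * (q * emb x) - emb (D a) * emb x"
      by (simp add: inner utumi_embed_hom left_diff_distrib mult.assoc)
    moreover have "emb (a * x) * q = emb a * (emb x * q)" by (simp add: utumi_embed_hom mult.assoc)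
    ultimately show "a * x \<in> ?M" using x by (simp add: closed)
    have "emb (x * a) * q = (emb x * q) * emb a + emb x * emb (D a)"
      by (simp add: inner utumi_embed_hom right_diff_distrib mult.assoc)
    moreover have "q * emb (x * a) = (q * emb x) * emb a" by (simp add: utumi_embed_hom mult.assoc)
    ultimately show "x * a \<in> ?M" using x by (simp add: closed)
    show "scale \<alpha> x \<in> ?M" for \<alpha>
    proof -
      have s: "emb (scale \<alpha> x) = utumi_scalar scale \<alpha> * emb x"
        using utumi_scale_embed[of \<alpha> x] by (simp add: utumi_scale_def)
      have "q * emb (scale \<alpha> x) = utumi_scalar scale \<alpha> * (q * emb x)"
        unfolding s by (metis central mult.assoc)
      moreover have "emb (scale \<alpha> x) * q = utumi_scalar scale \<alpha> * (emb x * q)"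
        by (simp add: s mult.assoc)
      ultimately show ?thesis using x by (simp add: scalar_closed)
    qed
  next
    show "0 \<in> ?M" by simp
    show "x + y \<in> ?M" if "x \<in> ?M" "y \<in> ?M" for x y
      using that by (simp add: utumi_embed_hom distrib_left distrib_right closed)
  qed
  moreover have "?M \<inter> J \<noteq> {0}" if J: "algebra_ideal scale J" "J \<noteq> {0}" for J
  proof -
    have "ideal (emb ` J)" unfolding ideal_def
    proof (intro conjI ballI)
      show "emb ` J \<subseteq> range emb" by blast
      show "0 \<in> emb ` J" by (rule image_eqI[of _ _ 0]) (use algebra_idealD(1)[OF J(1)] in auto)
      show "x - y \<in> emb ` J" if "x \<in> emb ` J" "y \<in> emb ` J" for x y
        using that algebra_idealD(4)[OF J(1)] by (auto simp flip: utumi_embed_diff)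
      show "x * r \<in> emb ` J" "r * x \<in> emb ` J" if "x \<in> emb ` J" "r \<in> range emb" for x r
        using that algebra_idealD(5,6)[OF J(1)] by (auto simp flip: utumi_embed_hom)
    qed
    moreover have "emb ` J \<noteq> {0}"
    proof -
      obtain x where "x \<in> J" "x \<noteq> 0" using J algebra_idealD(1)[OF J(1)] by blast
      then have "emb x \<noteq> 0" using inj_eq[OF utumi_embed_inj[OF ann], of x 0] by simp
      then show ?thesis using \<open>x \<in> J\<close> by blast
    qed
    ultimately have "I \<inter> emb ` J \<noteq> {0}" using I(1) by (simp add: essential_def)
    moreover have "0 \<in> I \<inter> emb ` J"
      using I(1) idealD(2)[of I] idealD(2)[OF \<open>ideal (emb ` J)\<close>] by (simp add: essential_def)
    ultimately obtain x where "x \<in> J" "emb x \<in> I" "emb x \<noteq> 0" by blast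
    then have "x \<in> ?M \<inter> J" "x \<noteq> 0" using I(2)[of "emb x"] by auto
    then show ?thesis by blast
  qed
  ultimately have "essential_ideal scale ?M" by (simp add: essential_ideal_def)
  then show ?thesis unfolding Qsm_iff by blast
qed

end

theorem corollary2p15:
  fixes scale :: "'f::comm_ring_1 \<Rightarrow> 'a::ring \<Rightarrow> 'a" and D :: "'a \<Rightarrow> 'a"
  assumes "assoc_algebra scale"
    and "semiprime_algebra scale"
    and "torsion_free TYPE('a)"
    and "SGPI_ring TYPE('a)"
    and "prime_algebra scale \<or> weakly_Noetherian scale \<or> finitely_cogenerated scale"
    and "essential_ideals_countably_closed scale"
    and "extended_centroid_integral scale"
    and "D \<in> Der scale"
    and "nil_derivation D \<or>
         (algebraic_derivation scale D \<and> algebraically_closed_field_char_0 TYPE('f))"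
  shows "Der_extension scale D \<in> C_Der scale \<inter> Inder_Qsm scale"
proof -
  interpret assoc_algebra scale by fact
  note semi = assms(2)
  obtain \<delta> where "quotient_derivation (range utumi_embed) (range (utumi_scalar scale)) \<delta>"
    and \<delta>: "\<And>x. \<delta> (utumi_embed x) = utumi_embed (D x)"
    using quotient_derivation_utumi[OF semi assms(3,7,8)] by blast
  then interpret quotient_derivation "range (utumi_embed :: 'a \<Rightarrow> _)" "range (utumi_scalar scale)" \<delta>
    by blast
  obtain f :: "'a utumi gen_poly" where f: "\<And>c. c \<in> ring_centre \<Longrightarrow> c \<noteq> 0 \<Longrightarrow> gp_coef c * f \<noteq> 0"
    "\<forall>\<phi> :: 'a utumi gen_poly \<Rightarrow> 'a utumi. is_ring_hom \<phi> \<and> \<phi> ` range gp_indet \<subseteq> range utumi_embed \<and>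
      (\<forall>q. \<phi> (gp_coef q) = q) \<longrightarrow> \<phi> f = 0"
    using assms(4) by (auto simp: SGPI_ring_def extended_centroid_def)
  obtain q where q: "q \<in> multipliers" "\<And>r. r \<in> range utumi_embed \<Longrightarrow> \<delta> r = r * q - q * r"
    using inner_of_gpi[OF central_idempotent_chain[OF semi assms(5)] f] by blast
  have inner: "utumi_embed (D x) = utumi_embed x * q - q * utumi_embed x" for x
    using q(2)[of "utumi_embed x"] \<delta> by simp
  have "q \<in> Qsm scale" by (rule multipliers_Qsm[OF semi q(1) inner])
  then have der: "Der_extension scale D = (\<lambda>x\<in>Qsm scale. x * q - q * x)"
    by (rule Der_extension_eqI[OF semi assms(8) _ inner])
  then have "Der_extension scale D \<in> Inder_Qsm scale"
    using \<open>q \<in> Qsm scale\<close> by (auto simp: Inder_Qsm_def)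
  \<comment> \<open>Membership in \<open>C_Der\<close> is shown by the one-term sum with coefficient
    1 and the derivation \<open>D\<close> itself.\<close>
  moreover have "Der_extension scale D = (\<lambda>p\<in>Qsm scale. \<Sum>i<1::nat. 1 * Der_extension scale D p)"
    unfolding der by (rule ext) simp
  then have "Der_extension scale D \<in> C_Der scale"
    unfolding C_Der_def using assms(8)
    by (intro CollectI exI[of _ 1] exI[of _ "\<lambda>_. 1"] exI[of _ "\<lambda>_. D"])
      (auto simp: extended_centroid_def ring_centre_def)
  ultimately show ?thesis by blast
qed

end
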